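(* Assume that the one-sided topological Markov shifts $(X_A,\sigma_A)$ and $(X_B,\sigma_B)$ are strongly continuous orbit equivalent. Then the dual actions on the $C^*$-crossed products of the Cuntz–Krieger algebras by their gauge actions are isomorphic: $$(\mathcal{O}_A\times_{\rho^A}\mathbb{T},\hat\rho^A,\mathbb{Z})\cong(\mathcal{O}_B\times_{\rho^B}\mathbb{T},\hat\rho^B,\mathbb{Z}),$$ that is, there is an isomorphism of $C^*$-algebras $\mathcal{O}_A\times_{\rho^A}\mathbb{T}\to\mathcal{O}_B\times_{\rho^B}\mathbb{T}$ intertwining the dual actions $\hat\rho^A$ and $\hat\rho^B$ of $\mathbb{Z}$.
   Context: $\mathbb{Z}_+$ is the set of nonnegative integers, $\mathbb{N}=\{1,2,\dots\}$. $A$ and $B$ are square matrices (of possibly different sizes $>1$) with entries in $\{0,1\}$, irreducible, and satisfying condition (I) of Cuntz–Krieger (for irreducible matrices: not a permutation matrix). For an $N\times N$ such matrix $A$, $X_A=\{(x_n)_{n\in\mathbb{N}}\in\{1,\dots,N\}^{\mathbb{N}} : A(x_n,x_{n+1})=1\ \forall n\}$ with the product topology and $\sigma_A((x_n)_n)=(x_{n+1})_n$. A continuous orbit map $h:(X_A,\sigma_A)\to(X_B,\sigma_B)$ is a local homeomorphism $h:X_A\to X_B$ for which there are continuous $k_1,l_1:X_A\to\mathbb{Z}_+$ with $\sigma_B^{k_1(x)}(h(\sigma_A(x)))=\sigma_B^{l_1(x)}(h(x))$ for all $x\in X_A$. It is a strongly continuous orbit map if there is a continuous $b_1:X_A\to\mathbb{Z}$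 with $l_1(x)-k_1(x)=1+b_1(x)-b_1(\sigma_A(x))$ for all $x\in X_A$ (the function $l_1-k_1$ does not depend on the choice of $k_1,l_1$). $(X_A,\sigma_A)$ and $(X_B,\sigma_B)$ are strongly continuous orbit equivalent if there is a homeomorphism $h:X_A\to X_B$ such that both $h$ and $h^{-1}$ are strongly continuous orbit maps. The Cuntz–Krieger algebra $\mathcal{O}_A$ is the (universal, by condition (I) unique) $C^*$-algebra generated by nonzero partial isometries $S_1,\dots,S_N$ with $\sum_{j=1}^N S_jS_j^*=1$ and $S_i^*S_i=\sum_{j=1}^N A(i,j)S_jS_j^*$. With $\mathbb{T}=\mathbb{R}/\mathbb{Z}$, the gauge action $\rho^A$ of $\mathbb{T}$ on $\mathcal{O}_A$ is given by $\rho^A_t(S_i)=e^{2\pi\sqrt{-1}t}S_i$; $\hat\rho^A$ is the dual action of $\mathbb{Z}=\hat{\mathbb{T}}$ on the crossed product $\mathcal{O}_A\times_{\rho^A}\mathbb{T}$. *)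

theory Defs
  imports "HOL-Analysis.Analysis"
begin

section \<open>C*-algebras\<close>

text \<open>Not necessarily unital; the zero algebra is allowed.\<close>

class cstar_algebra = real_normed_algebra + banach +
  fixes scaleC :: "complex \<Rightarrow> 'a \<Rightarrow> 'a" (infixr \<open>*\<^sub>C\<close> 75)
    and star :: "'a \<Rightarrow> 'a"
  assumes scaleC_add_right: "c *\<^sub>C (x + y) = c *\<^sub>C x + c *\<^sub>C y"
    and scaleC_add_left: "(c + d) *\<^sub>C x = c *\<^sub>C x + d *\<^sub>C x"
    and scaleC_scaleC: "c *\<^sub>C d *\<^sub>C x = (c * d) *\<^sub>C x"
    and scaleC_of_real: "complex_of_real r *\<^sub>C x = r *\<^sub>R x"
    and mult_scaleC_left: "(c *\<^sub>C x) * y = c *\<^sub>C (x * y)"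
    and mult_scaleC_right: "x * (c *\<^sub>C y) = c *\<^sub>C (x * y)"
    and norm_scaleC: "norm (c *\<^sub>C x) = cmod c * norm x"
    and star_star: "star (star x) = x"
    and star_add: "star (x + y) = star x + star y"
    and star_scaleC: "star (c *\<^sub>C x) = cnj c *\<^sub>C star x"
    and star_mult: "star (x * y) = star y * star x"
    and cstar_identity: "norm (star x * x) = (norm x)\<^sup>2"

class unital_cstar_algebra = cstar_algebra + real_normed_algebra_1

definition star_hom :: "('a::cstar_algebra \<Rightarrow> 'b::cstar_algebra) \<Rightarrow> bool" where
  "star_hom \<phi> \<longleftrightarrow>
     (\<forall>x y. \<phi> (x + y) = \<phi> x + \<phi> y) \<and>
     (\<forall>c x. \<phi> (c *\<^sub>C x) = c *\<^sub>C \<phi> x) \<and>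
     (\<forall>x y. \<phi> (x * y) = \<phi> x * \<phi> y) \<and>
     (\<forall>x. \<phi> (star x) = star (\<phi> x))"

definition star_iso :: "('a::cstar_algebra \<Rightarrow> 'b::cstar_algebra) \<Rightarrow> bool" where
  "star_iso \<phi> \<longleftrightarrow> star_hom \<phi> \<and> bij \<phi>"

definition cstar_subalgebra :: "'a::cstar_algebra set \<Rightarrow> bool" where
  "cstar_subalgebra M \<longleftrightarrow>
     closed M \<and> 0 \<in> M \<and>
     (\<forall>x\<in>M. \<forall>y\<in>M. x + y \<in> M \<and> x * y \<in> M) \<and>
     (\<forall>c. \<forall>x\<in>M. c *\<^sub>C x \<in> M) \<and>
     (\<forall>x\<in>M. star x \<in> M)"

definition partial_isometry :: "'a::cstar_algebra \<Rightarrow> bool" where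
  "partial_isometry s \<longleftrightarrow> s * star s * s = s"


section \<open>One-sided topological Markov shifts\<close>

definition zero_one_matrix :: "nat^'n^'n \<Rightarrow> bool" where
  "zero_one_matrix A \<longleftrightarrow> (\<forall>i j. A $ i $ j \<in> {0, 1})"

text \<open>The overloaded power of the type of vectors is componentwise, hence the iteration
  of the matrix product.\<close>

definition irreducible_matrix :: "nat^'n^'n \<Rightarrow> bool" where
  "irreducible_matrix A \<longleftrightarrow> (\<forall>i j. \<exists>m\<ge>1. (((**) A) ^^ m) (mat 1) $ i $ j > 0)"

definition permutation_matrix :: "nat^'n^'n \<Rightarrow> bool" where
  "permutation_matrix A \<longleftrightarrow>
     (\<exists>\<pi>. bij \<pi> \<and> (\<forall>i j. A $ i $ j = (if j = \<pi> i then 1 else 0)))"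

text \<open>The standing assumptions on a matrix. For irreducible matrices, condition (I) of
  Cuntz and Krieger means not being a permutation matrix.\<close>

definition markov_matrix :: "nat^'n^'n \<Rightarrow> bool" where
  "markov_matrix A \<longleftrightarrow>
     CARD('n) > 1 \<and> zero_one_matrix A \<and> irreducible_matrix A \<and> \<not> permutation_matrix A"

text \<open>Sequences are indexed from 0 instead of 1.\<close>

definition shift_space :: "nat^'n^'n \<Rightarrow> (nat \<Rightarrow> 'n) set" where
  "shift_space A = {x. \<forall>n. A $ x n $ x (Suc n) = 1}"

definition shift_top :: "nat^'n^'n \<Rightarrow> (nat \<Rightarrow> 'n) topology" where
  "shift_top A =
     subtopology (product_topology (\<lambda>_. discrete_topology UNIV) UNIV) (shift_space A)"

definition shift :: "(nat \<Rightarrow> 'n) \<Rightarrow> (nat \<Rightarrow> 'n)" where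
  "shift x = (\<lambda>n. x (Suc n))"


section \<open>Strongly continuous orbit equivalence\<close>

definition local_homeomorphism :: "'x topology \<Rightarrow> 'y topology \<Rightarrow> ('x \<Rightarrow> 'y) \<Rightarrow> bool" where
  "local_homeomorphism X Y h \<longleftrightarrow>
     (\<forall>x\<in>topspace X. \<exists>U. openin X U \<and> x \<in> U \<and> openin Y (h ` U) \<and>
        homeomorphic_map (subtopology X U) (subtopology Y (h ` U)) h)"

definition orbit_cocycles ::
  "nat^'n^'n \<Rightarrow> ((nat \<Rightarrow> 'n) \<Rightarrow> (nat \<Rightarrow> 'm)) \<Rightarrow>
     ((nat \<Rightarrow> 'n) \<Rightarrow> nat) \<Rightarrow> ((nat \<Rightarrow> 'n) \<Rightarrow> nat) \<Rightarrow> bool" where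
  "orbit_cocycles A h k l \<longleftrightarrow>
     continuous_map (shift_top A) (discrete_topology UNIV) k \<and>
     continuous_map (shift_top A) (discrete_topology UNIV) l \<and>
     (\<forall>x\<in>shift_space A. (shift ^^ k x) (h (shift x)) = (shift ^^ l x) (h x))"

definition continuous_orbit_map ::
  "nat^'n^'n \<Rightarrow> nat^'m^'m \<Rightarrow> ((nat \<Rightarrow> 'n) \<Rightarrow> (nat \<Rightarrow> 'm)) \<Rightarrow> bool" where
  "continuous_orbit_map A B h \<longleftrightarrow>
     local_homeomorphism (shift_top A) (shift_top B) h \<and> (\<exists>k l. orbit_cocycles A h k l)"

definition strongly_continuous_orbit_map ::
  "nat^'n^'n \<Rightarrow> nat^'m^'m \<Rightarrow> ((nat \<Rightarrow> 'n) \<Rightarrow> (nat \<Rightarrow> 'm)) \<Rightarrow> bool" where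
  "strongly_continuous_orbit_map A B h \<longleftrightarrow>
     continuous_orbit_map A B h \<and>
     (\<exists>k l (b :: _ \<Rightarrow> int). orbit_cocycles A h k l \<and>
        continuous_map (shift_top A) (discrete_topology UNIV) b \<and>
        (\<forall>x\<in>shift_space A. int (l x) - int (k x) = 1 + b x - b (shift x)))"

definition strongly_continuous_orbit_equivalent ::
  "nat^'n^'n \<Rightarrow> nat^'m^'m \<Rightarrow> bool" where
  "strongly_continuous_orbit_equivalent A B \<longleftrightarrow>
     (\<exists>h g. homeomorphic_maps (shift_top A) (shift_top B) h g \<and>
        strongly_continuous_orbit_map A B h \<and> strongly_continuous_orbit_map B A g)"


section \<open>Cuntz--Krieger algebras\<close>

text \<open>The type \<^typ>\<open>'a\<close>, with the generators \<open>S\<close>, is the Cuntz--Krieger algebra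
  of \<open>A\<close>. Condition (I) makes it unique up to an isomorphism preserving the generators.\<close>

definition cuntz_krieger_algebra ::
  "nat^'n^'n \<Rightarrow> ('n \<Rightarrow> 'a::unital_cstar_algebra) \<Rightarrow> bool" where
  "cuntz_krieger_algebra A S \<longleftrightarrow>
     (\<forall>i. S i \<noteq> 0 \<and> partial_isometry (S i)) \<and>
     (\<Sum>j\<in>UNIV. S j * star (S j)) = 1 \<and>
     (\<forall>i. star (S i) * S i = (\<Sum>j\<in>UNIV. of_nat (A $ i $ j) * (S j * star (S j)))) \<and>
     cstar_subalgebra hull (range S) = UNIV"

text \<open>Actions of the circle \<open>\<real>/\<int>\<close> are given as 1-periodic families indexed by \<open>\<real>\<close>.
  The automorphism described here exists by the uniqueness of the Cuntz--Krieger algebra,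
  and it is unique because \<open>S\<close> generates.\<close>

definition gauge_action ::
  "('n \<Rightarrow> 'a::unital_cstar_algebra) \<Rightarrow> real \<Rightarrow> 'a \<Rightarrow> 'a" where
  "gauge_action S t =
     (THE \<theta>. star_iso \<theta> \<and> (\<forall>i. \<theta> (S i) = cis (2 * pi * t) *\<^sub>C S i))"


section \<open>Crossed products by the circle\<close>

text \<open>\<open>C(\<real>/\<int>, 'a)\<close>, with the convolution product, involution and \<open>L\<^sup>1\<close>-norm
  belonging to an action \<open>\<alpha>\<close>. The circle carries its normalized Haar measure.\<close>

definition circle_functions :: "(real \<Rightarrow> 'a::cstar_algebra) set" where
  "circle_functions = {f. continuous_on UNIV f \<and> (\<forall>t. f (t + 1) = f t)}"

definition convolution ::
  "(real \<Rightarrow> 'a \<Rightarrow> 'a) \<Rightarrow> (real \<Rightarrow> 'a) \<Rightarrow> (real \<Rightarrow> 'a) \<Rightarrow> real \<Rightarrow> 'a::cstar_algebra" where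
  "convolution \<alpha> f g = (\<lambda>t. integral {0..1} (\<lambda>s. f s * \<alpha> s (g (t - s))))"

definition involution ::
  "(real \<Rightarrow> 'a \<Rightarrow> 'a) \<Rightarrow> (real \<Rightarrow> 'a) \<Rightarrow> real \<Rightarrow> 'a::cstar_algebra" where
  "involution \<alpha> f = (\<lambda>t. \<alpha> t (star (f (- t))))"

definition L1_norm :: "(real \<Rightarrow> 'a::cstar_algebra) \<Rightarrow> real" where
  "L1_norm f = integral {0..1} (\<lambda>t. norm (f t))"

text \<open>The \<open>L\<^sup>1\<close>-contractive C*-seminorms are exactly the functions
  \<open>f \<mapsto> norm (\<pi> f)\<close> for the \<open>L\<^sup>1\<close>-contractive *-homomorphisms \<open>\<pi>\<close> into C*-algebras
  (complete the quotient by the null space of the seminorm). Their supremum is the norm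
  of the enveloping C*-algebra; seminorms avoid quantifying over types.\<close>

definition L1_cstar_seminorm ::
  "(real \<Rightarrow> 'a \<Rightarrow> 'a) \<Rightarrow> ((real \<Rightarrow> 'a::cstar_algebra) \<Rightarrow> real) \<Rightarrow> bool" where
  "L1_cstar_seminorm \<alpha> p \<longleftrightarrow>
     (\<forall>f\<in>circle_functions. \<forall>g\<in>circle_functions.
        p (\<lambda>t. f t + g t) \<le> p f + p g \<and> p (convolution \<alpha> f g) \<le> p f * p g) \<and>
     (\<forall>c. \<forall>f\<in>circle_functions. p (\<lambda>t. c *\<^sub>C f t) = cmod c * p f) \<and>
     (\<forall>f\<in>circle_functions. p (convolution \<alpha> (involution \<alpha> f) f) = (p f)\<^sup>2) \<and>
     (\<forall>f\<in>circle_functions. 0 \<le> p f \<and> p f \<le> L1_norm f)"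

definition universal_norm ::
  "(real \<Rightarrow> 'a \<Rightarrow> 'a) \<Rightarrow> (real \<Rightarrow> 'a::cstar_algebra) \<Rightarrow> real" where
  "universal_norm \<alpha> f = (SUP p\<in>{p. L1_cstar_seminorm \<alpha> p}. p f)"

text \<open>The type \<^typ>\<open>'c\<close>, with the canonical map \<open>\<iota>\<close> from \<open>C(\<real>/\<int>, 'a)\<close>, is the crossed
  product of \<^typ>\<open>'a\<close> by \<open>\<alpha>\<close>, i.e. the (Hausdorff) completion of the convolution algebra
  in the universal norm.\<close>

definition crossed_product ::
  "(real \<Rightarrow> 'a \<Rightarrow> 'a) \<Rightarrow> ((real \<Rightarrow> 'a::cstar_algebra) \<Rightarrow> 'c::cstar_algebra) \<Rightarrow> bool" where
  "crossed_product \<alpha> \<iota> \<longleftrightarrow>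
     (\<forall>f\<in>circle_functions. \<forall>g\<in>circle_functions.
        \<iota> (\<lambda>t. f t + g t) = \<iota> f + \<iota> g \<and> \<iota> (convolution \<alpha> f g) = \<iota> f * \<iota> g) \<and>
     (\<forall>c. \<forall>f\<in>circle_functions. \<iota> (\<lambda>t. c *\<^sub>C f t) = c *\<^sub>C \<iota> f) \<and>
     (\<forall>f\<in>circle_functions. \<iota> (involution \<alpha> f) = star (\<iota> f)) \<and>
     (\<forall>f\<in>circle_functions. norm (\<iota> f) = universal_norm \<alpha> f) \<and>
     closure (\<iota> ` circle_functions) = UNIV"

text \<open>The dual group of \<open>\<real>/\<int>\<close> is \<open>\<int>\<close>, where \<open>n\<close> is the character
  \<open>t \<mapsto> exp (2 \<pi> i n t)\<close>; the dual action multiplies a function by the conjugate character.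
  The opposite convention only replaces \<open>n\<close> by \<open>-n\<close>.\<close>

definition dual_action ::
  "((real \<Rightarrow> 'a::cstar_algebra) \<Rightarrow> 'c::cstar_algebra) \<Rightarrow> int \<Rightarrow> 'c \<Rightarrow> 'c" where
  "dual_action \<iota> n =
     (THE \<theta>. star_iso \<theta> \<and>
        (\<forall>f\<in>circle_functions.
           \<theta> (\<iota> f) = \<iota> (\<lambda>t. cis (- 2 * pi * of_int n * t) *\<^sub>C f t)))"

end

theory Submission
  imports Defs
begin

text \<open>Let \<open>h\<close> be the orbit equivalence and \<open>b\<close> the function with \<open>l - k = 1 + b - b \<circ> shift\<close>. In the
  coordinates of \<open>B\<close> the shift of \<open>A\<close> replaces prefixes, so it defines a Cuntz--Krieger family of \<open>A\<close>
  inside the algebra of \<open>B\<close>; this family generates, since the same can be said with \<open>A\<close> and \<open>B\<close>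
  exchanged. By the uniqueness theorem there is an isomorphism \<open>\<phi>\<close> of the two algebras, and the equation
  for \<open>b\<close> says that \<open>\<phi>\<close> intertwines the gauge actions up to the diagonal unitaries
  \<open>u t = exp (-2 \<pi> i t (b \<circ> inv h))\<close>. Hence mapping \<open>f\<close> to \<open>t \<mapsto> \<phi> (f t) u t\<close> is an isometric isomorphism of
  the convolution algebras that commutes with the multiplication by characters.

  Uniqueness needs neither positivity nor a universal algebra. A polynomial with degrees in \<open>{-K..K}\<close>
  has \<open>2 K + 1\<close> homogeneous components, and compressing by suitable projections bounds the norm of each
  component, which is computed from matrix units, by the norm of the polynomial in any other
  Cuntz--Krieger family. Hence the norms of a polynomial in two families agree up to the factor
  \<open>2 K + 1\<close>. For the powers of \<open>star X * X\<close> this factor grows only linearly in the exponent, so by the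
  C*-identity the two norms of \<open>X\<close> are equal.\<close>


section \<open>Elementary facts on C*-algebras\<close>

text \<open>Dynamics and algebra are linked by a formal action: a polynomial in the generators acts
  on functions of a point and an integer, and this action determines it. The integer records the
  degree, so the gauge action becomes conjugation by exp(2 \<pi> i t n), and the orbit equivalence
  becomes the substitution of \<open>(h x, n + b x)\<close> for \<open>(x, n)\<close>. The equation
  for \<open>b\<close> is what turns the transported generator, of degree 1, into words of degrees
  \<open>l - k\<close>; compactness makes the sum of these words finite. Recovering the generators
  of \<open>B\<close> requires the coboundaries of both directions to fit together:
  \<open>b \<circ> g + b'\<close> must be shift invariant. A separate obstacle is that the relations
  only give range projections with sum 1. Their orthogonality, usually a consequence of positivity,
  is drawn from one spectral fact: a selfadjoint element of norm 1 has a spectral value of modulus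
  at least 1. The same fact shows that isomorphisms, which are defined algebraically, are
  isometric.\<close>

lemma scaleC_1 [simp]: "1 *\<^sub>C (x::'a::cstar_algebra) = x"
  using scaleC_of_real[of 1 x] by simp

lemma scaleC_0_left [simp]: "0 *\<^sub>C (x::'a::cstar_algebra) = 0"
  using scaleC_of_real[of 0 x] by simp

lemma scaleC_0_right [simp]: "c *\<^sub>C (0::'a::cstar_algebra) = 0"
  using scaleC_add_right[of c "0::'a" 0] by simp

lemma scaleC_minus_right: "c *\<^sub>C (- x) = - (c *\<^sub>C (x::'a::cstar_algebra))"
  using scaleC_add_right[of c x "-x"] by (simp add: eq_neg_iff_add_eq_0 add.commute)

lemma scaleC_minus_left: "(- c) *\<^sub>C x = - (c *\<^sub>C (x::'a::cstar_algebra))"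
  using scaleC_add_left[of c "-c" x] by (simp add: eq_neg_iff_add_eq_0 add.commute)

lemma scaleC_minus1 [simp]: "(- 1) *\<^sub>C x = - (x::'a::cstar_algebra)"
  by (simp add: scaleC_minus_left)

lemma scaleC_diff_right: "c *\<^sub>C (x - y) = c *\<^sub>C x - c *\<^sub>C (y::'a::cstar_algebra)"
  using scaleC_add_right[of c x "-y"] by (simp add: scaleC_minus_right)

lemma scaleC_diff_left: "(c - d) *\<^sub>C x = c *\<^sub>C x - d *\<^sub>C (x::'a::cstar_algebra)"
  using scaleC_add_left[of c "-d" x] by (simp add: scaleC_minus_left)

lemma scaleC_sum_right: "c *\<^sub>C (\<Sum>i\<in>I. f i) = (\<Sum>i\<in>I. c *\<^sub>C (f i::'a::cstar_algebra))"
  by (induction I rule: infinite_finite_induct) (auto simp: scaleC_add_right)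

lemma scaleC_sum_left: "(\<Sum>i\<in>I. f i) *\<^sub>C x = (\<Sum>i\<in>I. f i *\<^sub>C (x::'a::cstar_algebra))"
  by (induction I rule: infinite_finite_induct) (auto simp: scaleC_add_left)

lemma scaleC_eq_0_iff [simp]: "c *\<^sub>C x = 0 \<longleftrightarrow> c = 0 \<or> (x::'a::cstar_algebra) = 0"
  by (metis mult_eq_0_iff norm_eq_zero norm_scaleC)

lemma scaleR_scaleC: "r *\<^sub>R (x::'a::cstar_algebra) = complex_of_real r *\<^sub>C x"
  by (simp add: scaleC_of_real)

lemma bounded_linear_scaleC_right: "bounded_linear (\<lambda>x::'a::cstar_algebra. c *\<^sub>C x)"
  by (rule bounded_linear_intro[where K = "cmod c"])
     (auto simp: scaleC_add_right scaleR_scaleC scaleC_scaleC norm_scaleC mult.commute)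

lemma bounded_bilinear_scaleC: "bounded_bilinear (\<lambda>c (x::'a::cstar_algebra). c *\<^sub>C x)"
proof
  show "\<exists>K. \<forall>a b. norm (a *\<^sub>C (b::'a)) \<le> norm a * norm b * K"
    by (intro exI[of _ 1]) (simp add: norm_scaleC)
qed (auto simp: scaleC_add_right scaleC_add_left scaleR_scaleC scaleC_scaleC scaleR_conv_of_real mult.commute)

lemmas continuous_on_scaleC = bounded_bilinear.continuous_on[OF bounded_bilinear_scaleC]

lemma star_0 [simp]: "star (0::'a::cstar_algebra) = 0"
  using star_scaleC[of 0 "0::'a"] by simp

lemma star_minus: "star (- x) = - star (x::'a::cstar_algebra)"
  using star_add[of x "-x"] by (simp add: eq_neg_iff_add_eq_0 add.commute)

lemma star_diff: "star (x - y) = star x - star (y::'a::cstar_algebra)"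
  using star_add[of x "-y"] by (simp add: star_minus)

lemma star_sum: "star (\<Sum>i\<in>I. f i) = (\<Sum>i\<in>I. star (f i::'a::cstar_algebra))"
  by (induction I rule: infinite_finite_induct) (auto simp: star_add)

lemma star_1 [simp]: "star (1::'a::unital_cstar_algebra) = 1"
  by (metis mult_1 mult_1_right star_mult star_star)

lemma norm_star [simp]: "norm (star x) = norm (x::'a::cstar_algebra)"
proof -
  have *: "norm x \<le> norm (star x)" for x :: 'a
  proof (cases "norm x = 0")
    case False
    have "norm x * norm x \<le> norm (star x) * norm x"
      using norm_mult_ineq[of "star x" x] by (simp add: cstar_identity power2_eq_square)
    then show ?thesis using False by simp
  qed simp
  show ?thesis using *[of x] *[of "star x"] by (simp add: star_star)
qed

lemma bounded_linear_star: "bounded_linear (star :: 'a::cstar_algebra \<Rightarrow> 'a)"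
  by (rule bounded_linear_intro[where K = 1]) (auto simp: star_add scaleR_scaleC star_scaleC)

lemma star_eq_0_iff [simp]: "star x = 0 \<longleftrightarrow> (x::'a::cstar_algebra) = 0"
  by (metis norm_star norm_eq_zero)

lemma star_mult_self_eq_0_iff: "star x * x = 0 \<longleftrightarrow> (x::'a::cstar_algebra) = 0"
  by (metis cstar_identity norm_eq_zero power_eq_0_iff mult_zero_right)

lemma norm_square_selfadjoint: "star x = x \<Longrightarrow> norm (x * x) = (norm (x::'a::cstar_algebra))\<^sup>2"
  using cstar_identity[of x] by simp

lemma norm_projection:
  assumes "star p = p" "p * p = (p::'a::cstar_algebra)"
  shows "norm p \<le> 1" "p \<noteq> 0 \<Longrightarrow> norm p = 1"
proof -
  have "norm p = (norm p)\<^sup>2" using norm_square_selfadjoint[of p] assms by simp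
  then have "norm p = 0 \<or> norm p = 1" by (simp add: power2_eq_square)
  then show "norm p \<le> 1" "p \<noteq> 0 \<Longrightarrow> norm p = 1" by auto
qed

text \<open>By the C*-identity the norms of iterated squares of selfadjoint elements are exact powers, so a
  comparison of norms that deteriorates subexponentially is in fact a contraction.\<close>

lemma le_of_power_le:
  fixes a b C D :: real
  assumes "0 \<le> a" "0 \<le> b" "\<And>n::nat. a ^ (2 ^ n) \<le> (C * 2 ^ n + D) * b ^ (2 ^ n)"
  shows "a \<le> b"
proof (rule ccontr)
  assume ab: "\<not> a \<le> b"
  show False
  proof (cases "b = 0")
    case True
    then show False using assms(3)[of 0] ab by simp
  next
    case False
    define q where "q = a / b"
    have q: "q > 1" "b > 0" using False ab assms by (auto simp: q_def)
    have le: "q ^ (2 ^ n) \<le> C * real (2 ^ n) + D" for n :: nat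
      using assms(3)[of n] q by (simp add: q_def power_divide pos_divide_le_eq)
    have "(\<lambda>n::nat. (C * real n + D) / q ^ n) \<longlonglongrightarrow> C * 0 + D * 0"
    proof -
      have "(\<lambda>n::nat. real n / q ^ n) \<longlonglongrightarrow> 0"
        using q by (intro tendsto_eq_rhs[OF lim_n_over_pown]) auto
      moreover have "(\<lambda>n::nat. 1 / q ^ n) \<longlonglongrightarrow> 0"
        using LIMSEQ_power_zero[of "1/q"] q by (simp add: power_divide)
      ultimately have "(\<lambda>n::nat. C * (real n / q ^ n) + D * (1 / q ^ n)) \<longlonglongrightarrow> C * 0 + D * 0"
        by (intro tendsto_intros)
      then show ?thesis by (simp add: add_divide_distrib)
    qed
    then have "eventually (\<lambda>n::nat. (C * real n + D) / q ^ n < 1) sequentially"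
      by (intro order_tendstoD(2)) auto
    then obtain N where N: "\<And>n. n \<ge> N \<Longrightarrow> (C * real n + D) / q ^ n < 1"
      by (auto simp: eventually_sequentially)
    \<comment> \<open>The hypothesis concerns exponents \<open>2 ^ n\<close> only; the eventual
      bound applies at the index \<open>2 ^ N\<close> because this is at least
      \<open>N\<close>.\<close>
    have "(C * real (2 ^ N) + D) / q ^ (2 ^ N) < 1"
      by (rule N) (simp add: less_imp_le)
    then show False using le[of N] q by (simp add: pos_divide_less_eq)
  qed
qed

lemma norm_iterated_squares:
  fixes x :: "nat \<Rightarrow> 'a::cstar_algebra"
  assumes "star (x 0) = x 0" "\<And>n. x (Suc n) = x n * x n"
  shows "norm (x n) = norm (x 0) ^ (2 ^ n)" and "star (x n) = x n"
proof -
  show *: "star (x n) = x n" for n by (induction n) (auto simp: assms star_mult)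
  show "norm (x n) = norm (x 0) ^ (2 ^ n)"
    by (induction n)
       (simp_all add: assms(2) norm_square_selfadjoint[OF *] mult.commute flip: power_mult)
qed

text \<open>In the applications \<open>x 0\<close> and \<open>y 0\<close> are
  \<open>star Z * Z\<close> for one expression \<open>Z\<close> evaluated in two algebras. A factor
  linear in the exponent \<open>2 ^ n\<close> disappears when \<open>2 ^ n\<close>-th roots are
  taken.\<close>

lemma norm_le_of_iterated_squares:
  fixes x :: "nat \<Rightarrow> 'a::cstar_algebra" and y :: "nat \<Rightarrow> 'b::cstar_algebra"
  assumes "star (x 0) = x 0" "\<And>n. x (Suc n) = x n * x n"
    and "star (y 0) = y 0" "\<And>n. y (Suc n) = y n * y n"
    and "\<And>n. norm (x n) \<le> (C * 2 ^ n + D) * norm (y n)"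
  shows "norm (x 0) \<le> norm (y 0)"
proof (rule le_of_power_le)
  show "norm (x 0) ^ 2 ^ n \<le> (C * 2 ^ n + D) * norm (y 0) ^ 2 ^ n" for n
    using assms(5)[of n] norm_iterated_squares(1)[where x = x and n = n, OF assms(1,2)]
      norm_iterated_squares(1)[where x = y and n = n, OF assms(3,4)] by simp
qed auto


section \<open>Quasi-inverses and contractivity of homomorphisms\<close>

text \<open>\<open>quasi_inverse a w\<close> expresses that \<open>1 + w\<close> is the inverse of \<open>1 - a\<close> in the unitization.\<close>

definition quasi_inverse :: "'a::cstar_algebra \<Rightarrow> 'a \<Rightarrow> bool" where
  "quasi_inverse a w \<longleftrightarrow> w = a + a * w \<and> w = a + w * a"

text \<open>In the unitization \<open>1 + w\<close> is a right inverse and \<open>1 + v\<close> a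
  left inverse of \<open>1 - a\<close>, and such inverses agree.\<close>

lemma quasi_inverse_unique:
  assumes "w = a + a * w" "v = a + v * (a::'a::cstar_algebra)"
  shows "v = w"
proof -
  have 1: "a * w = w - a" and 2: "v * a = v - a" using assms(1,2)[symmetric] by (simp_all add: algebra_simps)
  have "v * w - v * a = v * (a * w)" by (simp add: 1 right_diff_distrib)
  also have "\<dots> = v * w - a * w" by (simp add: 2 left_diff_distrib flip: mult.assoc)
  finally show ?thesis by (simp add: 1 2)
qed

lemma quasi_inverse_eq: "quasi_inverse a w \<Longrightarrow> quasi_inverse a v \<Longrightarrow> v = w"
  unfolding quasi_inverse_def by (metis quasi_inverse_unique)

text \<open>Both defining equations are fixed point equations of contractions with constant
  \<open>norm a\<close>; Banach's theorem takes the place of the Neumann series.\<close>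

lemma quasi_inverse_exists:
  fixes a :: "'a::cstar_algebra"
  assumes "norm a < 1"
  shows "\<exists>w. quasi_inverse a w"
proof -
  have "\<exists>!w. a + a * w = w"
    by (rule banach_fix_type[of "norm a"])
       (use assms norm_mult_ineq[of a] in \<open>auto simp: dist_norm simp flip: right_diff_distrib\<close>)
  moreover have "\<exists>!w. a + w * a = w"
    by (rule banach_fix_type[of "norm a"])
       (use assms norm_mult_ineq[of _ a] in \<open>auto simp: dist_norm mult.commute[of "norm a"] simp flip: left_diff_distrib\<close>)
  ultimately obtain w v where wv: "w = a + a * w" "v = a + v * a" by metis
  then show ?thesis using quasi_inverse_unique[OF wv] by (auto simp: quasi_inverse_def)
qed

text \<open>Partial fractions: 1 / (1 - a^2) is the mean of 1 / (1 - a) and 1 / (1 + a).\<close>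

lemma quasi_inverse_square:
  fixes a :: "'a::cstar_algebra"
  assumes "quasi_inverse a w" "quasi_inverse (- a) v"
  shows "quasi_inverse (a * a) ((1/2) *\<^sub>C (w + v))"
proof -
  have w: "w = a + a * w" "w = a + w * a" and v: "v = - a - a * v" "v = - a - v * a"
    using assms by (simp_all add: quasi_inverse_def)
  have 1: "a * w = w - a" using w(1) by (metis add_diff_cancel_left')
  have 2: "w * a = w - a" using w(2) by (metis add_diff_cancel_left')
  have 3: "a * v = - v - a" using v(1) by (metis add.commute diff_add_cancel minus_add_distrib uminus_add_conv_diff minus_minus)
  have 4: "v * a = - v - a" using v(2) by (metis add.commute diff_add_cancel minus_add_distrib uminus_add_conv_diff minus_minus)
  have h: "(1/2) *\<^sub>C (z + z) = z" for z :: 'a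
    using scaleC_add_left[of "1/2" "1/2" z] by (simp add: scaleC_add_right)
  have "a * a * (w + v) = (w + v) - (a * a + a * a)"
    by (simp add: mult.assoc 1 3 distrib_left right_diff_distrib)
  then have "(1/2) *\<^sub>C (a * a * (w + v)) = (1/2) *\<^sub>C (w + v) - a * a"
    by (simp only: scaleC_diff_right h)
  moreover have "(w + v) * (a * a) = (w + v) - (a * a + a * a)"
    by (simp add: 2 4 distrib_right left_diff_distrib flip: mult.assoc)
  then have "(1/2) *\<^sub>C ((w + v) * (a * a)) = (1/2) *\<^sub>C (w + v) - a * a"
    by (simp only: scaleC_diff_right h)
  ultimately show ?thesis
    by (auto simp: quasi_inverse_def mult_scaleC_left mult_scaleC_right)
qed

text \<open>This is the resolvent identity (1 + w) - (1 + v) = (1 + w) (a - b) (1 + v), multiplied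
  out to avoid the unit.\<close>

lemma quasi_inverse_diff:
  fixes a b :: "'a::cstar_algebra"
  assumes "quasi_inverse a w" "quasi_inverse b v"
  shows "w - v = (a - b) + w * (a - b) + (a - b) * v + w * (a - b) * v"
proof -
  from assms have 1: "w * a = w - a" "b * v = v - b"
    unfolding quasi_inverse_def by (metis add_diff_cancel_left')+
  have "w * (a - b) * v = (w * a) * v - w * (b * v)" by (simp add: algebra_simps)
  also have "\<dots> = w * b - a * v" by (simp add: 1 algebra_simps)
  finally show ?thesis by (simp add: 1 algebra_simps)
qed

lemma norm_quasi_inverse_diff:
  fixes a b :: "'a::cstar_algebra"
  assumes "quasi_inverse a w" "quasi_inverse b v"
  shows "norm (w - v) \<le> (1 + norm w) * norm (a - b) * (1 + norm v)"
proof -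
  have "norm (w - v) \<le> norm (a - b) + norm (w * (a - b)) + norm ((a - b) * v) + norm (w * (a - b) * v)"
    unfolding quasi_inverse_diff[OF assms] by (intro norm_triangle_le add_mono) auto
  also have "\<dots> \<le> norm (a - b) + norm w * norm (a - b) + norm (a - b) * norm v + norm w * norm (a - b) * norm v"
    using norm_mult_ineq[of w "a - b"] norm_mult_ineq[of "a - b" v] norm_mult_ineq[of "w * (a - b)" v]
      mult_right_mono[OF norm_mult_ineq[of w "a - b"], of "norm v"] by simp
  finally show ?thesis by (simp add: algebra_simps)
qed

lemma continuous_on_quasi_inverse:
  fixes y :: "'a::cstar_algebra"
  assumes w: "\<And>z. z \<in> U \<Longrightarrow> quasi_inverse (z *\<^sub>C y) (w z)"
  shows "continuous_on U w"
  unfolding continuous_on_def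
proof
  fix z assume z: "z \<in> U"
  define K where "K = 1 + norm (w z)"
  have K: "K \<ge> 1" by (simp add: K_def)
  \<comment> \<open>Small enough that \<open>dist u z * norm y * K\<close> is at most 1/2; the
    unknown \<open>norm (w u)\<close> in the resolvent estimate can then be absorbed into the left
    side.\<close>
  define e where "e = 1 / (2 * K * (1 + norm y))"
  have e: "e > 0" using K by (simp add: e_def add_pos_nonneg)
  have bound: "norm (w u - w z) \<le> 2 * K * K * norm y * dist u z" if u: "u \<in> U" "dist u z < e" for u
  proof -
    have d: "norm (w u - w z) \<le> (1 + norm (w u)) * (dist u z * norm y) * K"
      using norm_quasi_inverse_diff[OF w[OF u(1)] w[OF z]]
      by (simp add: norm_scaleC dist_norm K_def flip: scaleC_diff_left)
    have "dist u z * norm y * K \<le> e * (1 + norm y) * K"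
      using u K e by (intro mult_right_mono mult_mono) (auto simp: less_imp_le)
    also have "\<dots> = 1/2" using K by (simp add: e_def field_simps add_nonneg_eq_0_iff)
    finally have h: "dist u z * norm y * K \<le> 1/2" .
    have "1 + norm (w u) \<le> K + norm (w u - w z)"
      using norm_triangle_sub[of "w u" "w z"] by (simp add: K_def)
    also have "\<dots> \<le> K + (1 + norm (w u)) * (1/2)"
      using d mult_left_mono[OF h, of "1 + norm (w u)"] by (simp add: mult.assoc)
    finally have "1 + norm (w u) \<le> 2 * K" by (simp add: field_simps)
    then have "(1 + norm (w u)) * (dist u z * norm y) * K \<le> 2 * K * (dist u z * norm y) * K"
      using K by (intro mult_right_mono) auto
    then show ?thesis using d by (simp add: ac_simps)
  qed
  have "((\<lambda>u. w u - w z) \<longlongrightarrow> 0) (at z within U)"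
  proof (rule Lim_null_comparison)
    show "\<forall>\<^sub>F u in at z within U. norm (w u - w z) \<le> 2 * K * K * norm y * dist u z"
      using e bound by (auto simp: eventually_at intro!: exI[of _ e])
    show "((\<lambda>u. 2 * K * K * norm y * dist u z) \<longlongrightarrow> 0) (at z within U)"
      by (intro tendsto_eq_intros) auto
  qed
  then show "(w \<longlongrightarrow> w z) (at z within U)" by (simp add: LIM_zero_iff)
qed

text \<open>Rickart's argument: averaging over roots of unity turns quasi-inverses of \<open>z y\<close> into
  quasi-inverses of \<open>z\<^sup>n y\<^sup>n\<close>. These change uniformly little between \<open>|z| = 1\<close> and
  \<open>|z| = r\<close>, although they tend to 0 on the circle of radius \<open>r < 1\<close>.\<close>

lemma exists_not_quasi_invertible:
  fixes y :: "'a::cstar_algebra"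
  assumes "star y = y" "norm y = 1"
  shows "\<exists>z. cmod z \<le> 1 \<and> \<not> (\<exists>w. quasi_inverse (z *\<^sub>C y) w)"
proof (rule ccontr)
  assume "\<not> ?thesis"
  then obtain w where w: "\<And>z. z \<in> cball 0 1 \<Longrightarrow> quasi_inverse (z *\<^sub>C y) (w z)"
    by (auto simp: dist_norm) metis
  have "compact (w ` cball 0 1)"
    by (intro compact_continuous_image continuous_on_quasi_inverse[OF w]) auto
  then obtain B where B: "B > 0" "\<And>z. z \<in> cball 0 1 \<Longrightarrow> norm (w z) \<le> B"
    using compact_imp_bounded bounded_pos by (metis image_eqI)
  \<comment> \<open>A Lipschitz constant on the unit disc, from the resolvent identity and the bound
    \<open>B\<close>.\<close>
  define C where "C = (1 + B) * (1 + B)"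
  have C: "C > 0" using B by (simp add: C_def)
  define Y where "Y = (\<lambda>n. ((\<lambda>a. a * a) ^^ n) y)"
  have Y: "norm (Y n) = 1" for n
    using norm_iterated_squares(1)[of Y n] assms by (simp add: Y_def)
  \<comment> \<open>The constant \<open>C\<close> does not depend on \<open>n\<close>: the induction
    step averages the quasi-inverses at the two square roots of \<open>z\<close>, and averaging does
    not increase differences.\<close>
  have ex: "(\<exists>v. quasi_inverse (z *\<^sub>C Y n) v) \<and>
      (\<forall>r a b. 0 \<le> r \<longrightarrow> r \<le> 1 \<longrightarrow> quasi_inverse (z *\<^sub>C Y n) a \<longrightarrow>
         quasi_inverse ((complex_of_real (r ^ (2 ^ n)) * z) *\<^sub>C Y n) b \<longrightarrow> norm (a - b) \<le> C * (1 - r))"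
    if "cmod z \<le> 1" for n z
    using that
  proof (induction n arbitrary: z)
    case 0
    have "norm (a - b) \<le> C * (1 - r)"
      if r: "0 \<le> r" "r \<le> 1" and ab: "quasi_inverse (z *\<^sub>C y) a" "quasi_inverse ((complex_of_real r * z) *\<^sub>C y) b"
      for r a b
    proof -
      have rz: "cmod (complex_of_real r * z) \<le> 1"
        using r 0 by (simp add: norm_mult mult_le_one)
      have "a = w z" "b = w (complex_of_real r * z)"
        using quasi_inverse_eq[OF w[of z] ab(1)] quasi_inverse_eq[OF w[of "complex_of_real r * z"] ab(2)] 0 rz
        by (simp_all add: dist_norm)
      then have nab: "norm a \<le> B" "norm b \<le> B" using B(2) 0 rz by auto
      have "z *\<^sub>C y - (complex_of_real r * z) *\<^sub>C y = (complex_of_real (1 - r) * z) *\<^sub>C y"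
        by (simp add: algebra_simps flip: scaleC_diff_left)
      then have "norm (z *\<^sub>C y - (complex_of_real r * z) *\<^sub>C y) = \<bar>1 - r\<bar> * cmod z"
        by (simp only: norm_scaleC assms norm_mult norm_of_real)
      then have "norm (a - b) \<le> (1 + norm a) * ((1 - r) * cmod z) * (1 + norm b)"
        using norm_quasi_inverse_diff[OF ab] r by simp
      also have "\<dots> \<le> (1 + B) * ((1 - r) * 1) * (1 + B)"
        using nab r 0 B(1) by (intro mult_mono) auto
      finally show ?thesis by (simp add: C_def algebra_simps)
    qed
    moreover have "\<exists>v. quasi_inverse (z *\<^sub>C y) v" using w[of z] 0 by (auto simp: dist_norm)
    ultimately show ?case by (simp add: Y_def)
  next
    case (Suc n)
    define u where "u = csqrt z"
    have u: "u * u = z" "cmod u \<le> 1"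
      using Suc.prems by (simp_all add: u_def norm_csqrt flip: power2_eq_square)
    have sq: "(s *\<^sub>C Y n) * (s *\<^sub>C Y n) = (s * s) *\<^sub>C Y (Suc n)" for s
      by (simp add: Y_def mult_scaleC_left mult_scaleC_right scaleC_scaleC)
    from Suc.IH[of u] Suc.IH[of "-u"] u(2) obtain v v'
      where v: "quasi_inverse (u *\<^sub>C Y n) v" "quasi_inverse ((-u) *\<^sub>C Y n) v'" by auto
    have qv: "quasi_inverse (z *\<^sub>C Y (Suc n)) ((1/2) *\<^sub>C (v + v'))"
      using quasi_inverse_square[OF v(1), of v'] v(2) by (simp add: sq u scaleC_minus_left)
    have "norm (a - b) \<le> C * (1 - r)"
      if r: "0 \<le> r" "r \<le> 1" and ab: "quasi_inverse (z *\<^sub>C Y (Suc n)) a"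
         "quasi_inverse ((complex_of_real (r ^ (2 ^ Suc n)) * z) *\<^sub>C Y (Suc n)) b" for r a b
    proof -
      define s where "s = complex_of_real (r ^ (2 ^ n)) * u"
      have "cmod (complex_of_real (r ^ (2 ^ n))) \<le> 1"
        using r by (simp add: norm_power power_le_one)
      then have s1: "cmod s \<le> 1" using u(2) by (simp only: s_def norm_mult) (simp add: mult_le_one)
      have ss: "s * s = complex_of_real (r ^ (2 ^ Suc n)) * z"
      proof -
        have "r ^ (2 ^ Suc n) = r ^ (2 ^ n) * r ^ (2 ^ n)" by (simp add: mult_2 flip: power_add)
        then show ?thesis unfolding s_def u(1)[symmetric] by simp
      qed
      from Suc.IH[of s] Suc.IH[of "-s"] s1 obtain t t'
        where t: "quasi_inverse (s *\<^sub>C Y n) t" "quasi_inverse ((-s) *\<^sub>C Y n) t'" by auto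
      have qt: "quasi_inverse ((complex_of_real (r ^ (2 ^ Suc n)) * z) *\<^sub>C Y (Suc n)) ((1/2) *\<^sub>C (t + t'))"
        using quasi_inverse_square[OF t(1), of t'] t(2) by (simp only: sq ss scaleC_minus_left)
      have a: "a = (1/2) *\<^sub>C (v + v')" and b: "b = (1/2) *\<^sub>C (t + t')"
        using quasi_inverse_eq[OF qv ab(1)] quasi_inverse_eq[OF qt ab(2)] by simp_all
      have "norm (v - t) \<le> C * (1 - r)" "norm (v' - t') \<le> C * (1 - r)"
        using Suc.IH[of u] Suc.IH[of "-u"] u(2) r v t by (auto simp: s_def)
      moreover have "a - b = (1/2) *\<^sub>C ((v - t) + (v' - t'))"
        by (simp add: a b flip: scaleC_diff_right) (simp add: algebra_simps)
      then have "norm (a - b) \<le> (1/2) * (norm (v - t) + norm (v' - t'))"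
        by (simp add: norm_scaleC norm_triangle_ineq)
      ultimately show ?thesis by simp
    qed
    then show ?case using qv by blast
  qed
  \<comment> \<open>This choice makes the change \<open>C * (1 - r)\<close> at most 1/8, and a
    radius \<open>r ^ (2 ^ n)\<close> below 1/9 gives \<open>norm b \<le> 1/8\<close>. The resulting
    \<open>norm a \<le> 1/4\<close> contradicts \<open>Y n = a - Y n * a\<close> with
    \<open>norm (Y n) = 1\<close>.\<close>
  define r where "r = max 0 (1 - 1 / (8 * C))"
  have r: "0 \<le> r" "r < 1" "C * (1 - r) \<le> 1/8" using C by (auto simp: r_def max_def field_simps)
  have "(\<lambda>n. r ^ n) \<longlonglongrightarrow> 0" using r by (intro LIMSEQ_power_zero) auto
  then have "eventually (\<lambda>n. r ^ n < 1/9) sequentially" by (intro order_tendstoD(2)) auto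
  then obtain n where n: "\<And>m. m \<ge> n \<Longrightarrow> r ^ m < 1/9" by (auto simp: eventually_sequentially)
  define s where "s = r ^ (2 ^ n)"
  have s: "0 \<le> s" "s < 1/9" unfolding s_def using r n by (auto simp: less_imp_le)
  obtain a where a: "quasi_inverse (Y n) a" using ex[of 1 n] by auto
  obtain b where b: "quasi_inverse (complex_of_real s *\<^sub>C Y n) b"
    using ex[of "complex_of_real s" n] s by auto
  have "norm b \<le> norm (complex_of_real s *\<^sub>C Y n) + norm (complex_of_real s *\<^sub>C Y n) * norm b"
    using b norm_triangle_ineq[of "complex_of_real s *\<^sub>C Y n" "complex_of_real s *\<^sub>C Y n * b"]
      norm_mult_ineq[of "complex_of_real s *\<^sub>C Y n" b] unfolding quasi_inverse_def by simp
  then have "norm b \<le> s + s * norm b" using s by (simp add: norm_scaleC Y)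
  moreover have "s * norm b \<le> 1/9 * norm b" using s by (intro mult_right_mono) auto
  ultimately have nb: "norm b \<le> 1/8" using s by simp
  have "norm (a - b) \<le> C * (1 - r)"
    using ex[of 1 n] a b r(1,2) unfolding s_def by simp
  then have "norm (a - b) \<le> 1/8" using r(3) by linarith
  then have na: "norm a \<le> 1/4" using norm_triangle_sub[of a b] nb by simp
  have "Y n = a - Y n * a" using a unfolding quasi_inverse_def by (metis eq_diff_eq)
  then have "norm (Y n) \<le> norm a + norm (Y n) * norm a"
    using norm_triangle_ineq4[of a "Y n * a"] norm_mult_ineq[of "Y n" a] by simp
  then show False using na by (simp add: Y)
qed

section \<open>Norms under star homomorphisms and isomorphisms\<close>

lemma star_homD:
  assumes "star_hom \<phi>"
  shows "\<phi> (x + y) = \<phi> x + \<phi> y" "\<phi> (c *\<^sub>C x) = c *\<^sub>C \<phi> x" "\<phi> (x * y) = \<phi> x * \<phi> y" "\<phi> (star x) = star (\<phi> x)"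
    "\<phi> 0 = 0" "\<phi> (- x) = - \<phi> x" "\<phi> (x - y) = \<phi> x - \<phi> y" "\<phi> (sum f I) = (\<Sum>i\<in>I. \<phi> (f i))"
proof -
  note h = assms[unfolded star_hom_def]
  show 1: "\<phi> (x + y) = \<phi> x + \<phi> y" "\<phi> (x * y) = \<phi> x * \<phi> y" "\<phi> (star x) = star (\<phi> x)" for x y
    using h by auto
  show c: "\<phi> (c *\<^sub>C x) = c *\<^sub>C \<phi> x" for c x using h by auto
  show 0: "\<phi> 0 = 0" using c[of 0 0] by simp
  show m: "\<phi> (- x) = - \<phi> x" for x using c[of "-1" x] by simp
  show "\<phi> (x - y) = \<phi> x - \<phi> y" using 1(1)[of x "-y"] by (simp add: m)
  show "\<phi> (sum f I) = (\<Sum>i\<in>I. \<phi> (f i))"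
    by (induction I rule: infinite_finite_induct) (auto simp: 0 1)
qed

text \<open>Homomorphisms preserve quasi-inverses. If \<open>\<phi>\<close> enlarged a selfadjoint
  \<open>x\<close>, some multiple of \<open>\<phi> x\<close> would have no quasi-inverse although
  the same multiple of \<open>x\<close> has norm less than 1. The C*-identity extends the estimate
  to all elements.\<close>

lemma star_hom_contractive:
  assumes "star_hom \<phi>"
  shows "norm (\<phi> x) \<le> norm x"
proof -
  note h = star_homD[OF assms]
  have sa: "norm (\<phi> x) \<le> norm x" if x: "star x = x" for x
  proof (rule ccontr)
    assume n: "\<not> norm (\<phi> x) \<le> norm x"
    define c where "c = complex_of_real (1 / norm (\<phi> x))"
    have p: "norm (\<phi> x) > 0" using n by (auto simp: not_le intro: le_less_trans[OF norm_ge_zero])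
    have "star (c *\<^sub>C \<phi> x) = c *\<^sub>C \<phi> x" by (simp add: star_scaleC c_def x flip: h(4))
    moreover have "norm (c *\<^sub>C \<phi> x) = 1" using p by (simp add: norm_scaleC c_def norm_divide)
    ultimately obtain z where z: "cmod z \<le> 1" "\<And>w. \<not> quasi_inverse (z *\<^sub>C c *\<^sub>C \<phi> x) w"
      using exists_not_quasi_invertible[of "c *\<^sub>C \<phi> x"] by auto
    have "norm (z *\<^sub>C c *\<^sub>C x) = cmod z * (norm x / norm (\<phi> x))"
      by (simp add: norm_scaleC c_def norm_divide)
    also have "\<dots> \<le> 1 * (norm x / norm (\<phi> x))" using z by (intro mult_right_mono) auto
    also have "\<dots> < 1" using n p by simp
    finally obtain w where "quasi_inverse (z *\<^sub>C c *\<^sub>C x) w" using quasi_inverse_exists by blast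
    then have "quasi_inverse (\<phi> (z *\<^sub>C c *\<^sub>C x)) (\<phi> w)"
      unfolding quasi_inverse_def by (simp flip: h(1) h(3))
    then show False using z(2) by (simp add: h(2))
  qed
  have "(norm (\<phi> x))\<^sup>2 = norm (\<phi> (star x * x))" by (simp add: h cstar_identity)
  also have "\<dots> \<le> norm (star x * x)" by (rule sa) (simp add: star_mult star_star)
  finally show ?thesis by (simp add: cstar_identity)
qed

lemma star_iso_inv:
  assumes "star_iso \<phi>"
  shows "star_iso (inv \<phi>)"
proof -
  have b: "bij \<phi>" and h: "star_hom \<phi>" using assms by (auto simp: star_iso_def)
  note i = bij_is_inj[OF b] and s = surj_f_inv_f[OF bij_is_surj[OF b]]
  have "star_hom (inv \<phi>)"
    unfolding star_hom_def
    by (intro conjI allI; rule injD[OF i]) (simp_all add: s star_homD[OF h])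
  then show ?thesis using b by (simp add: star_iso_def bij_imp_bij_inv)
qed

lemma star_iso_norm:
  assumes "star_iso \<phi>"
  shows "norm (\<phi> x) = norm x"
proof (rule antisym)
  show "norm (\<phi> x) \<le> norm x" using assms by (auto simp: star_iso_def star_hom_contractive)
  have "norm (inv \<phi> (\<phi> x)) \<le> norm (\<phi> x)"
    using star_iso_inv[OF assms] by (auto simp: star_iso_def star_hom_contractive)
  then show "norm x \<le> norm (\<phi> x)" using assms by (simp add: star_iso_def inv_f_f bij_is_inj)
qed

lemma star_iso_bounded_linear:
  assumes "star_iso \<phi>"
  shows "bounded_linear \<phi>"
  using assms star_iso_norm[OF assms]
  by (intro bounded_linear_intro[where K = 1]) (auto simp: star_iso_def scaleR_scaleC star_homD)

lemma star_iso_continuous: "star_iso \<phi> \<Longrightarrow> continuous_on UNIV \<phi>"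
  using star_iso_bounded_linear linear_continuous_on by blast

lemma star_iso_comp: "star_iso \<phi> \<Longrightarrow> star_iso \<psi> \<Longrightarrow> star_iso (\<lambda>x. \<phi> (\<psi> x))"
  unfolding star_iso_def star_hom_def by (auto intro: bij_comp[unfolded o_def])

lemma star_iso_eq_on_dense:
  assumes "star_iso \<phi>" "star_iso \<psi>" "closure X = UNIV" "\<And>x. x \<in> X \<Longrightarrow> \<phi> x = \<psi> x"
  shows "\<phi> = \<psi>"
proof
  fix x
  have "closed {x. \<phi> x = \<psi> x}"
    using assms by (intro closed_Collect_eq star_iso_continuous)
  then have "closure X \<subseteq> {x. \<phi> x = \<psi> x}" using assms by (intro closure_minimal) auto
  then show "\<phi> x = \<psi> x" using assms by auto
qed

section \<open>Spectral discs and the orthogonality of projections with sum 1\<close>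

lemma quasi_inverse_unital:
  fixes a :: "'a::unital_cstar_algebra"
  assumes "norm (1 - z *\<^sub>C (1 - a)) < 1"
  shows "\<exists>w. quasi_inverse a w"
proof -
  obtain v where v: "quasi_inverse (1 - z *\<^sub>C (1 - a)) v" using quasi_inverse_exists[OF assms] by blast
  have 1: "z *\<^sub>C (1 - a) * (1 + v) = 1" "(1 + v) * (z *\<^sub>C (1 - a)) = 1"
    using v unfolding quasi_inverse_def by (simp_all add: algebra_simps)
  define w where "w = z *\<^sub>C (1 + v) - 1"
  have "(1 - a) * (1 + w) = 1" "(1 + w) * (1 - a) = 1"
    using 1 by (simp_all add: w_def mult_scaleC_left mult_scaleC_right)
  then have "quasi_inverse a w" unfolding quasi_inverse_def by (simp add: algebra_simps)
  then show ?thesis ..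
qed

text \<open>The assumptions confine the spectrum of \<open>b\<close> to two discs that meet only in 0.\<close>

lemma selfadjoint_eq_0:
  fixes b :: "'a::unital_cstar_algebra"
  assumes "star b = b" "norm (1 - b) \<le> 1" "norm (m *\<^sub>R 1 + b) \<le> m" "m > 0"
  shows "b = 0"
proof (rule ccontr)
  assume "b \<noteq> 0"
  define y where "y = complex_of_real (1 / norm b) *\<^sub>C b"
  have "star y = y" "norm y = 1"
    using \<open>b \<noteq> 0\<close> assms(1) by (simp_all add: y_def star_scaleC norm_scaleC norm_divide)
  then obtain z where z: "cmod z \<le> 1" "\<not> (\<exists>w. quasi_inverse (z *\<^sub>C y) w)"
    using exists_not_quasi_invertible by blast
  define k where "k = z * complex_of_real (1 / norm b)"
  have k: "\<not> (\<exists>w. quasi_inverse (k *\<^sub>C b) w)" using z(2) by (simp add: k_def y_def scaleC_scaleC)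
  have "k \<noteq> 0"
  proof
    assume "k = 0"
    then have "quasi_inverse (k *\<^sub>C b) 0" by (simp add: quasi_inverse_def)
    then show False using k by blast
  qed
  \<comment> \<open>\<open>v\<close> is a spectral value of \<open>b\<close>: the element
    \<open>1 - k b\<close> equals \<open>k (v - b)\<close> and is not invertible.\<close>
  define v where "v = 1 / k"
  have v: "k * v = 1" "v \<noteq> 0" using \<open>k \<noteq> 0\<close> by (simp_all add: v_def)
  have "cmod (v - 1) \<le> 1"
  proof (rule ccontr)
    assume c: "\<not> cmod (v - 1) \<le> 1"
    \<comment> \<open>With this factor \<open>s (1 - k b)\<close> equals 1 + (1 - b) / (v - 1), so a
      value \<open>v\<close> outside the disc brings it within distance less than 1 of 1.\<close>
    define s where "s = 1 / (k * (v - 1))"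
    have sk: "s * k = 1 / (v - 1)" and s: "s = v / (v - 1)"
      using \<open>k \<noteq> 0\<close> v(1) by (simp_all add: s_def) (metis mult_divide_mult_cancel_left)
    have "1 - s *\<^sub>C (1 - k *\<^sub>C b) = (1 - s) *\<^sub>C 1 + (s * k) *\<^sub>C b"
      by (simp add: scaleC_diff_right scaleC_diff_left scaleC_scaleC)
    also have "1 - s = - (1 / (v - 1))" using c by (cases "v = 1") (auto simp: s field_simps)
    also have "(- (1 / (v - 1))) *\<^sub>C 1 + (s * k) *\<^sub>C b = (- (1 / (v - 1))) *\<^sub>C (1 - b)"
      by (simp add: sk scaleC_diff_right scaleC_minus_left)
    finally have "norm (1 - s *\<^sub>C (1 - k *\<^sub>C b)) = norm (1 - b) / cmod (v - 1)"
      by (simp only: norm_scaleC norm_minus_cancel norm_divide norm_one) simp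
    also have "\<dots> < 1" using c assms(2) by (simp add: divide_less_eq)
    finally show False using quasi_inverse_unital k by blast
  qed
  moreover have "cmod (v + of_real m) \<le> m"
  proof (rule ccontr)
    assume c: "\<not> cmod (v + of_real m) \<le> m"
    have nz: "v + of_real m \<noteq> 0" using c assms(4) by auto
    define s where "s = 1 / (k * (v + of_real m))"
    have sk: "s * k = 1 / (v + of_real m)" and s: "s = v / (v + of_real m)"
      using \<open>k \<noteq> 0\<close> v(1) by (simp_all add: s_def) (metis mult_divide_mult_cancel_left)
    have "1 - s *\<^sub>C (1 - k *\<^sub>C b) = (1 - s) *\<^sub>C 1 + (s * k) *\<^sub>C b"
      by (simp add: scaleC_diff_right scaleC_diff_left scaleC_scaleC)
    also have "1 - s = (1 / (v + of_real m)) * of_real m" using nz by (auto simp: s field_simps)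
    also have "((1 / (v + of_real m)) * of_real m) *\<^sub>C 1 + (s * k) *\<^sub>C b = (1 / (v + of_real m)) *\<^sub>C (m *\<^sub>R 1 + b)"
      by (simp add: sk scaleC_add_right scaleR_scaleC scaleC_scaleC)
    finally have "norm (1 - s *\<^sub>C (1 - k *\<^sub>C b)) = norm (m *\<^sub>R 1 + b) / cmod (v + of_real m)"
      by (simp only: norm_scaleC norm_divide norm_one) simp
    also have "\<dots> < 1" using c assms(3,4) nz by (simp add: divide_less_eq)
    finally show False using quasi_inverse_unital k by blast
  qed
  \<comment> \<open>Expanded, the two discs say |v|^2 \<le> 2 Re v and |v|^2 \<le> - 2 m Re v, which
    is impossible for nonzero \<open>v\<close>.\<close>
  ultimately have "(cmod (v - 1))\<^sup>2 \<le> 1" "(cmod (v + of_real m))\<^sup>2 \<le> m\<^sup>2"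
    using assms(4) by (auto simp: abs_square_le_1 intro: power_mono)
  then have 1: "(cmod v)\<^sup>2 \<le> 2 * Re v" and 2: "(cmod v)\<^sup>2 + 2 * m * Re v \<le> 0"
    unfolding cmod_power2 by (simp_all add: power2_eq_square algebra_simps)
  have "(cmod v)\<^sup>2 > 0" using v(2) by simp
  then have "Re v > 0" using 1 by linarith
  then have "m * Re v > 0" using assms(4) by simp
  then show False using 2 \<open>(cmod v)\<^sup>2 > 0\<close> by linarith
qed

text \<open>Since \<open>1 - e\<close> and \<open>a\<close> annihilate each other, the iterated
  squares of \<open>1 - e + a\<close> are \<open>1 - e\<close> plus those of \<open>a\<close>. They
  stay bounded by 2, which for a selfadjoint element forces norm at most 1.\<close>

lemma norm_corner_le_1:
  fixes e a :: "'a::unital_cstar_algebra"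
  assumes "star e = e" "e * e = e" "e * a = a" "a * e = a" "star a = a" "norm a \<le> 1"
  shows "norm (1 - e + a) \<le> 1"
proof -
  define X where "X = (\<lambda>n. ((\<lambda>z. z * z) ^^ n) (1 - e + a))"
  define Y where "Y = (\<lambda>n. ((\<lambda>z. z * z) ^^ n) a)"
  have Y: "e * Y n = Y n \<and> Y n * e = Y n" for n
    by (induction n) (simp_all add: Y_def assms mult.assoc, simp add: assms flip: mult.assoc)
  have X: "X n = 1 - e + Y n" for n
  proof (induction n)
    case (Suc n)
    have "X (Suc n) = X n * X n" by (simp add: X_def)
    also have "\<dots> = 1 - e + Y n * Y n"
      using Y[of n] by (simp add: Suc algebra_simps assms)
    finally show ?case by (simp add: Y_def)
  qed (simp add: X_def Y_def)
  have "norm (X n) = norm (X 0) ^ 2 ^ n" for n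
    by (rule norm_iterated_squares) (simp_all add: X_def star_diff star_add assms)
  moreover have "norm (Y n) \<le> 1" for n
    by (subst norm_iterated_squares) (simp_all add: Y_def assms power_le_one)
  moreover have "norm (1 - e) \<le> 1"
    by (rule norm_projection) (simp_all add: star_diff assms algebra_simps)
  ultimately have "norm (X 0) ^ 2 ^ n \<le> (0 * 2 ^ n + 2) * 1 ^ 2 ^ n" for n
  proof -
    assume h: "\<And>n. norm (X n) = norm (X 0) ^ 2 ^ n" "\<And>n. norm (Y n) \<le> 1" "norm (1 - e) \<le> 1"
    have "norm (X n) \<le> norm (1 - e) + norm (Y n)" unfolding X[of n] by (rule norm_triangle_ineq)
    then have "norm (X n) \<le> 2" using h(2)[of n] h(3) by linarith
    then show ?thesis by (simp add: h(1)[of n])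
  qed
  then have "norm (X 0) \<le> 1" by (rule le_of_power_le[OF norm_ge_zero zero_le_one])
  then show ?thesis by (simp add: X_def)
qed

text \<open>The compressions \<open>b k = p i * p k * p i\<close> with \<open>k \<noteq> i\<close>
  have sum 0. In place of positivity, each of them has distance at most 1 from 1; by
  \<open>selfadjoint_eq_0\<close> this leaves no room for cancellation.\<close>

lemma sum_projections_orthogonal:
  fixes p :: "'i \<Rightarrow> 'a::unital_cstar_algebra"
  assumes fin: "finite I" and p: "\<And>i. i \<in> I \<Longrightarrow> star (p i) = p i" "\<And>i. i \<in> I \<Longrightarrow> p i * p i = p i"
    and sum: "(\<Sum>i\<in>I. p i) = 1" and ij: "i \<in> I" "j \<in> I" "i \<noteq> j"
  shows "p i * p j = 0"
proof -
  define b where "b = (\<lambda>k. p i * p k * p i)"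
  have b1: "norm (1 - b k) \<le> 1" if k: "k \<in> I" for k
  proof -
    have "norm (1 - p i + p i * (1 - p k) * p i) \<le> 1"
    proof (rule norm_corner_le_1)
      have "norm (1 - p k) \<le> 1"
        by (rule norm_projection) (simp_all add: star_diff p k algebra_simps)
      moreover have "norm (p i) \<le> 1" using norm_projection p ij by blast
      moreover have "norm (p i * (1 - p k) * p i) \<le> norm (p i) * norm (1 - p k) * norm (p i)"
        by (meson norm_mult_ineq mult_right_mono norm_ge_zero order_trans)
      ultimately show "norm (p i * (1 - p k) * p i) \<le> 1"
        by (smt (verit, best) mult_le_one mult_nonneg_nonneg norm_ge_zero)
      have "p i * (p i * z) = p i * z" for z using p(2)[OF ij(1)] by (simp flip: mult.assoc)
      then show "p i * (p i * (1 - p k) * p i) = p i * (1 - p k) * p i" by (simp add: mult.assoc)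
    qed (simp_all add: p ij k star_mult star_diff mult.assoc)
    moreover have "1 - p i + p i * (1 - p k) * p i = 1 - b k"
      by (simp add: b_def algebra_simps p ij)
    ultimately show ?thesis by simp
  qed
  define J where "J = I - {i, j}"
  have "b i + b j + (\<Sum>k\<in>J. b k) = (\<Sum>k\<in>I. b k)"
    using fin ij by (simp add: J_def sum.remove[of I i] sum.remove[of "I - {i}" j] Diff_insert2 [symmetric] insert_commute add.assoc)
  also have "\<dots> = p i * (\<Sum>k\<in>I. p k) * p i" by (simp add: b_def sum_distrib_left sum_distrib_right)
  also have "\<dots> = b i" by (simp add: sum b_def p ij)
  finally have bj: "b j = - (\<Sum>k\<in>J. b k)" by (simp add: eq_neg_iff_add_eq_0)
  have sa: "star (b j) = b j" by (simp add: b_def star_mult p ij mult.assoc)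
  \<comment> \<open>The other \<open>card J\<close> elements lie within distance 1 of 1, so their
    negated sum \<open>b j\<close> lies in the disc of radius \<open>card J + 1\<close> centred at
    the negative of that number.\<close>
  have "(real (card J) + 1) *\<^sub>R 1 + b j = 1 + (\<Sum>k\<in>J. 1 - b k)"
    by (simp add: bj sum_subtractf scaleR_add_left flip: of_real_def)
  also have "norm \<dots> \<le> 1 + (\<Sum>k\<in>J. 1)"
  proof -
    have "norm (\<Sum>k\<in>J. 1 - b k) \<le> (\<Sum>k\<in>J. 1)"
      by (intro sum_norm_le b1) (simp add: J_def)
    then show ?thesis using norm_triangle_ineq[of 1 "\<Sum>k\<in>J. 1 - b k"] by simp
  qed
  finally have "norm ((real (card J) + 1) *\<^sub>R 1 + b j) \<le> real (card J) + 1" by simp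
  then have "b j = 0" using selfadjoint_eq_0[OF sa b1] ij by simp
  then have "star (p j * p i) * (p j * p i) = 0"
    using p(2)[OF ij(2)] mult.assoc[of "p j" "p j" "p i"] by (simp add: b_def star_mult p ij mult.assoc)
  then have "star (p j * p i) = 0" unfolding star_mult_self_eq_0_iff by simp
  then show ?thesis by (simp add: star_mult p ij)
qed

text \<open>\<open>G\<close> is a norm preserving correspondence between dense subalgebras. Stated
  as a relation, it need not be shown to be a function beforehand: that follows from norm
  preservation for differences, and the closure of \<open>G\<close> is the graph of the
  isomorphism.\<close>

lemma star_iso_extension:
  fixes G :: "('a::cstar_algebra \<times> 'b::cstar_algebra) set"
  assumes add: "\<And>x y x' y'. (x, y) \<in> G \<Longrightarrow> (x', y') \<in> G \<Longrightarrow> (x + x', y + y') \<in> G"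
    and mult: "\<And>x y x' y'. (x, y) \<in> G \<Longrightarrow> (x', y') \<in> G \<Longrightarrow> (x * x', y * y') \<in> G"
    and scale: "\<And>c x y. (x, y) \<in> G \<Longrightarrow> (c *\<^sub>C x, c *\<^sub>C y) \<in> G"
    and star: "\<And>x y. (x, y) \<in> G \<Longrightarrow> (star x, star y) \<in> G"
    and iso: "\<And>x y. (x, y) \<in> G \<Longrightarrow> norm x = norm y"
    and dense1: "closure (fst ` G) = UNIV" and dense2: "closure (snd ` G) = UNIV"
  shows "\<exists>\<Phi>. star_iso \<Phi> \<and> (\<forall>x y. (x, y) \<in> G \<longrightarrow> \<Phi> x = y)"
proof -
  have diff: "(x - x', y - y') \<in> G" if "(x, y) \<in> G" "(x', y') \<in> G" for x y x' y'
    using add[OF that(1) scale[OF that(2), of "-1"]] by simp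
  define H where "H = (\<lambda>x y. \<exists>u v. (\<forall>n::nat. (u n, v n) \<in> G) \<and> u \<longlonglongrightarrow> x \<and> v \<longlonglongrightarrow> y)"
  have HG: "H x y" if "(x, y) \<in> G" for x y
    unfolding H_def using that by (intro exI[of _ "\<lambda>_. x"] exI[of _ "\<lambda>_. y"]) auto
  have Hadd: "H (x + x') (y + y')" and Hmult: "H (x * x') (y * y')" and Hdiff: "H (x - x') (y - y')"
    if xy: "H x y" "H x' y'" for x y x' y'
  proof -
    obtain u v u' v' where h: "\<And>n::nat. (u n, v n) \<in> G" "u \<longlonglongrightarrow> x" "v \<longlonglongrightarrow> y"
      "\<And>n::nat. (u' n, v' n) \<in> G" "u' \<longlonglongrightarrow> x'" "v' \<longlonglongrightarrow> y'"
      using xy unfolding H_def by blast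
    show "H (x + x') (y + y')" unfolding H_def
      by (rule exI[of _ "\<lambda>n. u n + u' n"], rule exI[of _ "\<lambda>n. v n + v' n"]) (intro conjI allI add tendsto_add h)
    show "H (x - x') (y - y')" unfolding H_def
      by (rule exI[of _ "\<lambda>n. u n - u' n"], rule exI[of _ "\<lambda>n. v n - v' n"]) (intro conjI allI diff tendsto_diff h)
    show "H (x * x') (y * y')" unfolding H_def
      by (rule exI[of _ "\<lambda>n. u n * u' n"], rule exI[of _ "\<lambda>n. v n * v' n"]) (intro conjI allI mult tendsto_mult h)
  qed
  have Hstar: "H (star x) (star y)" and Hscale: "H (c *\<^sub>C x) (c *\<^sub>C y)" and Hnorm: "norm x = norm y"
    if xy: "H x y" for x y c
  proof -
    obtain u v where h: "\<And>n::nat. (u n, v n) \<in> G" "u \<longlonglongrightarrow> x" "v \<longlonglongrightarrow> y"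
      using xy unfolding H_def by blast
    show "H (star x) (star y)" unfolding H_def
      by (rule exI[of _ "\<lambda>n. star (u n)"], rule exI[of _ "\<lambda>n. star (v n)"])
         (intro conjI allI star bounded_linear.tendsto[OF bounded_linear_star] h)
    show "H (c *\<^sub>C x) (c *\<^sub>C y)" unfolding H_def
      by (rule exI[of _ "\<lambda>n. c *\<^sub>C (u n)"], rule exI[of _ "\<lambda>n. c *\<^sub>C (v n)"])
         (intro conjI allI scale bounded_linear.tendsto[OF bounded_linear_scaleC_right] h)
    have "(\<lambda>n. norm (u n)) \<longlonglongrightarrow> norm x" "(\<lambda>n. norm (u n)) \<longlonglongrightarrow> norm y"
      using tendsto_norm[OF h(2)] tendsto_norm[OF h(3)] iso[OF h(1)] by simp_all
    then show "norm x = norm y" by (rule LIMSEQ_unique)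
  qed
  have uniq: "x = x' \<longleftrightarrow> y = y'" if "H x y" "H x' y'" for x y x' y'
    using Hnorm[OF Hdiff[OF that]] by (metis norm_eq_zero right_minus_eq)
  have ex1: "\<exists>y. H x y" for x
  proof -
    have "x \<in> closure (fst ` G)" using dense1 by simp
    then obtain u where u: "\<And>n. u n \<in> fst ` G" "u \<longlonglongrightarrow> x" unfolding closure_sequential by blast
    have "\<forall>n. \<exists>y. (u n, y) \<in> G" using u(1) by (metis imageE prod.collapse)
    then obtain v where v: "\<And>n. (u n, v n) \<in> G" by metis
    have "dist (v m) (v n) = dist (u m) (u n)" for m n
      using iso[OF diff[OF v v]] by (simp add: dist_norm)
    then have "Cauchy v" using LIMSEQ_imp_Cauchy[OF u(2)] by (simp add: Cauchy_def)
    then show ?thesis using v u(2) by (auto simp: H_def Cauchy_convergent_iff convergent_def)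
  qed
  have ex2: "\<exists>x. H x y" for y
  proof -
    have "y \<in> closure (snd ` G)" using dense2 by simp
    then obtain v where u: "\<And>n. v n \<in> snd ` G" "v \<longlonglongrightarrow> y" unfolding closure_sequential by blast
    have "\<forall>n. \<exists>x. (x, v n) \<in> G" using u(1) by (metis imageE prod.collapse)
    then obtain w where v: "\<And>n. (w n, v n) \<in> G" by metis
    have "dist (w m) (w n) = dist (v m) (v n)" for m n
      using iso[OF diff[OF v v]] by (simp add: dist_norm)
    then have "Cauchy w" using LIMSEQ_imp_Cauchy[OF u(2)] by (simp add: Cauchy_def)
    then show ?thesis using v u(2) by (auto simp: H_def Cauchy_convergent_iff convergent_def)
  qed
  define \<Phi> where "\<Phi> = (\<lambda>x. SOME y. H x y)"
  have \<Phi>: "H x (\<Phi> x)" for x unfolding \<Phi>_def by (rule someI_ex[OF ex1])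
  have eq: "\<Phi> x = y" if "H x y" for x y using uniq[OF \<Phi>[of x] that] by simp
  have "bij \<Phi>"
  proof (rule bijI)
    show "inj \<Phi>" by (rule injI) (metis \<Phi> uniq)
    show "surj \<Phi>" by (rule surjI[of _ "\<lambda>y. SOME x. H x y"]) (rule eq, rule someI_ex[OF ex2])
  qed
  moreover have "star_hom \<Phi>"
    unfolding star_hom_def by (intro conjI allI eq Hadd Hmult Hstar Hscale \<Phi>)
  ultimately show ?thesis using eq HG by (auto simp: star_iso_def)
qed


section \<open>Points of Markov shifts\<close>

definition cat :: "'n list \<Rightarrow> (nat \<Rightarrow> 'n) \<Rightarrow> nat \<Rightarrow> 'n" where
  "cat w z = (\<lambda>n. if n < length w then w ! n else z (n - length w))"

lemma cat_Nil [simp]: "cat [] z = z"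
  by (simp add: cat_def)

lemma cat_Cons_0 [simp]: "cat (j # w) z 0 = j"
  by (simp add: cat_def)

lemma cat_Cons_Suc [simp]: "cat (j # w) z (Suc n) = cat w z n"
  by (simp add: cat_def)

lemma shift_cat_Cons [simp]: "shift (cat (j # w) z) = cat w z"
  by (simp add: shift_def)

lemma cat_append: "cat (u @ v) z = cat u (cat v z)"
  by (rule ext) (auto simp: cat_def nth_append)

lemma cat_0: "cat w z 0 = hd (w @ [z 0])"
  by (cases w) auto

lemma shift_power: "(shift ^^ p) y = (\<lambda>n. y (n + p))"
  by (induction p arbitrary: y) (simp_all add: shift_def funpow_swap1)

lemma shift_power_cat [simp]: "(shift ^^ length w) (cat w z) = z"
  by (simp add: shift_power cat_def)

lemma cat_map_shift_power: "cat (map y [0..<p]) ((shift ^^ p) y) = y"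
  by (rule ext) (simp add: cat_def shift_power)

lemma cat_shift_Cons: "cat [y 0] (shift y) = y"
  using cat_map_shift_power[of y 1] by simp

text \<open>The symbol following the word is a separate argument: in \<open>cat w z\<close> it is
  the head of the tail, in the algebra the index of the projection in \<open>W w * P i\<close>. This
  treats the empty word uniformly.\<close>

fun admissible :: "nat^'n^'n \<Rightarrow> 'n list \<Rightarrow> 'n \<Rightarrow> bool" where
  "admissible A [] i \<longleftrightarrow> True"
| "admissible A (j # w) i \<longleftrightarrow> A $ j $ hd (w @ [i]) = 1 \<and> admissible A w i"

lemma admissible_append: "admissible A (u @ v) i \<longleftrightarrow> admissible A u (hd (v @ [i])) \<and> admissible A v i"
  by (induction u) (auto simp: hd_append)

lemma shift_space_Suc: "y \<in> shift_space A \<longleftrightarrow> A $ y 0 $ y 1 = 1 \<and> shift y \<in> shift_space A"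
  unfolding shift_space_def shift_def using not0_implies_Suc by (auto) (metis One_nat_def not0_implies_Suc)

lemma cat_in_shift_space: "cat w z \<in> shift_space A \<longleftrightarrow> admissible A w (z 0) \<and> z \<in> shift_space A"
proof (induction w)
  case (Cons j w)
  show ?case by (subst shift_space_Suc) (simp add: Cons cat_0)
qed simp

lemma shift_in_shift_space: "y \<in> shift_space A \<Longrightarrow> (shift ^^ p) y \<in> shift_space A"
  by (simp add: shift_space_def shift_power)

lemma shift_in_shift_space1: "y \<in> shift_space A \<Longrightarrow> shift y \<in> shift_space A"
  by (simp add: shift_space_def shift_def)

lemma admissible_prefix:
  assumes "y \<in> shift_space A"
  shows "admissible A (map y [0..<p]) (y p)"
proof -
  have "cat (map y [0..<p]) ((shift ^^ p) y) \<in> shift_space A" using assms by (simp add: cat_map_shift_power)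
  then show ?thesis unfolding cat_in_shift_space by (simp add: shift_power)
qed

lemma admissible_nth:
  "admissible A w i \<Longrightarrow> n < length w \<Longrightarrow> A $ (w ! n) $ ((w @ [i]) ! Suc n) = 1"
proof (induction w arbitrary: n)
  case (Cons j w)
  then show ?case by (cases n) (auto simp: hd_conv_nth nth_append)
qed simp

definition eventually_periodic :: "(nat \<Rightarrow> 'n) \<Rightarrow> bool" where
  "eventually_periodic y \<longleftrightarrow> (\<exists>p q. p < q \<and> (shift ^^ p) y = (shift ^^ q) y)"

lemma eventually_periodicI: "(shift ^^ p) y = (shift ^^ q) y \<Longrightarrow> p \<noteq> q \<Longrightarrow> eventually_periodic y"
  unfolding eventually_periodic_def by (metis nat_neq_iff)

text \<open>If the \<open>p\<close>-fold and \<open>q\<close>-fold shifts agree and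
  \<open>p < q\<close>, the first \<open>q\<close> symbols determine the point.\<close>

lemma countable_eventually_periodic: "countable {y::nat \<Rightarrow> 'n::finite. eventually_periodic y}"
proof -
  have "countable {y::nat \<Rightarrow> 'n. (shift ^^ p) y = (shift ^^ q) y}" if "p < q" for p q :: nat
  proof -
    have "inj_on (\<lambda>y. map y [0..<q]) {y::nat \<Rightarrow> 'n. (shift ^^ p) y = (shift ^^ q) y}"
    proof (rule inj_onI)
      fix y z :: "nat \<Rightarrow> 'n"
      assume yz: "y \<in> {y. (shift ^^ p) y = (shift ^^ q) y}" "z \<in> {y. (shift ^^ p) y = (shift ^^ q) y}"
        and eq: "map y [0..<q] = map z [0..<q]"
      have "y n = z n" for n
      proof (induction n rule: less_induct)
        case (less n)
        show ?case
        proof (cases "n < q")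
          case True
          then show ?thesis using eq by (simp add: map_eq_conv)
        next
          case False
          have "u n = u (n - q + p)" if "(shift ^^ p) u = (shift ^^ q) u" for u :: "nat \<Rightarrow> 'n"
            using fun_cong[OF that, of "n - q"] False by (simp add: shift_power)
          then have "y n = y (n - q + p)" "z n = z (n - q + p)" using yz by auto
          then show ?thesis using less[of "n - q + p"] False \<open>p < q\<close> by simp
        qed
      qed
      then show "y = z" by auto
    qed
    then show ?thesis using countable_image_inj_eq by blast
  qed
  moreover have "{y::nat \<Rightarrow> 'n. eventually_periodic y} = (\<Union>q. \<Union>p\<in>{..<q}. {y. (shift ^^ p) y = (shift ^^ q) y})"
    by (auto simp: eventually_periodic_def)
  ultimately show ?thesis by auto
qed

lemma countable_shift_preimage: "countable {y::nat \<Rightarrow> 'n::finite. \<exists>p. (shift ^^ p) y = z}"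
proof -
  have "{y::nat \<Rightarrow> 'n. \<exists>p. (shift ^^ p) y = z} \<subseteq> range (\<lambda>w. cat w z)"
  proof (safe)
    fix y :: "nat \<Rightarrow> 'n" and p assume "z = (shift ^^ p) y"
    then show "y \<in> range (\<lambda>w. cat w ((shift ^^ p) y))" by (metis cat_map_shift_power rangeI)
  qed
  then show ?thesis by (rule countable_subset) auto
qed

section \<open>Irreducibility: paths, branching and the abundance of points\<close>

lemma markov_matrix_01: "markov_matrix A \<Longrightarrow> A $ i $ j = 0 \<or> A $ i $ j = 1"
  by (auto simp: markov_matrix_def zero_one_matrix_def)

lemma path_of_matrix_power:
  assumes "zero_one_matrix A" "(((**) A) ^^ m) (mat 1) $ a $ i > 0"
  shows "\<exists>w. length w = m \<and> admissible A w i \<and> hd (w @ [i]) = a"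
  using assms(2)
proof (induction m arbitrary: a)
  case 0
  then show ?case by (auto simp: mat_def split: if_splits)
next
  case (Suc m)
  then have "(\<Sum>k\<in>UNIV. A $ a $ k * (((**) A) ^^ m) (mat 1) $ k $ i) > 0"
    using vec_lambda_beta by (simp only: funpow.simps o_apply) (simp add: matrix_matrix_mult_def[of A "_ (mat 1)"] del: One_nat_def)
  then obtain k where "A $ a $ k * (((**) A) ^^ m) (mat 1) $ k $ i > 0"
    by (metis (no_types, lifting) gr0I less_irrefl sum.neutral)
  then have k: "A $ a $ k > 0" "(((**) A) ^^ m) (mat 1) $ k $ i > 0" by auto
  then have "A $ a $ k = 1" using assms(1) unfolding zero_one_matrix_def by (metis insertE less_irrefl singletonD)
  moreover obtain w where "length w = m" "admissible A w i" "hd (w @ [i]) = k" using Suc.IH[OF k(2)] by blast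
  ultimately show ?case by (intro exI[of _ "a # w"]) auto
qed

lemma markov_path:
  assumes "markov_matrix A"
  shows "\<exists>w. w \<noteq> [] \<and> hd w = a \<and> admissible A w i"
proof -
  obtain m where m: "m \<ge> 1" "(((**) A) ^^ m) (mat 1) $ a $ i > 0"
    using assms unfolding markov_matrix_def irreducible_matrix_def by blast
  then obtain w where "length w = m \<and> admissible A w i \<and> hd (w @ [i]) = a"
    using path_of_matrix_power assms unfolding markov_matrix_def by blast
  then show ?thesis using m by (intro exI[of _ w]) (cases w; auto)
qed

lemma markov_successor:
  assumes "markov_matrix A"
  shows "\<exists>j. A $ i $ j = 1"
proof -
  obtain w where "w \<noteq> []" "hd w = i" "admissible A w i" using markov_path[OF assms] by blast
  then show ?thesis by (cases w) auto
qed

text \<open>Without branching the matrix is the graph of a map, which irreducibility makes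
  surjective; on a finite set this is a permutation.\<close>

lemma markov_branching:
  assumes "markov_matrix A"
  shows "\<exists>i j j'. j \<noteq> j' \<and> A $ i $ j = 1 \<and> A $ i $ j' = 1"
proof (rule ccontr)
  assume n: "\<not> ?thesis"
  obtain \<pi> where \<pi>: "\<And>i. A $ i $ \<pi> i = 1" using markov_successor[OF assms] by metis
  have A: "A $ i $ j = (if j = \<pi> i then 1 else 0)" for i j
    using n \<pi> markov_matrix_01[OF assms, of i j] by auto
  have "surj \<pi>"
  proof (rule surjI)
    fix j
    obtain w where w: "w \<noteq> []" "admissible A w j" using markov_path[OF assms] by blast
    then have "A $ last w $ j = 1" using admissible_append[of A "butlast w" "[last w]" j] by simp
    then show "\<pi> (SOME i. A $ i $ j = 1) = j"
      using A by (metis (mono_tags, lifting) someI_ex zero_neq_one)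
  qed
  then have "bij \<pi>" by (simp add: bij_def finite_UNIV_surj_inj)
  then show False using A assms unfolding markov_matrix_def permutation_matrix_def by blast
qed

lemma uncountable_UNIV_nat_bool: "uncountable (UNIV :: (nat \<Rightarrow> bool) set)"
proof
  assume "countable (UNIV :: (nat \<Rightarrow> bool) set)"
  then have "range (from_nat_into (UNIV :: (nat \<Rightarrow> bool) set)) = UNIV" by (simp add: range_from_nat_into)
  then obtain n where "from_nat_into UNIV n = (\<lambda>k. \<not> from_nat_into (UNIV :: (nat \<Rightarrow> bool) set) k k)"
    by (metis UNIV_I imageE)
  then show False by metis
qed

text \<open>Two distinct loops of the same length at one state can be concatenated freely.\<close>

lemma uncountable_cylinder:
  fixes A :: "nat^'n^'n"
  assumes "markov_matrix A"
  shows "uncountable {x \<in> shift_space A. x 0 = a}"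
proof
  assume count: "countable {x \<in> shift_space A. x 0 = a}"
  obtain i j j' where ij: "j \<noteq> j'" "A $ i $ j = 1" "A $ i $ j' = 1" using markov_branching[OF assms] by blast
  obtain u u' where u: "u \<noteq> []" "hd u = j" "admissible A u i" and u': "u' \<noteq> []" "hd u' = j'" "admissible A u' i"
    using markov_path[OF assms] by metis
  obtain \<pi> where p: "\<pi> \<noteq> []" "hd \<pi> = a" "admissible A \<pi> i" using markov_path[OF assms] by blast
  \<comment> \<open>Both orders of concatenation are used so that the two blocks have equal length;
    they differ at index 1, where the loops branch.\<close>
  define blk where "blk = (\<lambda>c. if c then (i # u) @ (i # u') else (i # u') @ (i # u))"
  define L where "L = length (blk True)"
  have L: "length (blk c) = L" "L > 0" for c by (auto simp: blk_def L_def)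
  have adm: "admissible A (blk c) i" for c
    using u u' ij by (auto simp: blk_def admissible_append)
  have blk0: "blk c ! 0 = i" for c by (simp add: blk_def)
  have neq: "blk True ! 1 \<noteq> blk False ! 1"
    using u u' ij by (simp add: blk_def nth_append hd_conv_nth)
  define z where "z = (\<lambda>s n. blk (s (n div L)) ! (n mod L))"
  have zin: "z s \<in> shift_space A" for s
    unfolding shift_space_def
  proof (safe)
    fix n
    have "A $ (blk (s (n div L)) ! (n mod L)) $ ((blk (s (n div L)) @ [i]) ! Suc (n mod L)) = 1"
      using admissible_nth[OF adm] L by simp
    moreover have "z s (Suc n) = (blk (s (n div L)) @ [i]) ! Suc (n mod L)"
    proof (cases "Suc (n mod L) = L")
      case True
      then have "Suc n mod L = 0" "length (blk (s (n div L))) = Suc (n mod L)" by (simp_all add: mod_Suc L)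
      then show ?thesis by (simp add: z_def blk0 nth_append)
    next
      case False
      then have "Suc n div L = n div L" "Suc n mod L = Suc (n mod L)" by (auto simp: div_Suc mod_Suc)
      moreover have "Suc (n mod L) < L" using False L(2) by (metis Suc_lessI mod_less_divisor)
      ultimately show ?thesis by (simp add: z_def nth_append L)
    qed
    ultimately show "A $ z s n $ z s (Suc n) = 1" by (simp add: z_def)
  qed
  have z0: "z s 0 = i" for s by (simp add: z_def blk0)
  have "inj (\<lambda>s. cat \<pi> (z s))"
  proof (rule injI)
    fix s t assume "cat \<pi> (z s) = cat \<pi> (z t)"
    then have zz: "z s = z t" by (metis shift_power_cat)
    show "s = t"
    proof
      fix k
      have "1 < L" by (simp add: L_def blk_def)
      then have "blk (s k) ! 1 = blk (t k) ! 1"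
        using fun_cong[OF zz, of "k * L + 1"] unfolding z_def
        by (simp only: mod_mult_self3 mod_less div_mult_self3 div_less add_0_right)
      then show "s k = t k" using neq by (cases "s k"; cases "t k") auto
    qed
  qed
  moreover have "range (\<lambda>s. cat \<pi> (z s)) \<subseteq> {x \<in> shift_space A. x 0 = a}"
    using p zin z0 by (auto simp: cat_in_shift_space cat_0)
  then have "countable (range (\<lambda>s. cat \<pi> (z s)))" using count countable_subset by blast
  ultimately show False using uncountable_UNIV_nat_bool countable_image_inj_eq by blast
qed

text \<open>The points are chosen one symbol at a time. Points to be avoided are the eventually
  periodic ones and those on forward or backward orbits of earlier choices; these are countably
  many, whereas a cylinder is uncountable.\<close>

lemma exists_separated_points:
  fixes A :: "nat^'n^'n"
  assumes "markov_matrix A"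
  shows "\<exists>x. \<forall>i. x i \<in> shift_space A \<and> x i 0 = i \<and> (\<forall>j p. p \<ge> 1 \<longrightarrow> (shift ^^ p) (x j) \<noteq> x i)"
proof -
  have "\<exists>x. \<forall>i\<in>F. x i \<in> shift_space A \<and> x i 0 = i \<and> (\<forall>j\<in>F. \<forall>p\<ge>1. (shift ^^ p) (x j) \<noteq> x i)" for F
  proof (induction F rule: finite_induct[OF finite])
    case (2 a F)
    then obtain x where x: "\<forall>i\<in>F. x i \<in> shift_space A \<and> x i 0 = i \<and> (\<forall>j\<in>F. \<forall>p\<ge>1. (shift ^^ p) (x j) \<noteq> x i)"
      by blast
    define bad where "bad = {y::nat \<Rightarrow> 'n. eventually_periodic y} \<union>
      (\<Union>i\<in>F. {y. \<exists>p. (shift ^^ p) y = x i} \<union> range (\<lambda>p. (shift ^^ p) (x i)))"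
    have "countable bad"
      unfolding bad_def using countable_eventually_periodic countable_shift_preimage by auto
    then have "\<not> {y \<in> shift_space A. y 0 = a} \<subseteq> bad"
      using uncountable_cylinder[OF assms] countable_subset by blast
    then obtain y where y: "y \<in> shift_space A" "y 0 = a" "y \<notin> bad" by auto
    have ne: "(shift ^^ p) y \<noteq> x i" "(shift ^^ p) (x i) \<noteq> y" if "i \<in> F" for i p
      using y(3) that unfolding bad_def by auto
    have np: "(shift ^^ p) y \<noteq> y" if "p \<ge> 1" for p
      using y(3) eventually_periodicI[of 0 y p] that unfolding bad_def by auto
    show ?case
      by (rule exI[of _ "x(a := y)"]) (use x y ne np 2 in auto)
  qed auto
  from this[of UNIV] show ?thesis by auto
qed

text \<open>Density of aperiodic points: the cylinder of \<open>y N\<close> is uncountable, so it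
  contains an aperiodic tail, which can be attached to the prefix of \<open>y\<close>.\<close>

lemma exists_not_eventually_periodic:
  fixes A :: "nat^'n^'n"
  assumes "markov_matrix A" "y \<in> shift_space A"
  shows "\<exists>z\<in>shift_space A. (\<forall>n<N. z n = y n) \<and> \<not> eventually_periodic z"
proof -
  have "\<not> {x \<in> shift_space A. x 0 = y N} \<subseteq> {x. eventually_periodic x}"
    using uncountable_cylinder[OF assms(1)] countable_eventually_periodic countable_subset by blast
  then obtain x where x: "x \<in> shift_space A" "x 0 = y N" "\<not> eventually_periodic x" by auto
  define z where "z = cat (map y [0..<N]) x"
  have "z \<in> shift_space A"
    using x admissible_prefix[OF assms(2), of N] by (simp add: z_def cat_in_shift_space)
  moreover have "\<forall>n<N. z n = y n" by (simp add: z_def cat_def)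
  moreover have "\<not> eventually_periodic z"
  proof
    assume "eventually_periodic z"
    then obtain p q where pq: "p < q" "(shift ^^ p) z = (shift ^^ q) z" by (auto simp: eventually_periodic_def)
    have zn: "(shift ^^ N) z = x" using shift_power_cat[of "map y [0..<N]" x] by (simp add: z_def)
    have "(shift ^^ (p + N)) z = (shift ^^ (q + N)) z"
      using arg_cong[OF pq(2), of "shift ^^ N"] by (simp add: shift_power add_ac)
    then have "(shift ^^ p) x = (shift ^^ q) x" by (simp add: funpow_add zn)
    then show False using x(3) pq(1) by (auto simp: eventually_periodic_def)
  qed
  ultimately show ?thesis by blast
qed

section \<open>Matrix units\<close>

text \<open>The matrix units proper are the products \<open>u x * star (u y)\<close> with
  \<open>\<tau> x = \<tau> y\<close>, so \<open>\<tau>\<close> labels the blocks of a direct sum of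
  matrix algebras. Keeping the factors \<open>u x\<close> separate allows rectangular matrices
  between words of different lengths.\<close>

definition matrix_units :: "'x set \<Rightarrow> ('x \<Rightarrow> 'a::cstar_algebra) \<Rightarrow> ('i \<Rightarrow> 'a) \<Rightarrow> ('x \<Rightarrow> 'i) \<Rightarrow> bool" where
  "matrix_units X u p \<tau> \<longleftrightarrow> finite X \<and>
     (\<forall>x\<in>X. \<forall>y\<in>X. star (u x) * u y = (if x = y then p (\<tau> x) else 0)) \<and>
     (\<forall>x\<in>X. u x * p (\<tau> x) = u x) \<and> (\<forall>i. star (p i) = p i \<and> p i * p i = p i \<and> p i \<noteq> 0)"

definition matrix_sum :: "('x \<Rightarrow> 'a::cstar_algebra) \<Rightarrow> 'x set \<Rightarrow> 'x set \<Rightarrow> ('x \<Rightarrow> 'x \<Rightarrow> complex) \<Rightarrow> 'a" where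
  "matrix_sum u X Y c = (\<Sum>x\<in>X. \<Sum>y\<in>Y. c x y *\<^sub>C (u x * star (u y)))"

lemma matrix_units_norm: "matrix_units X u p \<tau> \<Longrightarrow> x \<in> X \<Longrightarrow> norm (u x) = 1"
  using cstar_identity[of "u x"] norm_projection(2)[of "p (\<tau> x)"] power2_eq_1_iff[of "norm (u x)"] norm_ge_zero[of "u x"]
  by (auto simp: matrix_units_def)

lemma star_matrix_sum: "star (matrix_sum u X Y c) = matrix_sum u Y X (\<lambda>y x. cnj (c x y))"
  unfolding matrix_sum_def by (subst sum.swap) (simp add: star_sum star_scaleC star_mult star_star)

lemma matrix_sum_mult:
  assumes Y: "matrix_units Y u p \<tau>" and c: "\<And>x y. \<tau> x \<noteq> \<tau> y \<Longrightarrow> c x y = 0"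
    and ux: "\<And>x. x \<in> X \<Longrightarrow> u x * p (\<tau> x) = u x"
  shows "matrix_sum u X Y c * matrix_sum u Y Z d = matrix_sum u X Z (\<lambda>x z. \<Sum>y\<in>Y. c x y * d y z)"
proof -
  have "matrix_sum u X Y c * matrix_sum u Y Z d
      = (\<Sum>x\<in>X. \<Sum>y\<in>Y. \<Sum>y'\<in>Y. \<Sum>z\<in>Z. (c x y * d y' z) *\<^sub>C (u x * (star (u y) * u y') * star (u z)))"
  proof -
    have "matrix_sum u X Y c * matrix_sum u Y Z d = (\<Sum>x\<in>X. \<Sum>y\<in>Y. c x y *\<^sub>C (u x * star (u y)) * matrix_sum u Y Z d)"
      by (simp add: matrix_sum_def[of u X] sum_distrib_right)
    also have "\<dots> = (\<Sum>x\<in>X. \<Sum>y\<in>Y. \<Sum>y'\<in>Y. \<Sum>z\<in>Z. (c x y * d y' z) *\<^sub>C (u x * (star (u y) * u y') * star (u z)))"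
      by (intro sum.cong refl)
         (simp add: matrix_sum_def sum_distrib_left scaleC_sum_right mult_scaleC_left mult_scaleC_right scaleC_scaleC mult.assoc mult.commute)
    finally show ?thesis .
  qed
  also have "\<dots> = (\<Sum>x\<in>X. \<Sum>y\<in>Y. \<Sum>z\<in>Z. (c x y * d y z) *\<^sub>C (u x * star (u z)))"
  proof (rule sum.cong[OF refl], rule sum.cong[OF refl])
    fix x y assume xy: "x \<in> X" "y \<in> Y"
    have "(\<Sum>y'\<in>Y. \<Sum>z\<in>Z. (c x y * d y' z) *\<^sub>C (u x * (star (u y) * u y') * star (u z)))
        = (\<Sum>y'\<in>Y. if y' = y then \<Sum>z\<in>Z. (c x y * d y z) *\<^sub>C (u x * p (\<tau> y) * star (u z)) else 0)"
      using Y xy by (intro sum.cong) (auto simp: matrix_units_def)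
    also have "\<dots> = (\<Sum>z\<in>Z. (c x y * d y z) *\<^sub>C (u x * p (\<tau> y) * star (u z)))"
      using Y xy by (simp add: matrix_units_def)
    also have "\<dots> = (\<Sum>z\<in>Z. (c x y * d y z) *\<^sub>C (u x * star (u z)))"
      using c[of x y] ux[OF xy(1)] by (cases "\<tau> x = \<tau> y") auto
    finally show "(\<Sum>y'\<in>Y. \<Sum>z\<in>Z. (c x y * d y' z) *\<^sub>C (u x * (star (u y) * u y') * star (u z)))
        = (\<Sum>z\<in>Z. (c x y * d y z) *\<^sub>C (u x * star (u z)))" .
  qed
  also have "\<dots> = (\<Sum>x\<in>X. \<Sum>z\<in>Z. \<Sum>y\<in>Y. (c x y * d y z) *\<^sub>C (u x * star (u z)))"
    by (rule sum.cong[OF refl], rule sum.swap)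
  finally show ?thesis by (simp add: matrix_sum_def scaleC_sum_left)
qed

text \<open>Compression by \<open>u y\<close> and \<open>u z\<close>, both of norm 1, isolates the
  coefficient in front of a nonzero projection.\<close>

lemma matrix_coefficient_le:
  assumes Y: "matrix_units Y u p \<tau>" and d: "\<And>x y. \<tau> x \<noteq> \<tau> y \<Longrightarrow> d x y = 0" and yz: "y \<in> Y" "z \<in> Y"
  shows "cmod (d y z) \<le> norm (matrix_sum u Y Y d)"
proof (cases "\<tau> y = \<tau> z")
  case True
  have fin: "finite Y" using Y by (simp add: matrix_units_def)
  have "star (u y) * matrix_sum u Y Y d * u z
      = (\<Sum>x\<in>Y. \<Sum>x'\<in>Y. d x x' *\<^sub>C ((star (u y) * u x) * (star (u x') * u z)))"
    unfolding matrix_sum_def by (simp add: sum_distrib_left sum_distrib_right mult_scaleC_left mult_scaleC_right mult.assoc)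
  also have "\<dots> = (\<Sum>x\<in>Y. \<Sum>x'\<in>Y. if x' = z then (if x = y then d y z *\<^sub>C (p (\<tau> y) * p (\<tau> z)) else 0) else 0)"
    using Y yz by (intro sum.cong) (auto simp: matrix_units_def)
  also have "\<dots> = d y z *\<^sub>C p (\<tau> y)"
    using yz fin True Y by (simp add: matrix_units_def)
  finally have "cmod (d y z) = norm (star (u y) * matrix_sum u Y Y d * u z)"
    using Y norm_projection(2)[of "p (\<tau> y)"] by (simp add: norm_scaleC matrix_units_def)
  also have "\<dots> \<le> norm (star (u y)) * norm (matrix_sum u Y Y d) * norm (u z)"
    by (meson norm_mult_ineq mult_right_mono norm_ge_zero order_trans)
  finally show ?thesis using matrix_units_norm[OF Y] yz by simp
qed (simp add: d)

lemma norm_matrix_sum_le: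
  assumes Y: "matrix_units Y u p \<tau>"
  shows "norm (matrix_sum u Y Y d) \<le> (\<Sum>y\<in>Y. \<Sum>z\<in>Y. cmod (d y z))"
  unfolding matrix_sum_def
proof (intro sum_norm_le)
  fix y z assume "y \<in> Y" "z \<in> Y"
  then show "norm (d y z *\<^sub>C (u y * star (u z))) \<le> cmod (d y z)"
    using norm_mult_ineq[of "u y" "star (u z)"] matrix_units_norm[OF Y]
    by (simp add: norm_scaleC mult_left_le)
qed

text \<open>The iterated squares of \<open>star Z * Z\<close>, for \<open>Z = matrix_sum u X Y c\<close>, are matrix sums whose
  coefficients do not depend on \<open>u\<close>.\<close>

definition square_coefficients :: "'x set \<Rightarrow> 'x set \<Rightarrow> ('x \<Rightarrow> 'x \<Rightarrow> complex) \<Rightarrow> nat \<Rightarrow> 'x \<Rightarrow> 'x \<Rightarrow> complex" where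
  "square_coefficients X Y c n = ((\<lambda>e y z. \<Sum>x\<in>Y. e y x * e x z) ^^ n) (\<lambda>y z. \<Sum>x\<in>X. cnj (c x y) * c x z)"

lemma square_coefficients_eq_0:
  assumes c: "\<And>x y. \<tau> x \<noteq> \<tau> y \<Longrightarrow> c x y = 0" and "\<tau> y \<noteq> \<tau> z"
  shows "square_coefficients X Y c n y z = 0"
  using assms(2)
proof (induction n arbitrary: y z)
  case 0
  then have "cnj (c x y) * c x z = 0" for x using c[of x y] c[of x z] by (cases "\<tau> x = \<tau> y") auto
  then show ?case by (auto simp: square_coefficients_def intro!: sum.neutral)
next
  case (Suc n)
  have "square_coefficients X Y c n y x * square_coefficients X Y c n x z = 0" for x
    using Suc.IH[of y x] Suc.IH[of x z] Suc.prems by (cases "\<tau> y = \<tau> x") auto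
  then show ?case by (auto simp: square_coefficients_def intro!: sum.neutral)
qed

lemma matrix_sum_squares:
  assumes "matrix_units X u p \<tau>" "matrix_units Y u p \<tau>" and c: "\<And>x y. \<tau> x \<noteq> \<tau> y \<Longrightarrow> c x y = 0"
  defines "M \<equiv> \<lambda>n. matrix_sum u Y Y (square_coefficients X Y c n)"
  shows "star (matrix_sum u X Y c) * matrix_sum u X Y c = M 0" and "M (Suc n) = M n * M n" and "star (M 0) = M 0"
proof -
  have up: "u y * p (\<tau> y) = u y" if "y \<in> Y" for y using assms(2) that by (simp add: matrix_units_def)
  show 1: "star (matrix_sum u X Y c) * matrix_sum u X Y c = M 0"
    unfolding star_matrix_sum M_def
    by (subst matrix_sum_mult[OF assms(1)]) (auto simp: c up square_coefficients_def)
  then show "star (M 0) = M 0" by (metis star_mult star_star)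
  show "M (Suc n) = M n * M n"
    unfolding M_def
    by (subst matrix_sum_mult[OF assms(2)]) (auto simp: square_coefficients_eq_0[where c = c and \<tau> = \<tau>, OF c] up, simp add: square_coefficients_def)
qed

text \<open>In either system the norm of an iterated square lies between its largest coefficient and
  the sum of all of them. The norms therefore agree up to \<open>card Y * card Y\<close>, a factor
  independent of \<open>n\<close>, which the squaring argument removes.\<close>

lemma norm_matrix_sum_mono:
  fixes u :: "'x \<Rightarrow> 'a::cstar_algebra" and v :: "'x \<Rightarrow> 'b::cstar_algebra"
  assumes u: "matrix_units X u p \<tau>" "matrix_units Y u p \<tau>"
    and v: "matrix_units X v q \<tau>" "matrix_units Y v q \<tau>"
    and c: "\<And>x y. \<tau> x \<noteq> \<tau> y \<Longrightarrow> c x y = 0"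
  shows "norm (matrix_sum u X Y c) \<le> norm (matrix_sum v X Y c)"
proof -
  define d where "d = square_coefficients X Y c"
  note su = matrix_sum_squares[where c = c, OF u c, folded d_def]
  note sv = matrix_sum_squares[where c = c, OF v c, folded d_def]
  have d\<tau>: "\<tau> y \<noteq> \<tau> z \<Longrightarrow> d n y z = 0" for n y z
    unfolding d_def by (rule square_coefficients_eq_0[where \<tau> = \<tau>]) (auto simp: c)
  have le: "norm (matrix_sum u Y Y (d n)) \<le> (0 * 2 ^ n + real (card Y * card Y)) * norm (matrix_sum v Y Y (d n))" for n
  proof -
    have "norm (matrix_sum u Y Y (d n)) \<le> (\<Sum>y\<in>Y. \<Sum>z\<in>Y. cmod (d n y z))" by (rule norm_matrix_sum_le[OF u(2)])
    also have "\<dots> \<le> (\<Sum>y\<in>Y. \<Sum>z\<in>Y. norm (matrix_sum v Y Y (d n)))"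
      by (intro sum_mono matrix_coefficient_le[OF v(2)]) (auto simp: d\<tau>)
    finally show ?thesis by simp
  qed
  have "norm (matrix_sum u Y Y (d 0)) \<le> norm (matrix_sum v Y Y (d 0))"
    by (rule norm_le_of_iterated_squares[where x = "\<lambda>n. matrix_sum u Y Y (d n)" and y = "\<lambda>n. matrix_sum v Y Y (d n)",
          OF su(3) su(2) sv(3) sv(2) le])
  then show ?thesis
    by (simp add: cstar_identity flip: su(1) sv(1))
qed


section \<open>Words in a Cuntz--Krieger family\<close>

lemma finite_words_eq: "finite {x::'n::finite list \<times> 'n. length (fst x) = m \<and> P x}"
proof -
  have "finite ({w::'n list. set w \<subseteq> UNIV \<and> length w = m} \<times> (UNIV::'n set))"
    by (intro finite_cartesian_product finite_lists_length_eq) auto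
  then show ?thesis by (rule rev_finite_subset) auto
qed

lemma finite_words_le: "finite {x::'n::finite list \<times> 'n. length (fst x) \<le> m \<and> P x}"
proof -
  have "finite ({w::'n list. set w \<subseteq> UNIV \<and> length w \<le> m} \<times> (UNIV::'n set))"
    by (intro finite_cartesian_product finite_lists_length_le) auto
  then show ?thesis by (rule rev_finite_subset) auto
qed

definition words :: "nat^'n^'n \<Rightarrow> nat \<Rightarrow> ('n list \<times> 'n) set" where
  "words A m = {x. length (fst x) = m \<and> admissible A (fst x) (snd x)}"

lemma finite_words [simp]: "finite (words A m)"
  by (simp add: words_def finite_words_eq)

locale ck_family =
  fixes A :: "nat^'n^'n" and S :: "'n \<Rightarrow> 'a::unital_cstar_algebra"
  assumes markov: "markov_matrix A"
    and S_nonzero: "S i \<noteq> 0"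
    and S_partial_isometry: "S i * star (S i) * S i = S i"
    and S_sum: "(\<Sum>j\<in>UNIV. S j * star (S j)) = 1"
    and S_relation: "star (S i) * S i = (\<Sum>j\<in>UNIV. of_nat (A $ i $ j) * (S j * star (S j)))"
begin

definition P :: "'n \<Rightarrow> 'a" where
  "P i = S i * star (S i)"

lemma star_P: "star (P i) = P i" and P_idem: "P i * P i = P i" and P_S: "P i * S i = S i"
  and P_nonzero: "P i \<noteq> 0"
proof -
  show "star (P i) = P i" by (simp add: P_def star_mult star_star)
  show 1: "P i * S i = S i" by (simp add: P_def S_partial_isometry)
  then show "P i * P i = P i" by (metis P_def mult.assoc)
  show "P i \<noteq> 0" using 1 S_nonzero[of i] by auto
qed

lemma P_orthogonal: "i \<noteq> j \<Longrightarrow> P i * P j = 0"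
  by (rule sum_projections_orthogonal[of UNIV P]) (auto simp: star_P P_idem, simp add: P_def S_sum)

lemma P_S_if: "P i * S j = (if i = j then S j else 0)"
proof (cases "i = j")
  case False
  have "P i * S j = P i * P j * S j" by (simp add: P_S mult.assoc)
  then show ?thesis using False P_orthogonal by simp
qed (simp add: P_S)

lemma star_S_P: "star (S i) * P i = star (S i)"
  by (metis P_S star_P star_mult)

lemma star_S_S: "i \<noteq> j \<Longrightarrow> star (S i) * S j = 0"
proof -
  assume "i \<noteq> j"
  have "star (S i) * S j = star (S i) * (P i * S j)" by (simp add: star_S_P flip: mult.assoc)
  then show ?thesis using \<open>i \<noteq> j\<close> by (simp add: P_S_if)
qed

lemma star_S_S_S: "star (S j) * S j * S k = (if A $ j $ k = 1 then S k else 0)"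
proof -
  have "star (S j) * S j * S k = (\<Sum>l\<in>UNIV. of_nat (A $ j $ l) * (P l * S k))"
    by (simp add: S_relation P_def sum_distrib_right mult.assoc)
  also have "\<dots> = (\<Sum>l\<in>UNIV. if l = k then of_nat (A $ j $ k) * S k else 0)"
    by (intro sum.cong) (auto simp: P_S_if)
  also have "\<dots> = of_nat (A $ j $ k) * S k" by simp
  finally show ?thesis using markov_matrix_01[OF markov, of j k] by auto
qed

definition W :: "'n list \<Rightarrow> 'a" where
  "W w = prod_list (map S w)"

lemma W_Nil [simp]: "W [] = 1" and W_Cons: "W (j # w) = S j * W w" and W_append: "W (u @ v) = W u * W v"
  by (simp_all add: W_def)

text \<open>Replacements for the projections \<open>P i\<close> at the ends of words.
  \<open>R = P\<close> yields the components of a polynomial; an aperiodic \<open>R\<close> yields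
  compressions in which words of different lengths are orthogonal.\<close>

definition subprojections :: "('n \<Rightarrow> 'a) \<Rightarrow> bool" where
  "subprojections R \<longleftrightarrow> (\<forall>i. star (R i) = R i \<and> R i * R i = R i \<and> R i \<noteq> 0 \<and> P i * R i = R i)"

lemma subprojections_P: "subprojections P"
  by (simp add: subprojections_def star_P P_idem P_nonzero)

text \<open>\<open>star (S j) * S j\<close> is the sum of the range projections of the successors of
  \<open>j\<close>, so it fixes or kills whatever starts in the range of a single generator. For the
  empty word that range is known from \<open>P i * R i = R i\<close>.\<close>

lemma star_S_S_W:
  assumes "subprojections R"
  shows "star (S j) * S j * (W w * R i) = (if A $ j $ hd (w @ [i]) = 1 then W w * R i else 0)"
proof (cases w)
  case Nil
  have R: "R i = S i * (star (S i) * R i)" using assms by (simp add: subprojections_def P_def mult.assoc)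
  have "star (S j) * S j * R i = (star (S j) * S j * S i) * (star (S i) * R i)"
    by (subst R) (simp add: mult.assoc)
  then show ?thesis using R by (simp add: Nil star_S_S_S)
next
  case (Cons k v)
  have "star (S j) * S j * (S k * W v * R i) = (star (S j) * S j * S k) * (W v * R i)" by (simp add: mult.assoc)
  also have "\<dots> = (if A $ j $ k = 1 then S k else 0) * (W v * R i)" by (simp only: star_S_S_S)
  finally show ?thesis by (simp add: Cons W_Cons mult.assoc)
qed

lemma star_W_W:
  assumes "subprojections R" "length w = length v"
  shows "star (W w) * (W v * R i) = (if w = v \<and> admissible A v i then R i else 0)"
  using assms(2)
proof (induction w v rule: list_induct2)
  case (Cons j w k v)
  show ?case
  proof (cases "j = k")
    case True
    have "star (W (j # w)) * (W (k # v) * R i) = star (W w) * (star (S j) * S j * (W v * R i))"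
      by (simp add: W_Cons star_mult True mult.assoc)
    then show ?thesis using Cons.IH True by (auto simp: star_S_S_W[OF assms(1)])
  next
    case False
    have "star (W (j # w)) * (W (k # v) * R i) = star (W w) * ((star (S j) * S k) * (W v * R i))"
      by (simp add: W_Cons star_mult mult.assoc)
    then show ?thesis using False star_S_S[OF False] by simp
  qed
qed (simp add: assms)

lemma star_W_W_eq_0:
  assumes "r < length w" "r < length v" "w ! r \<noteq> v ! r"
  shows "star (W w) * W v = 0"
  using assms
proof (induction w arbitrary: v r)
  case (Cons j w)
  then obtain k v' where v: "v = k # v'" by (cases v) auto
  have e: "star (W (j # w)) * W v = star (W w) * ((star (S j) * S k) * W v')"
    by (simp add: W_Cons v star_mult mult.assoc)
  show ?case
  proof (cases "j = k")
    case True
    then obtain r' where r: "r = Suc r'" using Cons.prems v by (cases r) auto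
    then have "v' \<noteq> []" using Cons.prems v by auto
    then obtain l v'' where v': "v' = l # v''" by (cases v') auto
    have "star (S j) * S j * W v' = (star (S j) * S j * S l) * W v''" by (simp add: v' W_Cons mult.assoc)
    then have "star (S j) * S j * W v' = (if A $ j $ l = 1 then W v' else 0)"
      by (simp add: star_S_S_S v' W_Cons)
    moreover have "star (W w) * W v' = 0" using Cons.IH[of r' v'] Cons.prems r v True by simp
    ultimately show ?thesis using e True by simp
  qed (simp add: e star_S_S)
qed simp

definition u :: "('n \<Rightarrow> 'a) \<Rightarrow> 'n list \<times> 'n \<Rightarrow> 'a" where
  "u R x = W (fst x) * R (snd x)"

lemma matrix_units_u:
  assumes "subprojections R"
  shows "matrix_units (words A m) (u R) R snd"
  unfolding matrix_units_def
proof (intro conjI ballI allI finite_words)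
  have R: "star (R i) = R i" "R i * R i = R i" "P i * R i = R i" for i
    using assms by (simp_all add: subprojections_def)
  have P: "R i * R j = 0" if "i \<noteq> j" for i j
  proof -
    have "R i * R j = star (P i * R i) * (P j * R j)" using R by metis
    also have "\<dots> = R i * ((P i * P j) * R j)" by (simp only: star_mult star_P R(1) mult.assoc)
    finally show ?thesis using P_orthogonal[OF that] by simp
  qed
  fix x y assume x: "x \<in> words A m" and y: "y \<in> words A m"
  have "star (u R x) * u R y = R (snd x) * (star (W (fst x)) * (W (fst y) * R (snd y)))"
    using R by (simp add: u_def star_mult mult.assoc)
  also have "\<dots> = (if x = y then R (snd x) else 0)"
    using x y P R by (simp add: star_W_W[OF assms] words_def prod_eq_iff)
  finally show "star (u R x) * u R y = (if x = y then R (snd x) else 0)" .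
next
  fix x show "u R x * R (snd x) = u R x" using assms by (simp add: u_def subprojections_def mult.assoc)
qed (use assms in \<open>auto simp: subprojections_def\<close>)

text \<open>The long words along separated points provide projections below the \<open>P i\<close> that are moved
  off themselves by all short words; compressing by them removes the components of nonzero degree.\<close>

lemma exists_aperiodic_subprojections:
  "\<exists>R. subprojections R \<and> (\<forall>i j w. w \<noteq> [] \<longrightarrow> length w \<le> K \<longrightarrow> R i * W w * R j = 0)"
proof -
  obtain x where x: "\<And>i. x i \<in> shift_space A" "\<And>i. x i 0 = i" "\<And>i j p. p \<ge> 1 \<Longrightarrow> (shift ^^ p) (x i) \<noteq> x j"
    using exists_separated_points[OF markov] by metis
  have "\<forall>i j p. \<exists>r. p \<ge> 1 \<longrightarrow> x i (r + p) \<noteq> x j r"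
    using x(3) by (force simp: shift_power fun_eq_iff)
  then obtain r where r: "\<And>i j p. p \<ge> 1 \<Longrightarrow> x i (r i j p + p) \<noteq> x j (r i j p)" by metis
  define F where "F = (\<lambda>(i, j, p). r i j p) ` (UNIV \<times> UNIV \<times> {..K})"
  have "finite F" by (simp add: F_def)
  then obtain M0 where M0: "\<And>k. k \<in> F \<Longrightarrow> k < M0" by (meson finite_nat_set_iff_bounded)
  \<comment> \<open>Long enough to contain every comparison position \<open>r i j p\<close> even
    after a shift by \<open>p \<le> K\<close>.\<close>
  define M where "M = Suc (M0 + K)"
  have rM: "r i j p + p < M" if "p \<le> K" for i j p
    using M0[of "r i j p"] that by (force simp: F_def M_def)
  define a where "a = (\<lambda>i. (map (x i) [0..<M], x i M))"
  have a: "a i \<in> words A M" for i by (simp add: a_def words_def admissible_prefix x)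
  note mu = matrix_units_u[OF subprojections_P, of M, unfolded matrix_units_def]
  define R where "R = (\<lambda>i. u P (a i) * star (u P (a i)))"
  have su: "star (u P (a i)) * u P (a i) = P (x i M)" and uP: "u P (a i) * P (x i M) = u P (a i)" for i
  proof -
    have "star (u P (a i)) * u P (a i) = P (snd (a i))" "u P (a i) * P (snd (a i)) = u P (a i)"
      using mu a by simp_all
    then show "star (u P (a i)) * u P (a i) = P (x i M)" "u P (a i) * P (x i M) = u P (a i)"
      by (simp_all add: a_def)
  qed
  have "subprojections R"
    unfolding subprojections_def
  proof (intro allI conjI)
    fix i
    show "star (R i) = R i" by (simp add: R_def star_mult star_star)
    have "R i * R i = u P (a i) * (star (u P (a i)) * u P (a i)) * star (u P (a i))" by (simp add: R_def mult.assoc)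
    then show "R i * R i = R i" by (simp add: su uP R_def)
    show "R i \<noteq> 0"
    proof
      assume "R i = 0"
      then have "u P (a i) = 0" using star_mult_self_eq_0_iff[of "star (u P (a i))"] by (simp add: R_def star_star)
      then show False using su[of i] P_nonzero by simp
    qed
    have "map (x i) [0..<M] = i # map (x i) [1..<M]" by (simp add: M_def upt_rec x(2))
    then have "u P (a i) = S i * (W (map (x i) [1..<M]) * P (x i M))" by (simp add: u_def a_def W_Cons mult.assoc)
    then have "P i * u P (a i) = u P (a i)" by (simp add: P_S flip: mult.assoc)
    then show "P i * R i = R i" by (simp add: R_def flip: mult.assoc)
  qed
  moreover have "R i * W w * R j = 0" if w: "w \<noteq> []" "length w \<le> K" for i j w
  proof -
    \<comment> \<open>With \<open>p = length w\<close>, the two words read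
      \<open>x i (r i j p + p)\<close> and \<open>x j (r i j p)\<close> at position
      \<open>r i j p + p\<close>; different symbols at a common position kill the product.\<close>
    have "star (W (map (x i) [0..<M])) * W (w @ map (x j) [0..<M]) = 0"
    proof (rule star_W_W_eq_0)
      show "r i j (length w) + length w < length (map (x i) [0..<M])" using rM[of "length w"] w by simp
      show "r i j (length w) + length w < length (w @ map (x j) [0..<M])" using rM[of "length w" i j] w by simp
      show "map (x i) [0..<M] ! (r i j (length w) + length w) \<noteq> (w @ map (x j) [0..<M]) ! (r i j (length w) + length w)"
        using rM[of "length w" i j] w r[of "length w" i j] by (cases w) (auto simp: nth_append)
    qed
    moreover have "R i * W w * R j = u P (a i) * (P (x i M) * ((star (W (map (x i) [0..<M])) * W (w @ map (x j) [0..<M]))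
         * (P (x j M) * star (u P (a j)))))"
      by (simp add: R_def u_def a_def star_mult star_P W_append mult.assoc)
    ultimately show ?thesis by simp
  qed
  ultimately show ?thesis by blast
qed

end

section \<open>Normal forms\<close>

context ck_family
begin

definition unit :: "'n list \<times> 'n \<Rightarrow> 'n list \<times> 'n \<Rightarrow> 'a" where
  "unit a b = u P a * star (u P b)"

lemma unit_eq: "unit (w, i) (v, i) = W w * P i * star (W v)"
proof -
  have "unit (w, i) (v, i) = W w * (P i * P i) * star (W v)"
    by (simp add: unit_def u_def star_mult star_P mult.assoc)
  then show ?thesis by (simp add: P_idem)
qed

lemma not_admissible: "\<not> admissible A w i \<Longrightarrow> W w * P i = 0"
proof -
  assume "\<not> admissible A w i"
  then have "star (W w * P i) * (W w * P i) = 0"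
    using star_W_W[OF subprojections_P, of w w i] by (simp add: star_mult star_P mult.assoc)
  then show ?thesis by (simp only: star_mult_self_eq_0_iff)
qed

lemma S_P_eq_0: "A $ i $ k \<noteq> 1 \<Longrightarrow> S i * P k = 0"
  using not_admissible[of "[i]" k] by (simp add: W_Cons)

lemma P_split: "P i = (\<Sum>k | A $ i $ k = 1. S i * P k * star (S i))"
proof -
  have "P i = S i * (\<Sum>k\<in>UNIV. P k) * star (S i)"
    by (simp add: P_def[of i]) (simp add: P_def S_sum)
  also have "\<dots> = (\<Sum>k\<in>UNIV. S i * P k * star (S i))" by (simp add: sum_distrib_left sum_distrib_right)
  also have "\<dots> = (\<Sum>k | A $ i $ k = 1. S i * P k * star (S i))"
    by (rule sum.mono_neutral_right) (auto simp: S_P_eq_0)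
  finally show ?thesis .
qed

text \<open>Both words grow by one symbol and the degree is unchanged; repetition brings all right
  words to one common length.\<close>

lemma unit_split: "unit (w, i) (v, i) = (\<Sum>k | A $ i $ k = 1. unit (w @ [i], k) (v @ [i], k))"
  unfolding unit_eq
  by (subst P_split) (simp add: sum_distrib_left sum_distrib_right W_append W_Cons star_mult mult.assoc)

lemma S_unit: "S j * unit (w, i) b = unit (j # w, i) b"
  by (simp add: unit_def u_def W_Cons mult.assoc)

lemma star_S_unit:
  assumes "admissible A (k # w) i"
  shows "star (S j) * unit (k # w, i) b = (if j = k then unit (w, i) b else 0)"
proof (cases "j = k")
  case True
  have "star (S j) * unit (k # w, i) b = star (S j) * S j * (W w * P i) * star (u P b)"
    by (simp add: unit_def u_def W_Cons True mult.assoc)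
  then show ?thesis using assms True by (simp only: star_S_S_W[OF subprojections_P]) (simp add: unit_def u_def)
next
  case False
  have "star (S j) * unit (k # w, i) b = star (S j) * S k * (W w * P i * star (u P b))"
    by (simp add: unit_def u_def W_Cons mult.assoc)
  then show ?thesis using False by (simp add: star_S_S)
qed

lemma unit_eq_0: "\<not> admissible A w i \<Longrightarrow> unit (w, i) b = 0"
  by (simp add: unit_def u_def not_admissible)

lemma sum_unit_Nil: "(\<Sum>i\<in>UNIV. unit ([], i) ([], i)) = 1"
  by (simp add: unit_eq P_def S_sum)

end

text \<open>Formal counterparts of the generators: operators on functions on \<open>shift_space A \<times> \<int>\<close>. The second
  coordinate records the degree, so that polynomials in the generators are determined by their operators.\<close>

type_synonym 'n operator = "((nat \<Rightarrow> 'n) \<Rightarrow> int \<Rightarrow> complex) \<Rightarrow> (nat \<Rightarrow> 'n) \<Rightarrow> int \<Rightarrow> complex"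

definition op_gen :: "nat^'n^'n \<Rightarrow> 'n \<Rightarrow> 'n operator" where
  "op_gen A i \<xi> = (\<lambda>y n. if y \<in> shift_space A \<and> y 0 = i then \<xi> (shift y) (n - 1) else 0)"

definition op_star :: "nat^'n^'n \<Rightarrow> 'n \<Rightarrow> 'n operator" where
  "op_star A i \<xi> = (\<lambda>y n. if cat [i] y \<in> shift_space A then \<xi> (cat [i] y) (n + 1) else 0)"

definition op_id :: "nat^'n^'n \<Rightarrow> 'n operator" where
  "op_id A \<xi> = (\<lambda>y n. if y \<in> shift_space A then \<xi> y n else 0)"

text \<open>The formal counterpart of \<open>W w * P i * star (W v)\<close> for
  \<open>a = (w, i)\<close> and \<open>b = (v, i)\<close>.\<close>

definition op_unit :: "nat^'n^'n \<Rightarrow> 'n list \<times> 'n \<Rightarrow> 'n list \<times> 'n \<Rightarrow> 'n operator" where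
  "op_unit A a b \<xi> = (\<lambda>y n. let k = length (fst a) in
     if y \<in> shift_space A \<and> map y [0..<k] = fst a \<and> y k = snd a
     then \<xi> (cat (fst b) ((shift ^^ k) y)) (n - int k + int (length (fst b))) else 0)"

text \<open>One noncommutative polynomial evaluated in two families and as a formal operator. As a
  relation it requires neither a free algebra nor well-definedness of evaluation. \<open>K\<close>
  bounds the number of generators in each monomial, hence the degrees.\<close>

inductive ck_rel ::
  "nat^'n^'n \<Rightarrow> ('n \<Rightarrow> 'a::unital_cstar_algebra) \<Rightarrow> ('n \<Rightarrow> 'b::unital_cstar_algebra)
     \<Rightarrow> nat \<Rightarrow> 'a \<Rightarrow> 'b \<Rightarrow> 'n operator \<Rightarrow> bool"
  for A S T where
  gen: "ck_rel A S T 1 (S i) (T i) (op_gen A i)"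
| star_gen: "ck_rel A S T 1 (star (S i)) (star (T i)) (op_star A i)"
| one: "ck_rel A S T 0 1 1 (op_id A)"
| add: "ck_rel A S T K X Y L \<Longrightarrow> ck_rel A S T K X' Y' L' \<Longrightarrow>
    ck_rel A S T K (X + X') (Y + Y') (\<lambda>\<xi> y n. L \<xi> y n + L' \<xi> y n)"
| scale: "ck_rel A S T K X Y L \<Longrightarrow> ck_rel A S T K (c *\<^sub>C X) (c *\<^sub>C Y) (\<lambda>\<xi> y n. c * L \<xi> y n)"
| mult: "ck_rel A S T K X Y L \<Longrightarrow> ck_rel A S T K' X' Y' L' \<Longrightarrow>
    ck_rel A S T (K + K') (X * X') (Y * Y') (\<lambda>\<xi>. L (L' \<xi>))"
| weaken: "ck_rel A S T K X Y L \<Longrightarrow> K \<le> K' \<Longrightarrow> ck_rel A S T K' X Y L"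

text \<open>Formal operators carry no adjoint, so only the existence of an operator is claimed. The
  bound \<open>K\<close> is kept, as the count for iterated squares requires.\<close>

lemma ck_rel_star: "ck_rel A S T K X Y L \<Longrightarrow> \<exists>L'. ck_rel A S T K (star X) (star Y) L'"
proof (induction rule: ck_rel.induct)
  case (gen i)
  show ?case using ck_rel.star_gen by blast
next
  case (star_gen i)
  then show ?case using ck_rel.gen[of A S T i] by (auto simp: star_star)
next
  case (mult K X Y L K' X' Y' L')
  then show ?case using ck_rel.mult[of A S T K' "star X'" "star Y'" _ K "star X" "star Y"]
    by (auto simp: star_mult add.commute)
qed (auto simp: star_add star_scaleC intro: ck_rel.intros)

lemma ck_rel_op_id: "ck_rel A S T K X Y L \<Longrightarrow> L (op_id A \<xi>) = L \<xi>"
proof (induction arbitrary: \<xi> rule: ck_rel.induct)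
  case (gen i)
  show ?case by (intro ext) (simp add: op_gen_def op_id_def shift_in_shift_space1)
next
  case (mult K X Y L K' X' Y' L')
  then show ?case by simp
qed (auto simp: op_star_def op_id_def fun_eq_iff)

lemma op_gen_unit:
  fixes A :: "nat^'n^'n"
  shows "op_gen A j (op_unit A (w, i) b \<xi>) = op_unit A (j # w, i) b \<xi>"
proof (intro ext)
  fix y :: "nat \<Rightarrow> 'n" and n :: int
  have 1: "map y [0..<Suc (length w)] = y 0 # map (shift y) [0..<length w]"
    by (simp add: map_upt_Suc shift_def del: upt_Suc)
  have 2: "(shift ^^ Suc (length w)) y = (shift ^^ length w) (shift y)" by (simp add: funpow_swap1)
  have 3: "y (Suc (length w)) = shift y (length w)" by (simp add: shift_def)
  show "op_gen A j (op_unit A (w, i) b \<xi>) y n = op_unit A (j # w, i) b \<xi> y n"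
    using shift_in_shift_space1[of y A]
    unfolding op_gen_def op_unit_def Let_def fst_conv snd_conv length_Cons 1 2 3 by (auto simp: algebra_simps)
qed

lemma op_unit_not_admissible: "\<not> admissible A w i \<Longrightarrow> op_unit A (w, i) b \<xi> y n = 0"
  using admissible_prefix[of y A "length w"] by (auto simp: op_unit_def Let_def)

lemma op_star_unit:
  fixes A :: "nat^'n^'n"
  assumes "admissible A (k # w) i"
  shows "op_star A j (op_unit A (k # w, i) b \<xi>) = (if j = k then op_unit A (w, i) b \<xi> else (\<lambda>y n. 0))"
proof (intro ext)
  fix y :: "nat \<Rightarrow> 'n" and n :: int
  have 1: "map (cat [j] y) [0..<Suc (length w)] = j # map y [0..<length w]"
    by (simp add: map_upt_Suc cat_def del: upt_Suc)
  have 2: "(shift ^^ Suc (length w)) (cat [j] y) = (shift ^^ length w) y"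
    by (rule ext) (simp add: shift_power cat_def del: funpow.simps)
  have 3: "cat [j] y (Suc (length w)) = y (length w)" by simp
  have 4: "cat [k] y \<in> shift_space A" if "y \<in> shift_space A" "map y [0..<length w] = w" "y (length w) = i"
  proof -
    have "y 0 = hd (w @ [i])"
      using that(2,3) by (cases w) (auto simp: upt_rec)
    then show ?thesis using assms that(1) by (simp add: cat_in_shift_space)
  qed
  show "op_star A j (op_unit A (k # w, i) b \<xi>) y n = (if j = k then op_unit A (w, i) b \<xi> else (\<lambda>y n. 0)) y n"
    using 4 unfolding op_star_def op_unit_def Let_def fst_conv snd_conv length_Cons 1 2 3
    by (auto simp: cat_in_shift_space)
qed

lemma op_unit_split:
  "op_unit A (w, i) (v, i) \<xi> y n = (\<Sum>k | A $ i $ k = 1. op_unit A (w @ [i], k) (v @ [i], k) \<xi> y n)"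
proof -
  let ?l = "length w"
  have A: "A $ i $ y (Suc ?l) = 1" if "y \<in> shift_space A" "y ?l = i"
    using that by (auto simp: shift_space_def)
  have s: "cat (v @ [i]) ((shift ^^ Suc ?l) y) = cat v ((shift ^^ ?l) y)" if "y ?l = i"
  proof -
    have "cat [i] (shift ((shift ^^ ?l) y)) = (shift ^^ ?l) y"
      using cat_shift_Cons[of "(shift ^^ ?l) y"] that by (simp add: shift_power)
    then show ?thesis by (simp add: cat_append)
  qed
  have "op_unit A (w @ [i], k) (v @ [i], k) \<xi> y n =
      (if k = y (Suc ?l) then op_unit A (w, i) (v, i) \<xi> y n else 0)" for k
    using s by (auto simp: op_unit_def Let_def simp del: funpow.simps) (simp_all add: algebra_simps)
  then have "(\<Sum>k | A $ i $ k = 1. op_unit A (w @ [i], k) (v @ [i], k) \<xi> y n)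
      = (if A $ i $ y (Suc ?l) = 1 then op_unit A (w, i) (v, i) \<xi> y n else 0)"
    by simp
  then show ?thesis using A by (auto simp: op_unit_def Let_def)
qed

lemma op_unit_Nil: "(\<Sum>i\<in>UNIV. op_unit A ([], i) ([], i) \<xi> y n) = op_id A \<xi> y n"
proof -
  have "op_unit A ([], i) ([], i) \<xi> y n = (if i = y 0 then op_id A \<xi> y n else 0)" for i
    by (auto simp: op_unit_def op_id_def Let_def)
  then show ?thesis by simp
qed

text \<open>All right words have the same length \<open>N\<close>; the length of the left word then
  encodes the degree, which lies in \<open>{-K..K}\<close>.\<close>

definition nf_index :: "nat^'n^'n \<Rightarrow> nat \<Rightarrow> nat \<Rightarrow> (('n list \<times> 'n) \<times> ('n list \<times> 'n)) set" where
  "nf_index A N K = {(a, b). N \<le> length (fst a) + K \<and> length (fst a) \<le> N + K \<and> admissible A (fst a) (snd a) \<and>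
     b \<in> words A N \<and> snd a = snd b}"

lemma finite_nf_index [simp]: "finite (nf_index A N K)"
proof -
  have "finite ({x::'a list \<times> 'a. length (fst x) \<le> N + K \<and> True} \<times> words A N)"
    by (intro finite_cartesian_product finite_words finite_words_le)
  then show ?thesis by (rule rev_finite_subset) (auto simp: nf_index_def)
qed

section \<open>Normal forms shared by two families and the operators\<close>

locale ck_pair = X: ck_family A S + Y: ck_family A T
  for A :: "nat^'n^'n" and S :: "'n \<Rightarrow> 'a::unital_cstar_algebra" and T :: "'n \<Rightarrow> 'b::unital_cstar_algebra"
begin

text \<open>The same coefficients serve both elements and the operator. This allows norms in the two
  families to be compared and an element to be recovered from its operator.\<close>

definition nf_coeffs where
  "nf_coeffs N K c X Y L \<longleftrightarrow>
     X = (\<Sum>(a, b)\<in>nf_index A N K. c a b *\<^sub>C X.unit a b) \<and>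
     Y = (\<Sum>(a, b)\<in>nf_index A N K. c a b *\<^sub>C Y.unit a b) \<and>
     L = (\<lambda>\<xi> y n. \<Sum>(a, b)\<in>nf_index A N K. c a b * op_unit A a b \<xi> y n)"

definition nf where
  "nf N K X Y L \<longleftrightarrow> (\<exists>c. nf_coeffs N K c X Y L)"

lemma nf_sum:
  assumes "\<And>j. j \<in> J \<Longrightarrow> nf N K (f j) (g j) (h j)"
  shows "nf N K (\<Sum>j\<in>J. k j *\<^sub>C f j) (\<Sum>j\<in>J. k j *\<^sub>C g j) (\<lambda>\<xi> y n. \<Sum>j\<in>J. k j * h j \<xi> y n)"
proof -
  obtain c where c: "\<And>j. j \<in> J \<Longrightarrow> nf_coeffs N K (c j) (f j) (g j) (h j)"
    using assms unfolding nf_def by metis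
  have *: "(\<Sum>j\<in>J. k j *\<^sub>C (\<Sum>(a, b)\<in>I. c j a b *\<^sub>C e a b)) = (\<Sum>(a, b)\<in>I. (\<Sum>j\<in>J. k j * c j a b) *\<^sub>C e a b)"
    for e :: "_ \<Rightarrow> _ \<Rightarrow> 'z::cstar_algebra" and I
    by (simp add: scaleC_sum_right scaleC_sum_left scaleC_scaleC split_def) (rule sum.swap)
  show ?thesis
    unfolding nf_def nf_coeffs_def
  proof (intro exI conjI ext)
    show "(\<Sum>j\<in>J. k j *\<^sub>C f j) = (\<Sum>(a, b)\<in>nf_index A N K. (\<Sum>j\<in>J. k j * c j a b) *\<^sub>C X.unit a b)"
      unfolding *[symmetric] using c by (intro sum.cong) (auto simp: nf_coeffs_def)
    show "(\<Sum>j\<in>J. k j *\<^sub>C g j) = (\<Sum>(a, b)\<in>nf_index A N K. (\<Sum>j\<in>J. k j * c j a b) *\<^sub>C Y.unit a b)"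
      unfolding *[symmetric] using c by (intro sum.cong) (auto simp: nf_coeffs_def)
    fix \<xi> y n
    have "(\<Sum>j\<in>J. k j * h j \<xi> y n) = (\<Sum>j\<in>J. k j * (\<Sum>(a, b)\<in>nf_index A N K. c j a b * op_unit A a b \<xi> y n))"
      using c by (intro sum.cong) (auto simp: nf_coeffs_def)
    also have "\<dots> = (\<Sum>(a, b)\<in>nf_index A N K. (\<Sum>j\<in>J. k j * c j a b) * op_unit A a b \<xi> y n)"
      by (simp add: sum_distrib_left sum_distrib_right mult.assoc split_def) (rule sum.swap)
    finally show "(\<Sum>j\<in>J. k j * h j \<xi> y n) = (\<Sum>(a, b)\<in>nf_index A N K. (\<Sum>j\<in>J. k j * c j a b) * op_unit A a b \<xi> y n)" .
  qed
qed

lemma nf_0: "nf N K 0 0 (\<lambda>\<xi> y n. 0)"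
  using nf_sum[of "{}"] by simp

lemma nf_add: "nf N K X Y L \<Longrightarrow> nf N K X' Y' L' \<Longrightarrow> nf N K (X + X') (Y + Y') (\<lambda>\<xi> y n. L \<xi> y n + L' \<xi> y n)"
  using nf_sum[of UNIV N K "\<lambda>b. if b then X else X'" "\<lambda>b. if b then Y else Y'" "\<lambda>b. if b then L else L'" "\<lambda>_. 1"]
  by (simp add: UNIV_bool add.commute)

lemma nf_scale: "nf N K X Y L \<Longrightarrow> nf N K (c *\<^sub>C X) (c *\<^sub>C Y) (\<lambda>\<xi> y n. c * L \<xi> y n)"
  using nf_sum[of "{()}" N K "\<lambda>_. X" "\<lambda>_. Y" "\<lambda>_. L" "\<lambda>_. c"] by simp

lemma nf_unit:
  assumes "(a, b) \<in> nf_index A N K"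
  shows "nf N K (X.unit a b) (Y.unit a b) (op_unit A a b)"
  unfolding nf_def nf_coeffs_def
proof (intro exI conjI ext)
  let ?c = "\<lambda>a' b'. if (a', b') = (a, b) then 1 else (0::complex)"
  have *: "(\<Sum>(a', b')\<in>nf_index A N K. ?c a' b' *\<^sub>C e a' b') = e a b" for e :: "_ \<Rightarrow> _ \<Rightarrow> 'z::cstar_algebra"
  proof -
    have "(\<Sum>(a', b')\<in>nf_index A N K. ?c a' b' *\<^sub>C e a' b') = (\<Sum>x\<in>nf_index A N K. if x = (a, b) then e a b else 0)"
      by (intro sum.cong) (auto split: if_splits)
    then show ?thesis using assms by simp
  qed
  show "X.unit a b = (\<Sum>(a', b')\<in>nf_index A N K. ?c a' b' *\<^sub>C X.unit a' b')" by (simp only: *)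
  show "Y.unit a b = (\<Sum>(a', b')\<in>nf_index A N K. ?c a' b' *\<^sub>C Y.unit a' b')" by (simp only: *)
  fix \<xi> y n
  have "(\<Sum>(a', b')\<in>nf_index A N K. ?c a' b' * op_unit A a' b' \<xi> y n)
      = (\<Sum>x\<in>nf_index A N K. if x = (a, b) then op_unit A a b \<xi> y n else 0)"
    by (intro sum.cong) (auto split: if_splits)
  then show "op_unit A a b \<xi> y n = (\<Sum>(a', b')\<in>nf_index A N K. ?c a' b' * op_unit A a' b' \<xi> y n)"
    using assms by simp
qed

text \<open>Linearity reduces the effect of an operation on normal forms to single units,
  simultaneously in both families and for the operators.\<close>

lemma nf_linear:
  assumes nf: "nf N K X Y L"
    and units: "\<And>w v i. ((w, i), (v, i)) \<in> nf_index A N K \<Longrightarrow>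
        nf N' K' (F (X.unit (w, i) (v, i))) (G (Y.unit (w, i) (v, i))) (\<lambda>\<xi>. H (op_unit A (w, i) (v, i) \<xi>))"
    and F: "\<And>(J :: (('n list \<times> 'n) \<times> ('n list \<times> 'n)) set) k f. F (\<Sum>j\<in>J. k j *\<^sub>C f j) = (\<Sum>j\<in>J. k j *\<^sub>C F (f j))"
    and G: "\<And>(J :: (('n list \<times> 'n) \<times> ('n list \<times> 'n)) set) k f. G (\<Sum>j\<in>J. k j *\<^sub>C f j) = (\<Sum>j\<in>J. k j *\<^sub>C G (f j))"
    and H: "\<And>(J :: (('n list \<times> 'n) \<times> ('n list \<times> 'n)) set) k f. H (\<lambda>y n. \<Sum>j\<in>J. k j * f j y n) = (\<lambda>y n. \<Sum>j\<in>J. k j * H (f j) y n)"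
  shows "nf N' K' (F X) (G Y) (\<lambda>\<xi>. H (L \<xi>))"
proof -
  obtain c where c: "nf_coeffs N K c X Y L" using nf unfolding nf_def by blast
  let ?I = "nf_index A N K"
  have "nf N' K' (\<Sum>j\<in>?I. c (fst j) (snd j) *\<^sub>C F (X.unit (fst j) (snd j)))
      (\<Sum>j\<in>?I. c (fst j) (snd j) *\<^sub>C G (Y.unit (fst j) (snd j)))
      (\<lambda>\<xi> y n. \<Sum>j\<in>?I. c (fst j) (snd j) * H (op_unit A (fst j) (snd j) \<xi>) y n)"
  proof (rule nf_sum)
    fix j assume j: "j \<in> ?I"
    then obtain w v i where "j = ((w, i), (v, i))" by (cases j) (auto simp: nf_index_def)
    then show "nf N' K' (F (X.unit (fst j) (snd j))) (G (Y.unit (fst j) (snd j))) (\<lambda>\<xi>. H (op_unit A (fst j) (snd j) \<xi>))"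
      using units[of w i v] j by simp
  qed
  then show ?thesis using c by (simp add: nf_coeffs_def split_def F G H)
qed

lemma nf_Suc:
  assumes "nf N K X Y L"
  shows "nf (Suc N) K X Y L"
proof -
  have "nf (Suc N) K (id X) (id Y) (\<lambda>\<xi>. id (L \<xi>))"
  proof (rule nf_linear[OF assms])
    fix w v i assume I: "((w, i), (v, i)) \<in> nf_index A N K"
    have *: "nf (Suc N) K (\<Sum>k | A $ i $ k = 1. 1 *\<^sub>C X.unit (w @ [i], k) (v @ [i], k))
        (\<Sum>k | A $ i $ k = 1. 1 *\<^sub>C Y.unit (w @ [i], k) (v @ [i], k))
        (\<lambda>\<xi> y n. \<Sum>k | A $ i $ k = 1. 1 * op_unit A (w @ [i], k) (v @ [i], k) \<xi> y n)"
      using I by (intro nf_sum nf_unit) (auto simp: nf_index_def words_def admissible_append)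
    have o: "op_unit A (w, i) (v, i) = (\<lambda>\<xi> y n. \<Sum>k | A $ i $ k = 1. 1 * op_unit A (w @ [i], k) (v @ [i], k) \<xi> y n)"
      by (intro ext) (simp only: op_unit_split[of A w i v] mult_1)
    show "nf (Suc N) K (id (X.unit (w, i) (v, i))) (id (Y.unit (w, i) (v, i))) (\<lambda>\<xi>. id (op_unit A (w, i) (v, i) \<xi>))"
      using * unfolding id_apply o by (simp only: X.unit_split[of w i v] Y.unit_split[of w i v] scaleC_1)
  qed auto
  then show ?thesis by simp
qed

lemma nf_raise: "nf N K X Y L \<Longrightarrow> N \<le> N' \<Longrightarrow> nf N' K X Y L"
  by (rotate_tac) (induction rule: dec_induct, auto intro: nf_Suc)

lemma nf_weaken:
  assumes "nf N K X Y L" "K \<le> K'"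
  shows "nf N K' X Y L"
proof -
  have "nf N K' (id X) (id Y) (\<lambda>\<xi>. id (L \<xi>))"
  proof (rule nf_linear[OF assms(1)])
    fix w v i assume "((w, i), (v, i)) \<in> nf_index A N K"
    then show "nf N K' (id (X.unit (w, i) (v, i))) (id (Y.unit (w, i) (v, i))) (\<lambda>\<xi>. id (op_unit A (w, i) (v, i) \<xi>))"
      using assms(2) unfolding id_apply by (intro nf_unit) (auto simp: nf_index_def)
  qed auto
  then show ?thesis by simp
qed

lemma nf_one: "nf 0 0 1 1 (op_id A)"
proof -
  have "nf 0 0 (\<Sum>i\<in>UNIV. 1 *\<^sub>C X.unit ([], i) ([], i)) (\<Sum>i\<in>UNIV. 1 *\<^sub>C Y.unit ([], i) ([], i))
     (\<lambda>\<xi> y n. \<Sum>i\<in>UNIV. 1 * op_unit A ([], i) ([], i) \<xi> y n)"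
    by (intro nf_sum nf_unit) (auto simp: nf_index_def words_def)
  moreover have "(\<lambda>\<xi> y n. \<Sum>i\<in>UNIV. 1 * op_unit A ([], i) ([], i) \<xi> y n) = op_id A"
    by (intro ext) (simp add: op_unit_Nil)
  ultimately show ?thesis by (simp add: X.sum_unit_Nil Y.sum_unit_Nil)
qed

lemma nf_gen:
  assumes "nf N K X Y L" "K < N"
  shows "nf N (Suc K) (S j * X) (T j * Y) (\<lambda>\<xi>. op_gen A j (L \<xi>))"
proof (rule nf_linear[OF assms(1), where F = "\<lambda>X. S j * X" and G = "\<lambda>Y. T j * Y" and H = "op_gen A j"])
  fix w v i assume I: "((w, i), (v, i)) \<in> nf_index A N K"
  have o: "(\<lambda>\<xi>. op_gen A j (op_unit A (w, i) (v, i) \<xi>)) = op_unit A (j # w, i) (v, i)"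
    by (rule ext) (simp add: op_gen_unit)
  show "nf N (Suc K) (S j * X.unit (w, i) (v, i)) (T j * Y.unit (w, i) (v, i)) (\<lambda>\<xi>. op_gen A j (op_unit A (w, i) (v, i) \<xi>))"
  proof (cases "admissible A (j # w) i")
    case True
    then show ?thesis unfolding X.S_unit Y.S_unit o using I by (intro nf_unit) (auto simp: nf_index_def)
  next
    case False
    have "op_unit A (j # w, i) (v, i) = (\<lambda>\<xi> y n. 0)" by (intro ext op_unit_not_admissible False)
    then show ?thesis unfolding X.S_unit Y.S_unit o using nf_0 by (simp only: X.unit_eq_0[OF False] Y.unit_eq_0[OF False])
  qed
qed (auto simp: sum_distrib_left mult_scaleC_right op_gen_def fun_eq_iff)

lemma nf_star_gen:
  assumes "nf N K X Y L" "K < N"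
  shows "nf N (Suc K) (star (S j) * X) (star (T j) * Y) (\<lambda>\<xi>. op_star A j (L \<xi>))"
proof (rule nf_linear[OF assms(1), where F = "\<lambda>X. star (S j) * X" and G = "\<lambda>Y. star (T j) * Y" and H = "op_star A j"])
  fix w v i assume I: "((w, i), (v, i)) \<in> nf_index A N K"
  \<comment> \<open>\<open>K < N\<close> keeps the left word nonempty, so the starred generator has
    a symbol to cancel.\<close>
  then obtain k w' where w: "w = k # w'" using assms(2) by (cases w) (auto simp: nf_index_def)
  have adm: "admissible A (k # w') i" using I by (simp add: nf_index_def w)
  have o: "(\<lambda>\<xi>. op_star A j (op_unit A (k # w', i) (v, i) \<xi>)) = (if j = k then op_unit A (w', i) (v, i) else (\<lambda>\<xi> y n. 0))"
    by (rule ext) (simp add: op_star_unit[OF adm])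
  show "nf N (Suc K) (star (S j) * X.unit (w, i) (v, i)) (star (T j) * Y.unit (w, i) (v, i))
     (\<lambda>\<xi>. op_star A j (op_unit A (w, i) (v, i) \<xi>))"
  proof (cases "j = k")
    case True
    have "((w', i), (v, i)) \<in> nf_index A N (Suc K)" using I by (auto simp: nf_index_def w)
    then show ?thesis unfolding w o X.star_S_unit[OF adm] Y.star_S_unit[OF adm] using True nf_unit by simp
  next
    case False
    then show ?thesis unfolding w o X.star_S_unit[OF adm] Y.star_S_unit[OF adm] using nf_0 by simp
  qed
qed (auto simp: sum_distrib_left mult_scaleC_right op_star_def fun_eq_iff)

lemma op_id_nf:
  assumes "nf N K X Y L"
  shows "op_id A (L \<xi>) = L \<xi>"
proof -
  obtain c where "nf_coeffs N K c X Y L" using assms unfolding nf_def by blast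
  then have "L \<xi> y n = 0" if "y \<notin> shift_space A" for y n
    using that by (auto simp: nf_coeffs_def op_unit_def intro!: sum.neutral)
  then show ?thesis by (auto simp: op_id_def fun_eq_iff)
qed

text \<open>Induction on the left factor, with an arbitrary normal form on the right, avoids
  multiplying two normal forms. Raising \<open>N\<close> before each generator lengthens the left
  words, so that starred generators never use them up.\<close>

lemma nf_ck_rel_mult:
  "ck_rel A S T K X Y L \<Longrightarrow> nf N K' X' Y' L' \<Longrightarrow> \<exists>N'. nf N' (K + K') (X * X') (Y * Y') (\<lambda>\<xi>. L (L' \<xi>))"
proof (induction arbitrary: N K' X' Y' L' rule: ck_rel.induct)
  case (gen i)
  from nf_gen[OF nf_raise[OF gen, of "N + K' + 1"]] show ?case by auto
next
  case (star_gen i)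
  from nf_star_gen[OF nf_raise[OF star_gen, of "N + K' + 1"]] show ?case by auto
next
  case one
  then show ?case by (auto simp: op_id_nf)
next
  case (add K X1 Y1 L1 X2 Y2 L2)
  obtain N1 N2 where "nf N1 (K + K') (X1 * X') (Y1 * Y') (\<lambda>\<xi>. L1 (L' \<xi>))" "nf N2 (K + K') (X2 * X') (Y2 * Y') (\<lambda>\<xi>. L2 (L' \<xi>))"
    using add.IH(1)[OF add.prems] add.IH(2)[OF add.prems] by blast
  then have "nf (N1 + N2) (K + K') (X1 * X' + X2 * X') (Y1 * Y' + Y2 * Y') (\<lambda>\<xi> y n. L1 (L' \<xi>) y n + L2 (L' \<xi>) y n)"
    by (intro nf_add) (auto elim: nf_raise)
  then show ?case by (auto simp: distrib_right)
next
  case (scale K X Y L c)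
  then show ?case using nf_scale by (fastforce simp: mult_scaleC_left)
next
  case (mult K1 X1 Y1 L1 K2 X2 Y2 L2)
  obtain N2 where "nf N2 (K2 + K') (X2 * X') (Y2 * Y') (\<lambda>\<xi>. L2 (L' \<xi>))" using mult.IH(2)[OF mult.prems] by blast
  from mult.IH(1)[OF this] show ?case by (simp add: mult.assoc add.assoc)
next
  case (weaken K1 X1 Y1 L1 K2)
  then show ?case by (meson add_right_mono nf_weaken)
qed

lemma ck_rel_nf:
  assumes "ck_rel A S T K X Y L"
  shows "\<exists>N\<ge>K. nf N K X Y L"
proof -
  obtain N where N: "nf N (K + 0) (X * 1) (Y * 1) (\<lambda>\<xi>. L (op_id A \<xi>))"
    using nf_ck_rel_mult[OF assms nf_one] by blast
  then have "nf N K X Y L" by (simp add: ck_rel_op_id[OF assms])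
  then show ?thesis using nf_raise[of N K X Y L "N + K"] by (intro exI[of _ "N + K"]) auto
qed

end

section \<open>Uniqueness of Cuntz--Krieger algebras\<close>

text \<open>Sorting by the length of the left word separates the degrees; the condition on the end
  symbols turns into zero entries, so that full rectangles of words can be summed.\<close>

lemma sum_nf_index:
  assumes "K \<le> N"
  shows "(\<Sum>(a, b)\<in>nf_index A N K. f a b) =
    (\<Sum>m\<in>{N-K..N+K}. \<Sum>a\<in>words A m. \<Sum>b\<in>words A N. if snd a = snd b then f a b else (0::'z::comm_monoid_add))"
proof -
  let ?J = "\<lambda>m. {ab \<in> words A m \<times> words A N. snd (fst ab) = snd (snd ab)}"
  have "nf_index A N K = (\<Union>m\<in>{N-K..N+K}. ?J m)"
    using assms by (auto simp: nf_index_def words_def)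
  then have "(\<Sum>(a, b)\<in>nf_index A N K. f a b) = (\<Sum>m\<in>{N-K..N+K}. \<Sum>(a, b)\<in>?J m. f a b)"
  proof (simp only:, intro sum.UNION_disjoint ballI impI)
    show "finite (?J m)" for m by (rule finite_subset[of _ "words A m \<times> words A N"]) auto
    show "?J m \<inter> ?J m' = {}" if "m \<noteq> m'" for m m' using that by (auto simp: words_def)
  qed auto
  moreover have "(\<Sum>(a, b)\<in>?J m. f a b) = (\<Sum>a\<in>words A m. \<Sum>b\<in>words A N. if snd a = snd b then f a b else 0)" for m
  proof -
    have "(\<Sum>(a, b)\<in>?J m. f a b) = (\<Sum>ab\<in>words A m \<times> words A N. if snd (fst ab) = snd (snd ab) then f (fst ab) (snd ab) else 0)"
      unfolding split_def by (rule sum.inter_filter) auto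
    then show ?thesis by (simp add: sum.cartesian_product split_def)
  qed
  ultimately show ?thesis by simp
qed

context ck_family
begin

text \<open>For \<open>subprojections R\<close> this is the projection onto the words of length
  \<open>m\<close> ending in \<open>R\<close>; it serves to pick out a single degree.\<close>

definition Q :: "('n \<Rightarrow> 'a) \<Rightarrow> nat \<Rightarrow> 'a" where
  "Q R m = (\<Sum>x\<in>words A m. u R x * star (u R x))"

lemma star_Q: "star (Q R m) = Q R m"
  by (simp add: Q_def star_sum star_mult star_star)

lemma u_R: "subprojections R \<Longrightarrow> u R x * R (snd x) = u R x"
  by (simp add: u_def subprojections_def mult.assoc)

lemma R_P: "subprojections R \<Longrightarrow> R i * P i = R i"
  unfolding subprojections_def by (metis star_P star_mult)

lemma Q_u_R:
  assumes "subprojections R" "x \<in> words A m"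
  shows "Q R m * u R x = u R x"
proof -
  have "Q R m * u R x = (\<Sum>y\<in>words A m. if y = x then u R x * R (snd x) else 0)"
    unfolding Q_def sum_distrib_right
    using matrix_units_u[OF assms(1), of m] assms(2)
    by (intro sum.cong) (auto simp: matrix_units_def mult.assoc)
  then show ?thesis using assms by (simp add: u_R)
qed

lemma Q_u_P:
  assumes R: "subprojections R" and x: "x \<in> words A m"
  shows "Q R m * u P x = u R x"
proof -
  have "star (u R y) * u P x = (if y = x then R (snd x) else 0)" if y: "y \<in> words A m" for y
  proof -
    have "star (u R y) * u P x = R (snd y) * (star (W (fst y)) * (W (fst x) * P (snd x)))"
      using R by (simp add: u_def star_mult mult.assoc subprojections_def)
    also have "\<dots> = (if fst x = fst y then R (snd y) * P (snd x) else 0)"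
      using x y by (auto simp: star_W_W[OF subprojections_P] words_def)
    also have "\<dots> = (if y = x then R (snd x) else 0)"
    proof -
      have "R (snd y) * P (snd x) = R (snd y) * (P (snd y) * P (snd x))" using R_P[OF R] by (simp flip: mult.assoc)
      then have "R (snd y) * P (snd x) = (if snd y = snd x then R (snd x) else 0)"
        using R_P[OF R] P_orthogonal P_idem by auto
      then show ?thesis by (auto simp: prod_eq_iff)
    qed
    finally show ?thesis .
  qed
  then have "Q R m * u P x = (\<Sum>y\<in>words A m. if y = x then u R x * R (snd x) else 0)"
    unfolding Q_def sum_distrib_right by (intro sum.cong) (auto simp: mult.assoc)
  then show ?thesis using x by (simp add: u_R[OF R])
qed

lemma norm_Q_le_1:
  assumes "subprojections R"
  shows "norm (Q R m) \<le> 1"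
proof (rule norm_projection(1)[OF star_Q])
  show "Q R m * Q R m = Q R m"
    by (simp add: Q_def[of R m] sum_distrib_left)
       (simp add: Q_u_R[OF assms] flip: mult.assoc Q_def)
qed

text \<open>The shorter word either fails to match the initial part of the longer one or cancels it,
  leaving \<open>R i * W v2 * R j\<close> with \<open>v2\<close> nonempty and short.\<close>

lemma u_R_orthogonal:
  assumes R: "subprojections R" and ap: "\<And>i j w. w \<noteq> [] \<Longrightarrow> length w \<le> K \<Longrightarrow> R i * W w * R j = 0"
    and xy: "length (fst x) < length (fst y)" "length (fst y) \<le> length (fst x) + K"
  shows "star (u R x) * u R y = 0"
proof -
  obtain w i v j where x: "x = (w, i)" and y: "y = (v, j)" by (cases x, cases y)
  define v1 v2 where "v1 = take (length w) v" and "v2 = drop (length w) v"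
  have v: "v = v1 @ v2" "length v1 = length w" "v2 \<noteq> []" "length v2 \<le> K"
    using xy by (auto simp: v1_def v2_def x y)
  have Rs: "star (R i) = R i" for i using R by (simp add: subprojections_def)
  have "R i * star (W w) * W v1 = star (star (W v1) * (W w * R i))"
    by (simp add: star_mult star_star Rs mult.assoc)
  also have "\<dots> = (if v1 = w \<and> admissible A w i then R i else 0)"
    by (simp add: star_W_W[OF R] v(2) Rs)
  finally have "R i * star (W w) * W v1 * (W v2 * R j) = 0"
    using ap[OF v(3,4), of i j] by (simp add: mult.assoc)
  then show ?thesis by (simp add: x y u_def star_mult Rs v(1) W_append mult.assoc)
qed

lemma Q_u_eq_0:
  assumes R: "subprojections R" and ap: "\<And>i j w. w \<noteq> [] \<Longrightarrow> length w \<le> K \<Longrightarrow> R i * W w * R j = 0"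
    and x: "length (fst x) \<noteq> m" "length (fst x) \<le> m + K" "m \<le> length (fst x) + K"
  shows "Q R m * u R x = 0"
proof -
  have "star (u R y) * u R x = 0" if "y \<in> words A m" for y
  proof (cases "m < length (fst x)")
    case True
    then show ?thesis using u_R_orthogonal[OF R ap, of K y x] x that by (auto simp: words_def)
  next
    case False
    then have "star (u R x) * u R y = 0" using u_R_orthogonal[OF R ap, of K x y] x that by (auto simp: words_def)
    then have "star (star (u R x) * u R y) = 0" by simp
    then show ?thesis by (simp add: star_mult star_star)
  qed
  then show ?thesis by (simp add: Q_def sum_distrib_right mult.assoc)
qed

text \<open>\<open>m\<close> and the length of the left word both lie in \<open>{N-K..N+K}\<close>,
  so they differ by at most \<open>2 * K\<close>, the range in which aperiodicity removes the
  unit.\<close>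

lemma Q_unit_Q:
  assumes R: "subprojections R" and ap: "\<And>i j w. w \<noteq> [] \<Longrightarrow> length w \<le> 2 * K \<Longrightarrow> R i * W w * R j = 0"
    and ab: "(a, b) \<in> nf_index A N K" and m: "m \<in> {N-K..N+K}"
  shows "Q R m * unit a b * Q R N = (if length (fst a) = m then u R a * star (u R b) else 0)"
proof -
  have b: "b \<in> words A N" and ab': "snd a = snd b" using ab by (auto simp: nf_index_def)
  have Rs: "star (R i) = R i" for i using R by (simp add: subprojections_def)
  have "unit a b * Q R N = u P a * star (Q R N * u P b)"
    by (simp add: unit_def star_mult star_Q mult.assoc)
  also have "\<dots> = u P a * star (u R b * R (snd b))" by (simp add: Q_u_P[OF R b] u_R[OF R])
  also have "\<dots> = u P a * R (snd b) * star (u R b)" by (simp add: star_mult Rs mult.assoc)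
  also have "u P a * R (snd b) = u R a"
    using R by (simp add: u_def ab' subprojections_def mult.assoc)
  finally have 1: "Q R m * unit a b * Q R N = Q R m * u R a * star (u R b)" by (simp add: mult.assoc)
  show ?thesis
  proof (cases "length (fst a) = m")
    case True
    then have "a \<in> words A m" using ab by (auto simp: nf_index_def words_def)
    then show ?thesis using True 1 Q_u_R[OF R] by simp
  next
    case False
    have "Q R m * u R a = 0" by (rule Q_u_eq_0[OF R ap]) (use False ab m in \<open>auto simp: nf_index_def\<close>)
    then show ?thesis using False 1 by simp
  qed
qed

end

context ck_pair
begin

lemma nf_norm_le:
  assumes "nf N K X Y L" "K \<le> N"
  shows "norm X \<le> (2 * real K + 1) * norm Y"
proof -
  obtain c where c: "nf_coeffs N K c X Y L" using assms(1) unfolding nf_def by blast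
  \<comment> \<open>Extended by zero across different end symbols, the coefficients form block
    diagonal matrices, as the comparison of matrix sums demands.\<close>
  define d where "d = (\<lambda>(a::'n list \<times> 'n) (b::'n list \<times> 'n). if snd a = snd b then c a b else 0)"
  define D where "D = (\<lambda>m. matrix_sum (X.u X.P) (words A m) (words A N) d)"
  have X: "X = (\<Sum>m\<in>{N-K..N+K}. D m)"
  proof -
    have "X = (\<Sum>m\<in>{N-K..N+K}. \<Sum>a\<in>words A m. \<Sum>b\<in>words A N. if snd a = snd b then c a b *\<^sub>C X.unit a b else 0)"
      using c by (simp only: nf_coeffs_def sum_nf_index[OF assms(2)])
    also have "\<dots> = (\<Sum>m\<in>{N-K..N+K}. D m)"
      unfolding D_def matrix_sum_def d_def X.unit_def by (intro sum.cong refl) auto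
    finally show ?thesis .
  qed
  obtain R where R: "Y.subprojections R" and ap: "\<And>i j w. w \<noteq> [] \<Longrightarrow> length w \<le> 2 * K \<Longrightarrow> R i * Y.W w * R j = 0"
    using Y.exists_aperiodic_subprojections[of "2 * K"] by blast
  \<comment> \<open>The component in the first family is compared with the same coefficients on the
    units cut down by \<open>R\<close> in the second; the latter sum is exactly a compression of
    \<open>Y\<close>.\<close>
  have "norm (D m) \<le> norm Y" if m: "m \<in> {N-K..N+K}" for m
  proof -
    have "norm (D m) \<le> norm (matrix_sum (Y.u R) (words A m) (words A N) d)"
      unfolding D_def
      by (rule norm_matrix_sum_mono[OF X.matrix_units_u[OF X.subprojections_P] X.matrix_units_u[OF X.subprojections_P]
            Y.matrix_units_u[OF R] Y.matrix_units_u[OF R]]) (simp add: d_def)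
    also have "matrix_sum (Y.u R) (words A m) (words A N) d = Y.Q R m * Y * Y.Q R N"
    proof -
      have "Y.Q R m * Y * Y.Q R N = (\<Sum>(a, b)\<in>nf_index A N K. c a b *\<^sub>C (Y.Q R m * Y.unit a b * Y.Q R N))"
        using c by (simp add: nf_coeffs_def sum_distrib_left sum_distrib_right split_def mult_scaleC_left mult_scaleC_right)
      also have "\<dots> = (\<Sum>(a, b)\<in>nf_index A N K. c a b *\<^sub>C (if length (fst a) = m then Y.u R a * star (Y.u R b) else 0))"
        by (intro sum.cong refl) (auto simp: Y.Q_unit_Q[OF R ap _ m])
      also have "\<dots> = (\<Sum>m'\<in>{N-K..N+K}. if m' = m then matrix_sum (Y.u R) (words A m) (words A N) d else 0)"
        unfolding sum_nf_index[OF assms(2)] matrix_sum_def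
        by (intro sum.cong refl) (auto simp: words_def d_def intro!: sum.cong sum.neutral)
      finally show ?thesis using m by simp
    qed
    also have "norm (Y.Q R m * Y * Y.Q R N) \<le> norm (Y.Q R m) * norm Y * norm (Y.Q R N)"
      by (meson norm_mult_ineq mult_right_mono norm_ge_zero order_trans)
    also have "\<dots> \<le> 1 * norm Y * 1"
      by (intro mult_mono Y.norm_Q_le_1[OF R]) auto
    finally show ?thesis by simp
  qed
  then have "norm X \<le> (\<Sum>m\<in>{N-K..N+K}. norm Y)" unfolding X by (intro sum_norm_le)
  also have "\<dots> = (2 * real K + 1) * norm Y" using assms(2) by simp
  finally show ?thesis .
qed

lemma ck_rel_norm_le:
  assumes "ck_rel A S T K X Y L"
  shows "norm X \<le> norm Y"
proof -
  define x where "x = (\<lambda>n. ((\<lambda>z. z * z) ^^ n) (star X * X))"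
  define y where "y = (\<lambda>n. ((\<lambda>z. z * z) ^^ n) (star Y * Y))"
  have rel: "\<exists>L. ck_rel A S T (2 * K * 2 ^ n) (x n) (y n) L" for n
  proof (induction n)
    case 0
    obtain L' where "ck_rel A S T K (star X) (star Y) L'" using ck_rel_star[OF assms] by blast
    from ck_rel.mult[OF this assms] show ?case by (auto simp: x_def y_def mult_2)
  next
    case (Suc n)
    then obtain L where "ck_rel A S T (2 * K * 2 ^ n) (x n) (y n) L" by blast
    from ck_rel.mult[OF this this] show ?case by (auto simp: x_def y_def mult_2 algebra_simps)
  qed
  \<comment> \<open>The bound for \<open>star X * X\<close> is \<open>2 * K\<close> and that for its
    \<open>n\<close>-th iterated square \<open>2 * K * 2 ^ n\<close>; twice this plus 1 counts the
    components.\<close>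
  have "norm (x n) \<le> (4 * real K * 2 ^ n + 1) * norm (y n)" for n
  proof -
    obtain L where "ck_rel A S T (2 * K * 2 ^ n) (x n) (y n) L" using rel by blast
    then obtain N where "N \<ge> 2 * K * 2 ^ n" "nf N (2 * K * 2 ^ n) (x n) (y n) L" using ck_rel_nf by blast
    from nf_norm_le[OF this(2,1)] show ?thesis by (simp add: algebra_simps)
  qed
  then have "norm (x 0) \<le> norm (y 0)"
    by (intro norm_le_of_iterated_squares[where x = x and y = y and C = "4 * real K" and D = 1])
       (auto simp: x_def y_def star_mult star_star)
  then show ?thesis by (simp add: x_def y_def cstar_identity)
qed

text \<open>The coefficients of a normal form can be read off its operator: applied to the indicator
  of one point in one degree, and evaluated at a suitable place, only one unit contributes.\<close>

lemma ck_rel_eq_0: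
  assumes "ck_rel A S T K X Y (\<lambda>\<xi> y n. 0)"
  shows "X = 0"
proof -
  obtain N c where c: "nf_coeffs N K c X Y (\<lambda>\<xi> y n. 0)" using ck_rel_nf[OF assms] unfolding nf_def by blast
  have "c a b = 0" if ab: "(a, b) \<in> nf_index A N K" for a b
  proof -
    obtain w i v where a: "a = (w, i)" and b: "b = (v, i)" and v: "length v = N" and adm: "admissible A w i" "admissible A v i"
      using ab by (cases a, cases b) (auto simp: nf_index_def words_def)
    obtain z where z: "z \<in> shift_space A" "z 0 = i" using exists_separated_points[OF X.markov] by metis
    \<comment> \<open>Evaluation at \<open>cat w z\<close> in degree \<open>length w - N\<close>
      reaches degree 0 only through left words of length \<open>length w\<close>. The prefix then
      identifies \<open>w\<close>, and the point \<open>cat v z\<close> identifies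
      \<open>v\<close>.\<close>
    define \<xi> where "\<xi> = (\<lambda>y n. if y = cat v z \<and> n = (0::int) then (1::complex) else 0)"
    have w: "map (cat w z) [0..<length w] = w" "cat w z (length w) = i"
      by (auto simp: cat_def z intro: nth_equalityI)
    have *: "op_unit A a' b' \<xi> (cat w z) (int (length w) - int N) = (if (a', b') = (a, b) then 1 else 0)"
      if ab': "(a', b') \<in> nf_index A N K" for a' b'
    proof -
      obtain w' i' v' where a': "a' = (w', i')" and b': "b' = (v', i')" and v': "length v' = N"
        using ab' by (cases a', cases b') (auto simp: nf_index_def words_def)
      have inj: "v' = v" if "cat v' z = cat v z"
      proof (rule nth_equalityI)
        fix k assume "k < length v'"
        then show "v' ! k = v ! k" using fun_cong[OF that, of k] v v' by (simp add: cat_def)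
      qed (simp add: v v')
      define y where "y = cat w z"
      have y: "y \<in> shift_space A" "(shift ^^ length w) y = z" "map y [0..<length w] = w" "y (length w) = i"
        using z adm w by (auto simp: y_def cat_in_shift_space)
      have "op_unit A a' b' \<xi> y (int (length w) - int N) =
          (if map y [0..<length w'] = w' \<and> y (length w') = i' \<and> cat v' ((shift ^^ length w') y) = cat v z \<and> length w' = length w
           then 1 else 0)"
        using y(1) by (auto simp: op_unit_def Let_def a' b' \<xi>_def v')
      also have "(map y [0..<length w'] = w' \<and> y (length w') = i' \<and> cat v' ((shift ^^ length w') y) = cat v z \<and> length w' = length w)
          \<longleftrightarrow> (a', b') = (a, b)"
      proof (cases "length w' = length w")
        case True
        then show ?thesis using y inj by (auto simp: a a' b b' simp del: map_eq_conv)
      qed (auto simp: a a')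
      finally show ?thesis by (simp only: y_def)
    qed
    have "0 = (\<Sum>(a', b')\<in>nf_index A N K. c a' b' * op_unit A a' b' \<xi> (cat w z) (int (length w) - int N))"
    proof -
      have "(\<lambda>\<xi> y n. 0) = (\<lambda>\<xi> y n. \<Sum>(a', b')\<in>nf_index A N K. c a' b' * op_unit A a' b' \<xi> y n)"
        using c unfolding nf_coeffs_def by blast
      from fun_cong[OF fun_cong[OF fun_cong[OF this, of \<xi>], of "cat w z"], of "int (length w) - int N"]
      show ?thesis by (simp only:)
    qed
    also have "\<dots> = (\<Sum>x\<in>nf_index A N K. if x = (a, b) then c a b else 0)"
      by (intro sum.cong refl) (auto simp: * split: if_splits)
    finally show ?thesis using ab by simp
  qed
  then show ?thesis using c by (auto simp: nf_coeffs_def intro!: sum.neutral)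
qed

end

section \<open>From the comparison of norms to the isomorphism\<close>

lemma ck_rel_commute: "ck_rel A S T K X Y L \<Longrightarrow> ck_rel A T S K Y X L"
  by (induction rule: ck_rel.induct) (auto intro: ck_rel.intros)

lemma cstar_subalgebra_closure:
  fixes M :: "'a::cstar_algebra set"
  assumes "0 \<in> M" "\<And>x y. x \<in> M \<Longrightarrow> y \<in> M \<Longrightarrow> x + y \<in> M" "\<And>x y. x \<in> M \<Longrightarrow> y \<in> M \<Longrightarrow> x * y \<in> M"
    "\<And>c x. x \<in> M \<Longrightarrow> c *\<^sub>C x \<in> M" "\<And>x. x \<in> M \<Longrightarrow> star x \<in> M"
  shows "cstar_subalgebra (closure M)"
  unfolding cstar_subalgebra_def
proof (intro conjI ballI allI)
  show "0 \<in> closure M" using assms(1) closure_subset by blast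
  fix x y assume x: "x \<in> closure M" and y: "y \<in> closure M"
  obtain f g where f: "\<And>n. f n \<in> M" "f \<longlonglongrightarrow> x" and g: "\<And>n. g n \<in> M" "g \<longlonglongrightarrow> y"
    using x y unfolding closure_sequential by blast
  show "x + y \<in> closure M" unfolding closure_sequential
    by (intro exI[of _ "\<lambda>n. f n + g n"] conjI allI assms f g tendsto_add)
  show "x * y \<in> closure M" unfolding closure_sequential
    by (intro exI[of _ "\<lambda>n. f n * g n"] conjI allI assms f g tendsto_mult)
  show "star x \<in> closure M" unfolding closure_sequential
    by (intro exI[of _ "\<lambda>n. star (f n)"] conjI allI assms f bounded_linear.tendsto[OF bounded_linear_star])
next
  fix c x assume x: "x \<in> closure M"
  obtain f where f: "\<And>n. f n \<in> M" "f \<longlonglongrightarrow> x" using x unfolding closure_sequential by blast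
  show "c *\<^sub>C x \<in> closure M" unfolding closure_sequential
    by (intro exI[of _ "\<lambda>n. c *\<^sub>C f n"] conjI allI assms f bounded_linear.tendsto[OF bounded_linear_scaleC_right])
qed auto

lemma cuntz_krieger_algebra_ck_family:
  "markov_matrix A \<Longrightarrow> cuntz_krieger_algebra A S \<Longrightarrow> ck_family A S"
  by unfold_locales (auto simp: cuntz_krieger_algebra_def partial_isometry_def)

lemma generated_subset:
  assumes "cstar_subalgebra hull (range S) = UNIV" "cstar_subalgebra M" "\<And>i. S i \<in> M"
  shows "M = UNIV"
proof -
  have "cstar_subalgebra hull (range S) \<subseteq> M" using assms(2,3) by (intro hull_minimal) auto
  then show ?thesis using assms(1) by auto
qed

text \<open>Exchanging \<open>S\<close> and \<open>T\<close> upgrades the contraction to an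
  isometry, and since both families generate, both projections of the graph are dense.\<close>

theorem cuntz_krieger_uniqueness:
  assumes "markov_matrix A" "cuntz_krieger_algebra A S" "cuntz_krieger_algebra A T"
  shows "\<exists>\<Phi>. star_iso \<Phi> \<and> (\<forall>i. \<Phi> (S i) = T i)"
proof -
  note ck = cuntz_krieger_algebra_ck_family[OF assms(1,2)] cuntz_krieger_algebra_ck_family[OF assms(1,3)]
  interpret ST: ck_pair A S T using ck by (simp add: ck_pair_def)
  interpret TS: ck_pair A T S using ck by (simp add: ck_pair_def)
  define G where "G = {(X, Y). \<exists>K L. ck_rel A S T K X Y L}"
  have gen: "(S i, T i) \<in> G" for i unfolding G_def using ck_rel.gen by fastforce
  have one: "(1, 1) \<in> G" unfolding G_def using ck_rel.one by fastforce
  have add: "(x + x', y + y') \<in> G" if xy: "(x, y) \<in> G" "(x', y') \<in> G" for x y x' y'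
  proof -
    obtain K L K' L' where "ck_rel A S T K x y L" "ck_rel A S T K' x' y' L'" using xy unfolding G_def by blast
    then have "ck_rel A S T (K + K') x y L" "ck_rel A S T (K + K') x' y' L'" by (auto intro: ck_rel.weaken)
    from ck_rel.add[OF this] show ?thesis by (auto simp: G_def)
  qed
  have mult: "(x * x', y * y') \<in> G" if "(x, y) \<in> G" "(x', y') \<in> G" for x y x' y'
    using that unfolding G_def by (auto dest: ck_rel.mult)
  have scale: "(c *\<^sub>C x, c *\<^sub>C y) \<in> G" if "(x, y) \<in> G" for c x y
    using that unfolding G_def by (auto dest: ck_rel.scale)
  have star: "(star x, star y) \<in> G" if xy: "(x, y) \<in> G" for x y
  proof -
    obtain K L where "ck_rel A S T K x y L" using xy unfolding G_def by blast
    from ck_rel_star[OF this] show ?thesis unfolding G_def by blast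
  qed
  have zero: "(0, 0) \<in> G" using scale[OF one, of 0] by simp
  have "\<exists>\<Phi>. star_iso \<Phi> \<and> (\<forall>x y. (x, y) \<in> G \<longrightarrow> \<Phi> x = y)"
  proof (rule star_iso_extension[OF add mult scale star])
    show "norm x = norm y" if "(x, y) \<in> G" for x y
      using that ST.ck_rel_norm_le TS.ck_rel_norm_le[OF ck_rel_commute] by (fastforce simp: G_def intro: antisym)
    have fst: "x \<in> fst ` G \<longleftrightarrow> (\<exists>y. (x, y) \<in> G)" and snd: "y \<in> snd ` G \<longleftrightarrow> (\<exists>x. (x, y) \<in> G)" for x y by force+
    show "closure (fst ` G) = UNIV"
    proof (rule generated_subset[of S])
      show "cstar_subalgebra hull range S = UNIV" using assms(2) by (simp add: cuntz_krieger_algebra_def)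
      show "cstar_subalgebra (closure (fst ` G))"
        by (rule cstar_subalgebra_closure) (unfold fst, blast intro: zero, blast intro: add, blast intro: mult, blast intro: scale, blast intro: star)
      have "S i \<in> fst ` G" for i using gen[of i] unfolding fst by blast
      then show "S i \<in> closure (fst ` G)" for i using closure_subset by blast
    qed
    show "closure (snd ` G) = UNIV"
    proof (rule generated_subset[of T])
      show "cstar_subalgebra hull range T = UNIV" using assms(3) by (simp add: cuntz_krieger_algebra_def)
      show "cstar_subalgebra (closure (snd ` G))"
        by (rule cstar_subalgebra_closure) (unfold snd, blast intro: zero, blast intro: add, blast intro: mult, blast intro: scale, blast intro: star)
      have "T i \<in> snd ` G" for i using gen[of i] unfolding snd by blast
      then show "T i \<in> closure (snd ` G)" for i using closure_subset by blast
    qed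
  qed
  then show ?thesis using gen by blast
qed


section \<open>The gauge action\<close>

lemma star_iso_eq_on_generators:
  assumes "cstar_subalgebra hull (range S) = UNIV" "star_iso \<phi>" "star_iso \<psi>" "\<And>i. \<phi> (S i) = \<psi> (S i)"
  shows "\<phi> = \<psi>"
proof -
  have h: "star_hom \<phi>" "star_hom \<psi>" using assms by (auto simp: star_iso_def)
  have "{x. \<phi> x = \<psi> x} = UNIV"
  proof (rule generated_subset[OF assms(1)])
    show "cstar_subalgebra {x. \<phi> x = \<psi> x}"
      unfolding cstar_subalgebra_def
      by (auto simp: star_homD[OF h(1)] star_homD[OF h(2)] intro!: closed_Collect_eq star_iso_continuous assms)
  qed (use assms in auto)
  then show ?thesis by auto
qed

lemma hull_scaled_generators:
  fixes S :: "'n \<Rightarrow> 'a::cstar_algebra"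
  assumes "cstar_subalgebra hull (range S) = UNIV" "c \<noteq> 0"
  shows "cstar_subalgebra hull (range (\<lambda>i. c *\<^sub>C S i)) = UNIV"
proof (rule generated_subset[OF assms(1)])
  let ?M = "cstar_subalgebra hull (range (\<lambda>i. c *\<^sub>C S i))"
  show M: "cstar_subalgebra ?M"
    by (rule hull_in) (auto simp: cstar_subalgebra_def)
  fix i
  have "c *\<^sub>C S i \<in> ?M" by (rule hull_inc) auto
  then have "(1 / c) *\<^sub>C (c *\<^sub>C S i) \<in> ?M" using M unfolding cstar_subalgebra_def by blast
  then show "S i \<in> ?M" using assms(2) by (simp add: scaleC_scaleC)
qed

text \<open>The rotated generators again form a generating family, so uniqueness provides the
  automorphism and the definite description is legitimate.\<close>

lemma gauge_action:
  assumes "markov_matrix A" "cuntz_krieger_algebra A S"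
  shows "star_iso (gauge_action S t)" and "gauge_action S t (S i) = cis (2 * pi * t) *\<^sub>C S i"
proof -
  define c where "c = cis (2 * pi * t)"
  have c: "cnj c * c = 1" "c * cnj c = 1" "c \<noteq> 0" by (simp_all add: c_def cis_mult cis_cnj)
  have "cuntz_krieger_algebra A (\<lambda>i. c *\<^sub>C S i)"
    using assms(2) hull_scaled_generators[of S c] unfolding cuntz_krieger_algebra_def
    by (auto simp: partial_isometry_def star_scaleC mult_scaleC_left mult_scaleC_right scaleC_scaleC c mult.assoc)
  then obtain \<theta> where "star_iso \<theta>" "\<And>i. \<theta> (S i) = c *\<^sub>C S i"
    using cuntz_krieger_uniqueness assms by blast
  then have "\<exists>!\<theta>. star_iso \<theta> \<and> (\<forall>i. \<theta> (S i) = c *\<^sub>C S i)"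
  proof (intro ex1I[of _ \<theta>] conjI allI)
    fix \<theta>' assume "star_iso \<theta>' \<and> (\<forall>i. \<theta>' (S i) = c *\<^sub>C S i)"
    then show "\<theta>' = \<theta>"
      using \<open>star_iso \<theta>\<close> \<open>\<And>i. \<theta> (S i) = c *\<^sub>C S i\<close> assms(2)
      by (intro star_iso_eq_on_generators[of S]) (auto simp: cuntz_krieger_algebra_def)
  qed
  from theI'[OF this] show "star_iso (gauge_action S t)" "gauge_action S t (S i) = cis (2 * pi * t) *\<^sub>C S i"
    by (auto simp: gauge_action_def c_def)
qed

lemma gauge_action_periodic:
  assumes "markov_matrix A" "cuntz_krieger_algebra A S"
  shows "gauge_action S (t + 1) = gauge_action S t"
proof (rule star_iso_eq_on_generators[of S])
  show "cstar_subalgebra hull range S = UNIV" using assms(2) by (simp add: cuntz_krieger_algebra_def)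
  have "cis (2 * pi * (t + 1)) = cis (2 * pi * t)" by (simp add: distrib_left flip: cis_mult)
  then show "gauge_action S (t + 1) (S i) = gauge_action S t (S i)" for i by (simp add: gauge_action[OF assms])
qed (rule gauge_action(1)[OF assms])+

text \<open>The elements with continuous orbits form a C*-subalgebra containing the generators; it
  is closed because isometric automorphisms make convergence uniform in \<open>t\<close>.\<close>

lemma gauge_action_continuous_pointwise:
  assumes "markov_matrix A" "cuntz_krieger_algebra A S"
  shows "continuous_on UNIV (\<lambda>t. gauge_action S t x)"
proof -
  let ?\<alpha> = "gauge_action S"
  let ?M = "{x. continuous_on UNIV (\<lambda>t. ?\<alpha> t x)}"
  have h: "star_hom (?\<alpha> t)" for t using gauge_action(1)[OF assms] by (simp add: star_iso_def)
  have "?M = UNIV"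
  proof (rule generated_subset[of S])
    show "cstar_subalgebra hull range S = UNIV" using assms(2) by (simp add: cuntz_krieger_algebra_def)
    show "S i \<in> ?M" for i
      by (auto simp: gauge_action(2)[OF assms] intro!: continuous_on_scaleC continuous_intros)
    have closed: "x \<in> ?M" if f: "\<And>n::nat. f n \<in> ?M" "f \<longlonglongrightarrow> x" for f x
    proof -
      have "uniform_limit UNIV (\<lambda>n t. ?\<alpha> t (f n)) (\<lambda>t. ?\<alpha> t x) sequentially"
      proof (rule uniform_limitI)
        fix e :: real assume "e > 0"
        then have "eventually (\<lambda>n. dist (f n) x < e) sequentially" using f(2) by (auto simp: tendsto_iff)
        moreover have "dist (?\<alpha> t (f n)) (?\<alpha> t x) = dist (f n) x" for n t
          using star_iso_norm[OF gauge_action(1)[OF assms], of t "f n - x"] by (simp add: dist_norm star_homD[OF h])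
        ultimately show "eventually (\<lambda>n. \<forall>t\<in>UNIV. dist (?\<alpha> t (f n)) (?\<alpha> t x) < e) sequentially" by simp
      qed
      then show ?thesis using f(1) by (auto intro: uniform_limit_theorem[rotated])
    qed
    show "cstar_subalgebra ?M"
      unfolding cstar_subalgebra_def
      by (auto simp: star_homD[OF h] intro!: continuous_intros continuous_on_scaleC
          bounded_linear.continuous_on[OF bounded_linear_star]) (auto simp: closed_sequential_limits intro: closed[simplified])
  qed
  then show ?thesis by auto
qed

section \<open>Elements given by their operators\<close>

definition op_word :: "nat^'n^'n \<Rightarrow> 'n list \<Rightarrow> 'n operator" where
  "op_word A w \<xi> = (\<lambda>y n. if y \<in> shift_space A \<and> map y [0..<length w] = w
     then \<xi> ((shift ^^ length w) y) (n - int (length w)) else 0)"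

definition op_word_star :: "nat^'n^'n \<Rightarrow> 'n list \<Rightarrow> 'n operator" where
  "op_word_star A w \<xi> = (\<lambda>y n. if cat w y \<in> shift_space A then \<xi> (cat w y) (n + int (length w)) else 0)"

lemma op_word_Nil: "op_word A [] = op_id A"
  by (intro ext) (simp add: op_word_def op_id_def)

lemma op_word_star_Nil: "op_word_star A [] = op_id A"
  by (intro ext) (simp add: op_word_star_def op_id_def)

lemma op_word_Cons:
  fixes A :: "nat^'n^'n"
  shows "op_word A (j # w) \<xi> = op_gen A j (op_word A w \<xi>)"
proof (intro ext)
  fix y :: "nat \<Rightarrow> 'n" and n :: int
  have 1: "map y [0..<Suc (length w)] = y 0 # map (shift y) [0..<length w]"
    by (simp add: map_upt_Suc shift_def del: upt_Suc)
  have 2: "(shift ^^ Suc (length w)) y = (shift ^^ length w) (shift y)" by (simp add: funpow_swap1)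
  show "op_word A (j # w) \<xi> y n = op_gen A j (op_word A w \<xi>) y n"
    using shift_in_shift_space1[of y A]
    unfolding op_gen_def op_word_def length_Cons 1 2 by (auto simp: algebra_simps)
qed

lemma op_word_star_Cons: "op_word_star A (j # w) \<xi> = op_word_star A w (op_star A j \<xi>)"
proof (intro ext)
  fix y n
  have "cat (j # w) y = cat [j] (cat w y)" using cat_append[of "[j]" w y] by simp
  moreover have "cat [j] (cat w y) \<in> shift_space A \<Longrightarrow> cat w y \<in> shift_space A" by (simp add: cat_in_shift_space)
  ultimately show "op_word_star A (j # w) \<xi> y n = op_word_star A w (op_star A j \<xi>) y n"
    by (auto simp: op_word_star_def op_star_def algebra_simps)
qed

lemma op_word_word_star:
  "op_word A w (op_word_star A v \<xi>) y n =
    (if y \<in> shift_space A \<and> map y [0..<length w] = w \<and> cat v ((shift ^^ length w) y) \<in> shift_space A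
     then \<xi> (cat v ((shift ^^ length w) y)) (n - int (length w) + int (length v)) else 0)"
  by (simp add: op_word_def op_word_star_def)

text \<open>The partial map \<open>\<phi>\<close> with domain \<open>V\<close> replaces the prefix \<open>w\<close> by \<open>v w\<close>; \<open>\<psi>\<close> is its inverse.\<close>

lemma sum_op_prefix_map:
  fixes A :: "nat^'n^'n"
  assumes V: "\<And>y. y \<in> shift_space A \<Longrightarrow> V y \<longleftrightarrow> map y [0..<N] \<in> I"
    and I: "\<And>w. w \<in> I \<Longrightarrow> length w = N"
    and \<phi>: "\<And>y. y \<in> shift_space A \<Longrightarrow> V y \<Longrightarrow> \<phi> y \<in> shift_space A \<and>
        \<phi> y = cat (v (map y [0..<N])) ((shift ^^ N) y) \<and> d y = int N - int (length (v (map y [0..<N])))"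
  shows "(\<Sum>w\<in>I. op_word A w (op_word_star A (v w) \<xi>) y n) =
      (if y \<in> shift_space A \<and> V y then \<xi> (\<phi> y) (n - d y) else 0)"
    and "\<lbrakk>\<And>y. y \<in> shift_space A \<Longrightarrow> V y \<Longrightarrow> \<psi> (\<phi> y) = y\<rbrakk> \<Longrightarrow>
      (\<Sum>w\<in>I. op_word A (v w) (op_word_star A w \<xi>) y n) =
      (if \<exists>z\<in>shift_space A. V z \<and> \<phi> z = y then \<xi> (\<psi> y) (n + d (\<psi> y)) else 0)"
proof -
  have "finite {w::'n list. set w \<subseteq> UNIV \<and> length w = N}" by (intro finite_lists_length_eq) auto
  then have fin: "finite I" by (rule rev_finite_subset) (auto simp: I)
  show "(\<Sum>w\<in>I. op_word A w (op_word_star A (v w) \<xi>) y n) =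
      (if y \<in> shift_space A \<and> V y then \<xi> (\<phi> y) (n - d y) else 0)"
  proof -
    have "(\<Sum>w\<in>I. op_word A w (op_word_star A (v w) \<xi>) y n)
        = (\<Sum>w\<in>I. if w = map y [0..<N] then (if y \<in> shift_space A then \<xi> (\<phi> y) (n - d y) else 0) else 0)"
    proof (rule sum.cong[OF refl])
      fix w assume w: "w \<in> I"
      show "op_word A w (op_word_star A (v w) \<xi>) y n
        = (if w = map y [0..<N] then (if y \<in> shift_space A then \<xi> (\<phi> y) (n - d y) else 0) else 0)"
      proof (cases "y \<in> shift_space A \<and> w = map y [0..<N]")
        case True
        then have "V y" using V w by simp
        have "\<phi> y \<in> shift_space A" "cat (v w) ((shift ^^ N) y) = \<phi> y" "n - d y = n - int N + int (length (v w))"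
        proof -
          have f: "\<phi> y \<in> shift_space A \<and> \<phi> y = cat (v w) ((shift ^^ N) y) \<and> d y = int N - int (length (v w))"
            unfolding conjunct2[OF True] by (rule \<phi>[OF conjunct1[OF True] \<open>V y\<close>])
          then show "\<phi> y \<in> shift_space A" "cat (v w) ((shift ^^ N) y) = \<phi> y" by (blast, metis)
          show "n - d y = n - int N + int (length (v w))" using f by simp
        qed
        note e = this
        have c: "y \<in> shift_space A" "map y [0..<N] = w" using True by simp_all
        have "op_word A w (op_word_star A (v w) \<xi>) y n = \<xi> (\<phi> y) (n - int N + int (length (v w)))"
          unfolding op_word_word_star I[OF w] using c e(1,2) by simp
        then show ?thesis using c by (simp add: e(3))
      qed (use I[OF w] in \<open>auto simp: op_word_word_star\<close>)
    qed
    then show ?thesis using fin V by auto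
  qed
  assume \<psi>: "\<And>y. y \<in> shift_space A \<Longrightarrow> V y \<Longrightarrow> \<psi> (\<phi> y) = y"
  \<comment> \<open>The summand of \<open>w\<close> is active at \<open>y\<close> exactly if
    \<open>y\<close> is the image of a domain point with prefix \<open>w\<close>. That point is
    \<open>\<psi> y\<close>, so at most one summand survives.\<close>
  have cond: "(y \<in> shift_space A \<and> map y [0..<length (v w)] = v w \<and> cat w ((shift ^^ length (v w)) y) \<in> shift_space A)
      \<longleftrightarrow> (\<exists>z\<in>shift_space A. V z \<and> \<phi> z = y) \<and> w = map (\<psi> y) [0..<N]"
    and val: "\<lbrakk>y \<in> shift_space A; map y [0..<length (v w)] = v w; cat w ((shift ^^ length (v w)) y) \<in> shift_space A\<rbrakk> \<Longrightarrow>
      cat w ((shift ^^ length (v w)) y) = \<psi> y \<and> int N - int (length (v w)) = d (\<psi> y)"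
    if w: "w \<in> I" for w
  proof -
    have *: "\<exists>z\<in>shift_space A. V z \<and> \<phi> z = y \<and> z = cat w ((shift ^^ length (v w)) y) \<and> map z [0..<N] = w"
      if c: "y \<in> shift_space A" "map y [0..<length (v w)] = v w" "cat w ((shift ^^ length (v w)) y) \<in> shift_space A"
    proof -
      define z where "z = cat w ((shift ^^ length (v w)) y)"
      have z: "z \<in> shift_space A" "map z [0..<N] = w" "(shift ^^ N) z = (shift ^^ length (v w)) y"
      proof -
        show "z \<in> shift_space A" using c by (simp add: z_def)
        show "map z [0..<N] = w" by (rule nth_equalityI) (simp_all add: z_def cat_def I[OF w])
        show "(shift ^^ N) z = (shift ^^ length (v w)) y"
          unfolding z_def I[OF w, symmetric] by (rule shift_power_cat)
      qed
      then have "V z" using V w by simp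
      moreover have "\<phi> z = cat (map y [0..<length (v w)]) ((shift ^^ length (v w)) y)"
        using \<phi>[OF z(1) \<open>V z\<close>] z c by simp
      then have "\<phi> z = y" by (simp only: cat_map_shift_power)
      ultimately show ?thesis using z by (auto simp: z_def)
    qed
    have **: "y \<in> shift_space A \<and> map y [0..<length (v w)] = v w \<and> cat w ((shift ^^ length (v w)) y) \<in> shift_space A"
      if z: "z \<in> shift_space A" "V z" "\<phi> z = y" "w = map (\<psi> y) [0..<N]" for z
    proof -
      have w': "w = map z [0..<N]" using \<psi>[OF z(1,2)] z by simp
      have y: "y \<in> shift_space A" "y = cat (v w) ((shift ^^ N) z)" using \<phi>[OF z(1,2)] z(3) w' by auto
      have "map y [0..<length (v w)] = v w" by (rule nth_equalityI) (simp_all add: y(2) cat_def)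
      moreover have "(shift ^^ length (v w)) y = (shift ^^ N) z" by (simp add: y(2))
      then have "cat w ((shift ^^ length (v w)) y) = z" by (simp add: w' cat_map_shift_power)
      ultimately show ?thesis using y(1) z(1) by simp
    qed
    show "(y \<in> shift_space A \<and> map y [0..<length (v w)] = v w \<and> cat w ((shift ^^ length (v w)) y) \<in> shift_space A)
      \<longleftrightarrow> (\<exists>z\<in>shift_space A. V z \<and> \<phi> z = y) \<and> w = map (\<psi> y) [0..<N]"
    proof
      assume "y \<in> shift_space A \<and> map y [0..<length (v w)] = v w \<and> cat w ((shift ^^ length (v w)) y) \<in> shift_space A"
      with * obtain z where z: "z \<in> shift_space A" "V z" "\<phi> z = y" "map z [0..<N] = w" by blast
      have "\<psi> y = z" using \<psi>[OF z(1,2)] z(3) by simp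
      then show "(\<exists>z\<in>shift_space A. V z \<and> \<phi> z = y) \<and> w = map (\<psi> y) [0..<N]" using z by blast
    next
      assume "(\<exists>z\<in>shift_space A. V z \<and> \<phi> z = y) \<and> w = map (\<psi> y) [0..<N]"
      then show "y \<in> shift_space A \<and> map y [0..<length (v w)] = v w \<and> cat w ((shift ^^ length (v w)) y) \<in> shift_space A"
        using ** by blast
    qed
    show "cat w ((shift ^^ length (v w)) y) = \<psi> y \<and> int N - int (length (v w)) = d (\<psi> y)"
      if c: "y \<in> shift_space A" "map y [0..<length (v w)] = v w" "cat w ((shift ^^ length (v w)) y) \<in> shift_space A"
    proof -
      obtain z where z: "z \<in> shift_space A" "V z" "\<phi> z = y" "cat w ((shift ^^ length (v w)) y) = z" "map z [0..<N] = w"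
        using *[OF c] by metis
      have "\<psi> y = z" using \<psi>[OF z(1,2)] z(3) by simp
      moreover have "d z = int N - int (length (v w))" using \<phi>[OF z(1,2)] z(5) by simp
      ultimately show ?thesis using z(4) by simp
    qed
  qed
  show "(\<Sum>w\<in>I. op_word A (v w) (op_word_star A w \<xi>) y n) =
      (if \<exists>z\<in>shift_space A. V z \<and> \<phi> z = y then \<xi> (\<psi> y) (n + d (\<psi> y)) else 0)"
  proof -
    let ?R = "\<exists>z\<in>shift_space A. V z \<and> \<phi> z = y"
    have "(\<Sum>w\<in>I. op_word A (v w) (op_word_star A w \<xi>) y n)
        = (\<Sum>w\<in>I. if w = map (\<psi> y) [0..<N] then (if ?R then \<xi> (\<psi> y) (n + d (\<psi> y)) else 0) else 0)"
    proof (rule sum.cong[OF refl])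
      fix w assume w: "w \<in> I"
      show "op_word A (v w) (op_word_star A w \<xi>) y n
        = (if w = map (\<psi> y) [0..<N] then (if ?R then \<xi> (\<psi> y) (n + d (\<psi> y)) else 0) else 0)"
      proof (cases "?R \<and> w = map (\<psi> y) [0..<N]")
        case True
        with cond[OF w] have c: "y \<in> shift_space A" "map y [0..<length (v w)] = v w" "cat w ((shift ^^ length (v w)) y) \<in> shift_space A"
          by blast+
        have "n - int (length (v w)) + int (length w) = n + d (\<psi> y)" using val[OF w c] I[OF w] by simp
        moreover have "cat w ((shift ^^ length (v w)) y) = \<psi> y" using val[OF w c] by simp
        ultimately show ?thesis using True c by (simp only: op_word_word_star) simp
      next
        case False
        with cond[OF w] show ?thesis by (auto simp: op_word_word_star)
      qed
    qed
    also have "\<dots> = (if ?R then \<xi> (\<psi> y) (n + d (\<psi> y)) else 0)"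
    proof (cases ?R)
      case True
      then have "map (\<psi> y) [0..<N] \<in> I" using V \<psi> by auto
      then show ?thesis using fin by simp
    next
      case False
      show ?thesis unfolding if_not_P[OF False] by simp
    qed
    finally show ?thesis .
  qed
qed

context ck_family
begin

text \<open>Taking both families equal leaves only the link between an element and its
  operator.\<close>

definition realizes :: "'a \<Rightarrow> 'n operator \<Rightarrow> bool" where
  "realizes X L \<longleftrightarrow> (\<exists>K. ck_rel A S S K X X L)"

lemma realizes_gen: "realizes (S i) (op_gen A i)" and realizes_star_gen: "realizes (star (S i)) (op_star A i)"
  and realizes_one: "realizes 1 (op_id A)"
  unfolding realizes_def by (rule exI, rule ck_rel.gen, rule exI, rule ck_rel.star_gen, rule exI, rule ck_rel.one)

lemma realizes_scale: "realizes X L \<Longrightarrow> realizes (c *\<^sub>C X) (\<lambda>\<xi> y n. c * L \<xi> y n)"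
  unfolding realizes_def using ck_rel.scale by fast

lemma realizes_mult: "realizes X L \<Longrightarrow> realizes X' L' \<Longrightarrow> realizes (X * X') (\<lambda>\<xi>. L (L' \<xi>))"
  unfolding realizes_def using ck_rel.mult by fast

lemma realizes_add:
  assumes "realizes X L" "realizes X' L'"
  shows "realizes (X + X') (\<lambda>\<xi> y n. L \<xi> y n + L' \<xi> y n)"
proof -
  obtain K K' where "ck_rel A S S K X X L" "ck_rel A S S K' X' X' L'" using assms unfolding realizes_def by blast
  then have "ck_rel A S S (K + K') X X L" "ck_rel A S S (K + K') X' X' L'" by (auto intro: ck_rel.weaken)
  then show ?thesis unfolding realizes_def by (intro exI, rule ck_rel.add)
qed

lemma realizes_sum:
  assumes "\<And>j. j \<in> J \<Longrightarrow> realizes (f j) (h j)"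
  shows "realizes (\<Sum>j\<in>J. f j) (\<lambda>\<xi> y n. \<Sum>j\<in>J. h j \<xi> y n)"
proof -
  have 0: "realizes 0 (\<lambda>\<xi> y n. 0)" using realizes_scale[OF realizes_one, of 0] by simp
  show ?thesis using assms
    by (induction J rule: infinite_finite_induct) (auto simp: 0 intro: realizes_add)
qed

text \<open>The difference has the zero operator and vanishes by \<open>ck_rel_eq_0\<close>.
  Identities in the algebra thus become computations with points and degrees.\<close>

lemma realizes_unique:
  assumes "realizes X L" "realizes X' L"
  shows "X = X'"
proof -
  interpret SS: ck_pair A S S by unfold_locales
  have "realizes (X + (-1) *\<^sub>C X') (\<lambda>\<xi> y n. L \<xi> y n + (-1) * L \<xi> y n)"
    by (intro realizes_add realizes_scale assms)
  then have "\<exists>K. ck_rel A S S K (X + (-1) *\<^sub>C X') (X + (-1) *\<^sub>C X') (\<lambda>\<xi> y n. 0)"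
    unfolding realizes_def by simp
  then have "X + (-1) *\<^sub>C X' = 0" using SS.ck_rel_eq_0 by blast
  then show ?thesis by simp
qed

lemma realizes_W: "realizes (W w) (op_word A w)"
proof (induction w)
  case (Cons j w)
  have "op_word A (j # w) = (\<lambda>\<xi>. op_gen A j (op_word A w \<xi>))" by (rule ext) (rule op_word_Cons)
  then show ?case using realizes_mult[OF realizes_gen Cons] by (simp add: W_Cons)
qed (simp add: op_word_Nil realizes_one)

lemma realizes_star_W: "realizes (star (W w)) (op_word_star A w)"
proof (induction w)
  case (Cons j w)
  have "op_word_star A (j # w) = (\<lambda>\<xi>. op_word_star A w (op_star A j \<xi>))" by (rule ext) (rule op_word_star_Cons)
  then show ?case using realizes_mult[OF Cons realizes_star_gen] by (simp add: W_Cons star_mult)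
qed (simp add: op_word_star_Nil realizes_one)

end

section \<open>Finite determination of continuous functions\<close>

definition determined :: "nat^'n^'n \<Rightarrow> nat \<Rightarrow> ((nat \<Rightarrow> 'n) \<Rightarrow> 'z) \<Rightarrow> bool" where
  "determined A N f \<longleftrightarrow> (\<forall>y\<in>shift_space A. \<forall>z\<in>shift_space A. (\<forall>n<N. y n = z n) \<longrightarrow> f y = f z)"

lemma determined_mono: "determined A N f \<Longrightarrow> N \<le> M \<Longrightarrow> determined A M f"
  unfolding determined_def by (meson order_less_le_trans)

lemma determinedD:
  "determined A N f \<Longrightarrow> y \<in> shift_space A \<Longrightarrow> z \<in> shift_space A \<Longrightarrow> map y [0..<N] = map z [0..<N] \<Longrightarrow> f y = f z"
proof -
  assume d: "determined A N f" and yz: "y \<in> shift_space A" "z \<in> shift_space A" and m: "map y [0..<N] = map z [0..<N]"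
  have "\<forall>n<N. y n = z n" using m by (simp add: map_eq_conv)
  then show "f y = f z" using d yz unfolding determined_def by blast
qed

lemma topspace_shift_top [simp]: "topspace (shift_top A) = shift_space A"
  by (simp add: shift_top_def)

lemma compact_space_shift_top:
  fixes A :: "nat^'n^'n"
  shows "compact_space (shift_top A)"
proof -
  let ?X = "product_topology (\<lambda>_::nat. discrete_topology (UNIV :: 'n set)) UNIV"
  have "compact_space ?X"
    by (simp add: compact_space_product_topology compact_space_discrete_topology)
  moreover have "closedin ?X (shift_space A)"
  proof -
    have "closedin ?X {x \<in> topspace ?X. A $ x n $ x (Suc n) \<in> {1}}" for n
    proof -
      have p: "closedin ?X {x \<in> topspace ?X. x k \<in> {i}}" for k i
        by (rule closedin_continuous_map_preimage[OF continuous_map_product_projection]) auto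
      have "closedin ?X (\<Union>ij\<in>{(i, j). A $ i $ j = 1}. {x \<in> topspace ?X. x n \<in> {fst ij}} \<inter> {x \<in> topspace ?X. x (Suc n) \<in> {snd ij}})"
        by (intro closedin_Union finite_imageI) (auto intro!: closedin_Int p[simplified])
      moreover have "(\<Union>ij\<in>{(i, j). A $ i $ j = 1}. {x \<in> topspace ?X. x n \<in> {fst ij}} \<inter> {x \<in> topspace ?X. x (Suc n) \<in> {snd ij}})
          = {x \<in> topspace ?X. A $ x n $ x (Suc n) \<in> {1}}"
        by auto
      ultimately show ?thesis by simp
    qed
    then have "closedin ?X (\<Inter>n. {x \<in> topspace ?X. A $ x n $ x (Suc n) \<in> {1}})"
      by (intro closedin_Inter) auto
    moreover have "(\<Inter>n. {x \<in> topspace ?X. A $ x n $ x (Suc n) \<in> {1}}) = shift_space A"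
      by (auto simp: shift_space_def)
    ultimately show ?thesis by simp
  qed
  ultimately have "compactin ?X (shift_space A)" by (rule closedin_compact_space)
  then show ?thesis by (simp add: shift_top_def compact_space_subtopology)
qed

lemma openin_shift_top_cylinder:
  fixes A :: "nat^'n^'n"
  assumes "openin (shift_top A) U" "y \<in> U"
  shows "\<exists>N. \<forall>z\<in>shift_space A. (\<forall>n<N. z n = y n) \<longrightarrow> z \<in> U"
proof -
  let ?X = "product_topology (\<lambda>_::nat. discrete_topology (UNIV :: 'n set)) UNIV"
  obtain V where V: "openin ?X V" "U = V \<inter> shift_space A"
    using assms(1) by (auto simp: shift_top_def openin_subtopology)
  then obtain F where F: "finite {i. F i \<noteq> UNIV}" "y \<in> Pi\<^sub>E UNIV F" "Pi\<^sub>E UNIV F \<subseteq> V"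
    using assms(2) unfolding openin_product_topology_alt by auto
  obtain N where N: "\<forall>i\<in>{i. F i \<noteq> UNIV}. i < N" using F(1) finite_nat_set_iff_bounded by blast
  have "z \<in> U" if z: "z \<in> shift_space A" "\<forall>n<N. z n = y n" for z
  proof -
    have "z i \<in> F i" for i
      using N F(2) z(2) by (cases "F i = UNIV") (auto simp: PiE_def Pi_def)
    then show ?thesis using F(3) V z by auto
  qed
  then show ?thesis by blast
qed

text \<open>Each point has a cylinder on which \<open>f\<close> is constant, and by compactness
  finitely many of these cover the space.\<close>

lemma continuous_map_determined:
  fixes A :: "nat^'n^'n"
  assumes "continuous_map (shift_top A) (discrete_topology UNIV) f"
  shows "\<exists>N. determined A N f"
proof -
  have "\<exists>N. \<forall>z\<in>shift_space A. (\<forall>n<N. z n = y n) \<longrightarrow> f z = f y" if "y \<in> shift_space A" for y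
  proof -
    have "openin (shift_top A) {z \<in> topspace (shift_top A). f z \<in> {f y}}"
      using assms by (rule openin_continuous_map_preimage) auto
    from openin_shift_top_cylinder[OF this, of y] that show ?thesis by auto
  qed
  then obtain N where N: "\<And>y z. y \<in> shift_space A \<Longrightarrow> z \<in> shift_space A \<Longrightarrow> (\<forall>n<N y. z n = y n) \<Longrightarrow> f z = f y" by metis
  define C where "C = (\<lambda>y. {z \<in> shift_space A. \<forall>n<N y. z n = y n})"
  have "openin (shift_top A) (C y)" for y
  proof -
    let ?X = "product_topology (\<lambda>_::nat. discrete_topology (UNIV :: 'n set)) UNIV"
    have "openin ?X (Pi\<^sub>E UNIV (\<lambda>n. if n < N y then {y n} else UNIV))"
      by (rule product_topology_basis) (auto intro: finite_subset[of _ "{..<N y}"] split: if_splits)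
    moreover have "C y = Pi\<^sub>E UNIV (\<lambda>n. if n < N y then {y n} else UNIV) \<inter> shift_space A"
      by (auto simp: C_def PiE_def Pi_def split: if_splits)
    ultimately show ?thesis by (auto simp: shift_top_def openin_subtopology)
  qed
  then have op: "\<forall>U\<in>C ` shift_space A. openin (shift_top A) U" by blast
  have cov: "shift_space A \<subseteq> \<Union>(C ` shift_space A)" by (auto simp: C_def)
  have "compactin (shift_top A) (shift_space A)" using compact_space_shift_top[of A] by (simp add: compact_space_def)
  then obtain \<F> where F: "finite \<F>" "\<F> \<subseteq> C ` shift_space A" "shift_space A \<subseteq> \<Union>\<F>"
    unfolding compactin_def using op cov by metis
  then obtain Y where Y: "finite Y" "Y \<subseteq> shift_space A" "\<F> = C ` Y" by (meson finite_subset_image)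
  define M where "M = Max (insert 0 (N ` Y))"
  have "f y = f z" if yz: "y \<in> shift_space A" "z \<in> shift_space A" "\<forall>n<M. y n = z n" for y z
  proof -
    obtain x where x: "x \<in> Y" "y \<in> C x" using F(3) Y(3) yz(1) by auto
    have "N x \<le> M" unfolding M_def using x Y(1) by (intro Max_ge) auto
    then have "z \<in> C x" using x yz by (auto simp: C_def)
    then show ?thesis using N[of x y] N[of x z] x Y(2) by (auto simp: C_def)
  qed
  then show ?thesis unfolding determined_def by blast
qed

lemma determined_finite_image:
  fixes A :: "nat^'n^'n"
  assumes "determined A N f"
  shows "finite (f ` shift_space A)"
proof -
  have "finite {w::'n list. set w \<subseteq> UNIV \<and> length w = N}" by (intro finite_lists_length_eq) auto
  then have "finite ((\<lambda>y. map y [0..<N]) ` shift_space A)" by (rule rev_finite_subset) auto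
  moreover have "f ` shift_space A \<subseteq> (\<lambda>w. f (SOME y. y \<in> shift_space A \<and> map y [0..<N] = w)) ` (\<lambda>y. map y [0..<N]) ` shift_space A"
  proof
    fix v assume "v \<in> f ` shift_space A"
    then obtain y where y: "y \<in> shift_space A" "v = f y" by blast
    have "(SOME z. z \<in> shift_space A \<and> map z [0..<N] = map y [0..<N]) \<in> shift_space A \<and>
        map (SOME z. z \<in> shift_space A \<and> map z [0..<N] = map y [0..<N]) [0..<N] = map y [0..<N]"
      by (rule someI[of _ y]) (use y in auto)
    then have "v = f (SOME z. z \<in> shift_space A \<and> map z [0..<N] = map y [0..<N])"
      using determinedD[OF assms y(1)] y(2) by metis
    then show "v \<in> (\<lambda>w. f (SOME y. y \<in> shift_space A \<and> map y [0..<N] = w)) ` (\<lambda>y. map y [0..<N]) ` shift_space A"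
      using y by blast
  qed
  ultimately show ?thesis by (meson finite_imageI finite_subset)
qed

section \<open>Orbit equivalence\<close>

text \<open>One direction of the equivalence, with continuity already converted into finite
  determination. Data on \<open>A\<close> are composed with \<open>g\<close> because the words to be
  built are prefixes of points of \<open>B\<close>.\<close>

locale orbit_map =
  fixes A :: "nat^'n^'n" and B :: "nat^'m^'m"
    and h :: "(nat \<Rightarrow> 'n) \<Rightarrow> nat \<Rightarrow> 'm" and g :: "(nat \<Rightarrow> 'm) \<Rightarrow> nat \<Rightarrow> 'n"
    and k l :: "(nat \<Rightarrow> 'n) \<Rightarrow> nat" and b :: "(nat \<Rightarrow> 'n) \<Rightarrow> int"
  assumes markov_A: "markov_matrix A" and markov_B: "markov_matrix B"
    and h_in: "\<And>x. x \<in> shift_space A \<Longrightarrow> h x \<in> shift_space B"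
    and g_in: "\<And>y. y \<in> shift_space B \<Longrightarrow> g y \<in> shift_space A"
    and gh: "\<And>x. x \<in> shift_space A \<Longrightarrow> g (h x) = x"
    and hg: "\<And>y. y \<in> shift_space B \<Longrightarrow> h (g y) = y"
    and det_g: "\<exists>N. determined B N (\<lambda>y. g y 0)"
    and det_k: "\<exists>N. determined B N (\<lambda>y. k (g y))"
    and det_l: "\<exists>N. determined B N (\<lambda>y. l (g y))"
    and det_h: "\<And>n. \<exists>N. determined B N (\<lambda>y. h (shift (g y)) n)"
    and orbit: "\<And>x. x \<in> shift_space A \<Longrightarrow> (shift ^^ k x) (h (shift x)) = (shift ^^ l x) (h x)"
    and cocycle: "\<And>x. x \<in> shift_space A \<Longrightarrow> int (l x) - int (k x) = 1 + b x - b (shift x)"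
begin

text \<open>The cocycle equation telescopes: whatever exponents relate the two points, these have a
  difference given by \<open>p\<close> and the values of \<open>b\<close> at both ends.\<close>

lemma iterated_orbit:
  assumes "x \<in> shift_space A"
  shows "\<exists>r s. (shift ^^ r) (h x) = (shift ^^ s) (h ((shift ^^ p) x)) \<and> int r - int s = int p + b x - b ((shift ^^ p) x)"
proof (induction p)
  case 0
  show ?case by (rule exI[of _ 0], rule exI[of _ 0]) simp
next
  case (Suc p)
  then obtain r s where rs: "(shift ^^ r) (h x) = (shift ^^ s) (h ((shift ^^ p) x))"
    "int r - int s = int p + b x - b ((shift ^^ p) x)" by blast
  define x' where "x' = (shift ^^ p) x"
  have x': "x' \<in> shift_space A" using assms by (simp add: x'_def shift_in_shift_space)
  have comm: "(shift ^^ (i + j)) z = (shift ^^ i) ((shift ^^ j) z)" for i j and z :: "nat \<Rightarrow> 'm"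
    by (simp add: funpow_add)
  have "(shift ^^ (l x' + r)) (h x) = (shift ^^ (s + l x')) (h x')"
    unfolding comm[of "l x'" r] rs(1) by (simp add: x'_def add.commute flip: comm)
  also have "\<dots> = (shift ^^ (s + k x')) (h (shift x'))" by (simp add: comm orbit[OF x'])
  finally have "(shift ^^ (l x' + r)) (h x) = (shift ^^ (s + k x')) (h ((shift ^^ Suc p) x))" by (simp add: x'_def)
  moreover have "int (l x' + r) - int (s + k x') = int (Suc p) + b x - b ((shift ^^ Suc p) x)"
    using rs(2) cocycle[OF x'] by (simp add: x'_def)
  ultimately show ?case by blast
qed

text \<open>In the coordinates of \<open>B\<close> the shift of \<open>A\<close> becomes a replacement of prefixes.\<close>

lemma prefix_table:
  "\<exists>N v. determined B N (\<lambda>y. g y 0) \<and> (\<forall>y\<in>shift_space B.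
     h (shift (g y)) = cat (v (map y [0..<N])) ((shift ^^ N) y) \<and>
     int (l (g y)) - int (k (g y)) = int N - int (length (v (map y [0..<N]))))"
proof -
  obtain Ng Nk Nl where N: "determined B Ng (\<lambda>y. g y 0)" "determined B Nk (\<lambda>y. k (g y))" "determined B Nl (\<lambda>y. l (g y))"
    using det_g det_k det_l by blast
  obtain Nh where Nh: "\<And>n. determined B (Nh n) (\<lambda>y. h (shift (g y)) n)" using det_h by metis
  obtain Km where Km: "\<And>y. y \<in> shift_space B \<Longrightarrow> k (g y) \<le> Km"
    using finite_nat_set_iff_bounded_le[THEN iffD1, OF determined_finite_image[OF N(2)]] by auto
  obtain Lm where Lm: "\<And>y. y \<in> shift_space B \<Longrightarrow> l (g y) \<le> Lm"
    using finite_nat_set_iff_bounded_le[THEN iffD1, OF determined_finite_image[OF N(3)]] by auto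
  \<comment> \<open>Large enough to determine \<open>g y 0\<close>, \<open>k\<close>,
    \<open>l\<close> and the first \<open>Km\<close> symbols of the image, and to contain the
    \<open>l (g y)\<close> symbols that are dropped.\<close>
  define M where "M = Ng + Nk + Nl + Lm + (\<Sum>n<Km. Nh n)"
  have M: "determined B M (\<lambda>y. g y 0)" "determined B M (\<lambda>y. k (g y))" "determined B M (\<lambda>y. l (g y))" "Lm \<le> M"
    by (rule determined_mono[OF N(1)], simp add: M_def, rule determined_mono[OF N(2)], simp add: M_def,
        rule determined_mono[OF N(3)], simp add: M_def, simp add: M_def)
  have Mh: "determined B M (\<lambda>y. h (shift (g y)) n)" if "n < Km" for n
  proof (rule determined_mono[OF Nh])
    have "Nh n \<le> (\<Sum>n<Km. Nh n)" using that by (intro member_le_sum) auto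
    then show "Nh n \<le> M" by (simp add: M_def)
  qed
  \<comment> \<open>The orbit relation dictates this word: the first \<open>k\<close> symbols of
    \<open>h (shift (g y))\<close>, followed by what remains of the prefix after \<open>l\<close>
    symbols. Any representative \<open>y\<close> of the prefix gives the same word.\<close>
  define v where "v = (\<lambda>w. let y = SOME y. y \<in> shift_space B \<and> map y [0..<M] = w in
      map (h (shift (g y))) [0..<k (g y)] @ drop (l (g y)) w)"
  have "h (shift (g y)) = cat (v (map y [0..<M])) ((shift ^^ M) y) \<and>
     int (l (g y)) - int (k (g y)) = int M - int (length (v (map y [0..<M])))" if y: "y \<in> shift_space B" for y
  proof -
    define z where "z = (SOME z. z \<in> shift_space B \<and> map z [0..<M] = map y [0..<M])"
    have z: "z \<in> shift_space B" "map z [0..<M] = map y [0..<M]"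
      using someI[of "\<lambda>z. z \<in> shift_space B \<and> map z [0..<M] = map y [0..<M]" y] y unfolding z_def by blast+
    have kl: "k (g z) = k (g y)" "l (g z) = l (g y)"
      using determinedD[OF M(2) z(1) y z(2)] determinedD[OF M(3) z(1) y z(2)] by blast+
    have "map (h (shift (g z))) [0..<k (g y)] = map (h (shift (g y))) [0..<k (g y)]"
      using determinedD[OF Mh z(1) y z(2)] Km[OF y] by (intro map_cong) auto
    then have v: "v (map y [0..<M]) = map (h (shift (g y))) [0..<k (g y)] @ drop (l (g y)) (map y [0..<M])"
      by (simp add: v_def Let_def kl del: map_eq_conv flip: z_def)
    have l: "l (g y) \<le> M" using Lm[OF y] M(4) by linarith
    have "cat (drop (l (g y)) (map y [0..<M])) ((shift ^^ M) y) = (shift ^^ l (g y)) y"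
      using l by (intro ext) (simp add: cat_def shift_power add.commute)
    also have "\<dots> = (shift ^^ k (g y)) (h (shift (g y)))"
      using orbit[OF g_in[OF y]] by (simp add: hg y)
    finally have "cat (v (map y [0..<M])) ((shift ^^ M) y) = h (shift (g y))"
      unfolding v cat_append by (simp only: cat_map_shift_power)
    then show ?thesis using l by (simp add: v)
  qed
  then show ?thesis using M(1) by blast
qed

text \<open>Substitution along the skewed map \<open>(x, n) \<mapsto> (h x, n + b x)\<close>; the
  skewing absorbs the coboundary.\<close>

definition pull :: "((nat \<Rightarrow> 'm) \<Rightarrow> int \<Rightarrow> complex) \<Rightarrow> (nat \<Rightarrow> 'n) \<Rightarrow> int \<Rightarrow> complex" where
  "pull \<xi> x n = \<xi> (h x) (n + b x)"

text \<open>Conjugation of \<open>L\<close> by \<open>pull\<close>, whose inverse substitutes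
  \<open>(g y, n - b (g y))\<close> for \<open>(y, n)\<close>.\<close>

definition transport :: "'n operator \<Rightarrow> 'm operator" where
  "transport L \<xi> = (\<lambda>y n. if y \<in> shift_space B then L (pull \<xi>) (g y) (n - b (g y)) else 0)"

text \<open>Outside \<open>shift_space A\<close> the intermediate function takes uncontrolled
  values; the hypothesis says that \<open>L\<close> ignores them.\<close>

lemma transport_comp:
  assumes "\<And>\<zeta>. L (op_id A \<zeta>) = L \<zeta>"
  shows "transport (\<lambda>\<xi>. L (L' \<xi>)) \<xi> = transport L (transport L' \<xi>)"
proof -
  have "op_id A (pull (transport L' \<xi>)) = op_id A (L' (pull \<xi>))"
    by (intro ext) (simp add: op_id_def transport_def pull_def h_in gh)
  then have e: "L (pull (transport L' \<xi>)) = L (L' (pull \<xi>))" by (metis assms)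
  show ?thesis by (simp only: transport_def[of L] transport_def[of "\<lambda>\<xi>. L (L' \<xi>)"] e)
qed

lemma transport_op_id: "transport (op_id A) = op_id B"
  by (intro ext) (simp add: transport_def op_id_def pull_def hg g_in)

text \<open>These are the operators of the sum of \<open>W w * star (W (v w))\<close>, taken over
  the prefixes \<open>w\<close> of points with \<open>g y 0 = i\<close>, and of its adjoint. The
  degrees \<open>N - length (v w)\<close> equal \<open>l - k\<close>, and the cocycle equation
  matches them with the degree 1 of the generator, skewed by \<open>b\<close>.\<close>

lemma generator_implementation:
  "\<exists>I v. finite I \<and> (\<forall>\<xi> y n. (\<Sum>w\<in>I. op_word B w (op_word_star B (v w) \<xi>) y n) = transport (op_gen A i) \<xi> y n) \<and>
     (\<forall>\<xi> y n. (\<Sum>w\<in>I. op_word B (v w) (op_word_star B w \<xi>) y n) = transport (op_star A i) \<xi> y n)"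
proof -
  obtain N v where N: "determined B N (\<lambda>y. g y 0)" and v: "\<And>y. y \<in> shift_space B \<Longrightarrow>
     h (shift (g y)) = cat (v (map y [0..<N])) ((shift ^^ N) y) \<and>
     int (l (g y)) - int (k (g y)) = int N - int (length (v (map y [0..<N])))"
    using prefix_table by blast
  define I where "I = {w. \<exists>y\<in>shift_space B. map y [0..<N] = w \<and> g y 0 = i}"
  define \<phi> where "\<phi> = (\<lambda>y. h (shift (g y)))"
  define \<psi> where "\<psi> = (\<lambda>y. h (cat [i] (g y)))"
  define d where "d = (\<lambda>y. int (l (g y)) - int (k (g y)))"
  have d: "d y = 1 + b (g y) - b (shift (g y))" if "y \<in> shift_space B" for y
    using cocycle[OF g_in[OF that]] by (simp add: d_def)
  have "finite {w::'m list. set w \<subseteq> UNIV \<and> length w = N}" by (intro finite_lists_length_eq) auto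
  then have fin: "finite I" by (rule rev_finite_subset) (auto simp: I_def)
  have V: "g y 0 = i \<longleftrightarrow> map y [0..<N] \<in> I" if "y \<in> shift_space B" for y
  proof
    assume "map y [0..<N] \<in> I"
    then obtain z where "z \<in> shift_space B" "map z [0..<N] = map y [0..<N]" "g z 0 = i" by (auto simp: I_def)
    then show "g y 0 = i" using determinedD[OF N, of z y] that by simp
  qed (use that in \<open>auto simp: I_def\<close>)
  have I: "length w = N" if "w \<in> I" for w using that by (auto simp: I_def)
  have \<phi>: "\<phi> y \<in> shift_space B \<and> \<phi> y = cat (v (map y [0..<N])) ((shift ^^ N) y) \<and> d y = int N - int (length (v (map y [0..<N])))"
    if "y \<in> shift_space B" "g y 0 = i" for y
    using v[OF that(1)] h_in[OF shift_in_shift_space1[OF g_in[OF that(1)]]] unfolding \<phi>_def d_def by metis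
  have \<psi>: "\<psi> (\<phi> y) = y" if "y \<in> shift_space B" "g y 0 = i" for y
    using cat_shift_Cons[of "g y"] that by (simp add: \<phi>_def \<psi>_def gh shift_in_shift_space1 g_in hg)
  have R: "(\<exists>z\<in>shift_space B. g z 0 = i \<and> \<phi> z = y) \<longleftrightarrow> y \<in> shift_space B \<and> cat [i] (g y) \<in> shift_space A" for y
  proof
    assume "\<exists>z\<in>shift_space B. g z 0 = i \<and> \<phi> z = y"
    then obtain z where z: "z \<in> shift_space B" "g z 0 = i" "\<phi> z = y" by blast
    have "g y = shift (g z)" using z by (auto simp: \<phi>_def gh shift_in_shift_space1 g_in)
    then show "y \<in> shift_space B \<and> cat [i] (g y) \<in> shift_space A"
      using z cat_shift_Cons[of "g z"] g_in[OF z(1)] h_in[OF shift_in_shift_space1[OF g_in[OF z(1)]]] by (auto simp: \<phi>_def)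
  next
    assume y: "y \<in> shift_space B \<and> cat [i] (g y) \<in> shift_space A"
    then show "\<exists>z\<in>shift_space B. g z 0 = i \<and> \<phi> z = y"
      by (intro bexI[of _ "\<psi> y"]) (simp_all add: \<phi>_def \<psi>_def gh h_in hg)
  qed
  have "(\<Sum>w\<in>I. op_word B w (op_word_star B (v w) \<xi>) y n) = transport (op_gen A i) \<xi> y n" for \<xi> y n
  proof -
    have "(\<Sum>w\<in>I. op_word B w (op_word_star B (v w) \<xi>) y n) = (if y \<in> shift_space B \<and> g y 0 = i then \<xi> (\<phi> y) (n - d y) else 0)"
      by (rule sum_op_prefix_map(1)[where V = "\<lambda>y. g y 0 = i" and \<phi> = \<phi> and d = d and v = v, OF V I \<phi>])
    also have "\<dots> = transport (op_gen A i) \<xi> y n"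
      by (auto simp: transport_def op_gen_def pull_def g_in d \<phi>_def algebra_simps)
    finally show ?thesis .
  qed
  moreover have "(\<Sum>w\<in>I. op_word B (v w) (op_word_star B w \<xi>) y n) = transport (op_star A i) \<xi> y n" for \<xi> y n
  proof -
    have "(\<Sum>w\<in>I. op_word B (v w) (op_word_star B w \<xi>) y n) =
        (if \<exists>z\<in>shift_space B. g z 0 = i \<and> \<phi> z = y then \<xi> (\<psi> y) (n + d (\<psi> y)) else 0)"
      by (rule sum_op_prefix_map(2)[where V = "\<lambda>y. g y 0 = i" and \<phi> = \<phi> and d = d and v = v, OF V I \<phi> \<psi>])
    also have "\<dots> = transport (op_star A i) \<xi> y n"
      unfolding R by (auto simp: transport_def op_star_def pull_def d \<psi>_def h_in gh algebra_simps)
    finally show ?thesis .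
  qed
  ultimately show ?thesis using fin by blast
qed

end

lemma op_gen_star: "op_gen A i (op_star A i \<xi>) x n = (if x \<in> shift_space A \<and> x 0 = i then \<xi> x n else 0)"
  using cat_shift_Cons[of x] by (auto simp: op_gen_def op_star_def)

lemma op_star_gen: "op_star A i (op_gen A i \<xi>) x n = (if cat [i] x \<in> shift_space A then \<xi> x n else 0)"
  by (simp add: op_gen_def op_star_def)

lemma op_gen_op_id: "op_gen A i (op_id A \<xi>) = op_gen A i \<xi>"
  by (intro ext) (simp add: op_gen_def op_id_def shift_in_shift_space1)

lemma op_star_op_id: "op_star A i (op_id A \<xi>) = op_star A i \<xi>"
  by (intro ext) (simp add: op_star_def op_id_def)

lemma op_word_op_id: "op_word A w (op_id A \<xi>) = op_word A w \<xi>"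
  by (intro ext) (simp add: op_word_def op_id_def shift_in_shift_space)

lemma op_word_star_op_id: "op_word_star A w (op_id A \<xi>) = op_word_star A w \<xi>"
  by (intro ext) (simp add: op_word_star_def op_id_def)

locale orbit_equivalence = F: orbit_map A B h g k l b + R: orbit_map B A g h k' l' b'
  for A :: "nat^'n^'n" and B :: "nat^'m^'m" and h g k l b k' l' b' +
  assumes det_b: "\<exists>N. determined B N (\<lambda>y. b (g y))" and det_b': "\<exists>N. determined B N b'"
begin

text \<open>At a point that is not eventually periodic the degrees of all orbit relations are determined by
  the points alone; hence the two coboundaries cancel there, and everywhere by density.\<close>

lemma coboundaries_cancel:
  assumes "y \<in> shift_space B"
  shows "b (g (shift y)) + b' (shift y) = b (g y) + b' y"
proof -
  have np: "b (g (shift z)) + b' (shift z) = b (g z) + b' z"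
    if z: "z \<in> shift_space B" "\<not> eventually_periodic z" for z
  proof -
    have sz: "shift z \<in> shift_space B" using z by (simp add: shift_in_shift_space1)
    have w: "(shift ^^ k' z) (g (shift z)) = (shift ^^ l' z) (g z)" by (rule R.orbit[OF z(1)])
    \<comment> \<open>The point \<open>(shift ^^ l' z) (g z)\<close> lies on the orbits of both
      \<open>g z\<close> and \<open>g (shift z)\<close>; its image under \<open>h\<close> therefore
      relates \<open>z\<close> to \<open>shift z\<close>.\<close>
    obtain r1 s1 where 1: "(shift ^^ r1) z = (shift ^^ s1) (h ((shift ^^ l' z) (g z)))"
      "int r1 - int s1 = int (l' z) + b (g z) - b ((shift ^^ l' z) (g z))"
      using F.iterated_orbit[OF F.g_in[OF z(1)], of "l' z"] by (auto simp: F.hg z)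
    obtain r2 s2 where 2: "(shift ^^ r2) (shift z) = (shift ^^ s2) (h ((shift ^^ l' z) (g z)))"
      "int r2 - int s2 = int (k' z) + b (g (shift z)) - b ((shift ^^ l' z) (g z))"
      using F.iterated_orbit[OF F.g_in[OF sz], of "k' z"] by (auto simp: F.hg sz w)
    have "(shift ^^ (r1 + s2)) z = (shift ^^ s2) ((shift ^^ r1) z)" by (simp add: shift_power add_ac)
    also have "\<dots> = (shift ^^ s1) ((shift ^^ s2) (h ((shift ^^ l' z) (g z))))"
      unfolding 1(1) by (simp add: shift_power add_ac)
    also have "\<dots> = (shift ^^ (s1 + r2 + 1)) z"
      unfolding 2(1)[symmetric] by (simp add: shift_power shift_def add_ac)
    \<comment> \<open>Equal iterates of an aperiodic point have equal exponents; the 1 comes from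
      starting the second relation at \<open>shift z\<close>.\<close>
    finally have "r1 + s2 = s1 + r2 + 1" using z(2) eventually_periodicI by blast
    then show ?thesis using 1(2) 2(2) R.cocycle[OF z(1)] by linarith
  qed
  obtain N1 N2 where "determined B N1 (\<lambda>y. b (g y))" "determined B N2 b'" using det_b det_b' by blast
  then have N: "determined B (N1 + N2) (\<lambda>y. b (g y))" "determined B (N1 + N2) b'" by (auto elim: determined_mono)
  \<comment> \<open>One further common symbol makes \<open>shift z\<close> and
    \<open>shift y\<close> agree far enough as well.\<close>
  obtain z where z: "z \<in> shift_space B" "\<And>n. n < Suc (N1 + N2) \<Longrightarrow> z n = y n" "\<not> eventually_periodic z"
    using exists_not_eventually_periodic[OF F.markov_B assms, of "Suc (N1 + N2)"] by blast
  have m: "map z [0..<N1 + N2] = map y [0..<N1 + N2]" "map (shift z) [0..<N1 + N2] = map (shift y) [0..<N1 + N2]"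
    using z(2) by (auto simp: shift_def)
  note s = shift_in_shift_space1[OF z(1)] shift_in_shift_space1[OF assms]
  show ?thesis
    using np[OF z(1,3)] determinedD[OF N(1) z(1) assms m(1)] determinedD[OF N(2) z(1) assms m(1)]
      determinedD[OF N(1) s m(2)] determinedD[OF N(2) s m(2)] by simp
qed

text \<open>The passage to \<open>A\<close> and back shifts degrees by
  \<open>b \<circ> g + b'\<close>. A generator only compares this quantity at \<open>y\<close> and
  \<open>shift y\<close>, where its values coincide, so it is recovered.\<close>

lemma transport_transport_gen:
  assumes "y \<in> shift_space B"
  shows "R.transport (op_gen B j) (F.pull \<xi>) (g y) (n - b (g y)) = op_gen B j \<xi> y n"
  using coboundaries_cancel[OF assms] assms
  by (simp add: R.transport_def R.pull_def F.pull_def op_gen_def F.g_in F.hg shift_in_shift_space1 algebra_simps)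

end

text \<open>The images in the algebra of \<open>B\<close> of the generators of \<open>A\<close>,
  known through their operators. The adjoints are listed separately because formal operators carry
  no involution.\<close>

locale transported_family = orbit_equivalence A B h g k l b k' l' b' + T: ck_family B T
  for A :: "nat^'n^'n" and B :: "nat^'m^'m" and h g k l b k' l' b'
    and T :: "'m \<Rightarrow> 'b::unital_cstar_algebra" +
  fixes U :: "'n \<Rightarrow> 'b"
  assumes realizes_U: "T.realizes (U i) (F.transport (op_gen A i))"
    and realizes_star_U: "T.realizes (star (U i)) (F.transport (op_star A i))"
begin

definition WU :: "'n list \<Rightarrow> 'b" where
  "WU w = prod_list (map U w)"

lemma realizes_WU: "T.realizes (WU w) (F.transport (op_word A w))"
proof (induction w)
  case (Cons j w)
  have "F.transport (op_word A (j # w)) = (\<lambda>\<xi>. F.transport (op_gen A j) (F.transport (op_word A w) \<xi>))"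
    by (rule ext) (simp add: op_gen_op_id flip: F.transport_comp, simp flip: op_word_Cons)
  then show ?case using T.realizes_mult[OF realizes_U Cons] by (simp add: WU_def)
qed (simp add: WU_def op_word_Nil F.transport_op_id T.realizes_one)

lemma realizes_star_WU: "T.realizes (star (WU w)) (F.transport (op_word_star A w))"
proof (induction w)
  case (Cons j w)
  have "F.transport (op_word_star A (j # w)) = (\<lambda>\<xi>. F.transport (op_word_star A w) (F.transport (op_star A j) \<xi>))"
    by (rule ext) (simp add: op_word_star_op_id flip: F.transport_comp, simp flip: op_word_star_Cons)
  then show ?case using T.realizes_mult[OF Cons realizes_star_U] by (simp add: WU_def star_mult)
qed (simp add: WU_def op_word_star_Nil F.transport_op_id T.realizes_one)

lemma realizes_U_star_U: "T.realizes (U i * star (U i)) (F.transport (\<lambda>\<xi> x n. if x \<in> shift_space A \<and> x 0 = i then \<xi> x n else 0))"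
proof -
  have "(\<lambda>\<xi>. F.transport (op_gen A i) (F.transport (op_star A i) \<xi>))
      = F.transport (\<lambda>\<xi> x n. if x \<in> shift_space A \<and> x 0 = i then \<xi> x n else 0)"
    by (rule ext) (simp add: op_gen_op_id flip: F.transport_comp, simp add: op_gen_star[abs_def] cong: if_cong)
  then show ?thesis using T.realizes_mult[OF realizes_U realizes_star_U] by metis
qed

lemma realizes_star_U_U: "T.realizes (star (U i) * U i) (F.transport (\<lambda>\<xi> x n. if cat [i] x \<in> shift_space A then \<xi> x n else 0))"
proof -
  have "(\<lambda>\<xi>. F.transport (op_star A i) (F.transport (op_gen A i) \<xi>))
      = F.transport (\<lambda>\<xi> x n. if cat [i] x \<in> shift_space A then \<xi> x n else 0)"
    by (rule ext) (simp add: op_star_op_id flip: F.transport_comp, simp add: op_star_gen[abs_def] cong: if_cong)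
  then show ?thesis using T.realizes_mult[OF realizes_star_U realizes_U] by metis
qed

lemma U_star_U_U: "U i * star (U i) * U i = U i"
proof (rule T.realizes_unique[OF T.realizes_mult[OF realizes_U_star_U realizes_U]])
  have "(\<lambda>\<xi>. F.transport (\<lambda>\<xi> x n. if x \<in> shift_space A \<and> x 0 = i then \<xi> x n else 0) (F.transport (op_gen A i) \<xi>))
      = F.transport (op_gen A i)"
    by (intro ext) (auto simp: F.transport_def F.pull_def op_gen_def F.h_in F.gh F.g_in)
  then show "T.realizes (U i) (\<lambda>\<xi>. F.transport (\<lambda>\<xi> x n. if x \<in> shift_space A \<and> x 0 = i then \<xi> x n else 0)
      (F.transport (op_gen A i) \<xi>))"
    using realizes_U by simp
qed

lemma sum_U: "(\<Sum>i\<in>UNIV. U i * star (U i)) = 1"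
proof (rule T.realizes_unique[OF T.realizes_sum[OF realizes_U_star_U]])
  have "(\<lambda>\<xi> y n. \<Sum>i\<in>UNIV. F.transport (\<lambda>\<xi> x n. if x \<in> shift_space A \<and> x 0 = i then \<xi> x n else 0) \<xi> y n) = op_id B"
    by (intro ext) (simp add: F.transport_def op_id_def F.g_in F.pull_def F.hg)
  then show "T.realizes 1 (\<lambda>\<xi> y n. \<Sum>i\<in>UNIV. F.transport (\<lambda>\<xi> x n. if x \<in> shift_space A \<and> x 0 = i then \<xi> x n else 0) \<xi> y n)"
    using T.realizes_one by simp
qed

lemma U_relation: "star (U i) * U i = (\<Sum>j | A $ i $ j = 1. U j * star (U j))"
proof (rule T.realizes_unique[OF realizes_star_U_U])
  have "(\<lambda>\<xi> y n. \<Sum>j | A $ i $ j = 1. F.transport (\<lambda>\<xi> x n. if x \<in> shift_space A \<and> x 0 = j then \<xi> x n else 0) \<xi> y n)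
      = F.transport (\<lambda>\<xi> x n. if cat [i] x \<in> shift_space A then \<xi> x n else 0)"
    by (intro ext) (auto simp: F.transport_def F.g_in cat_in_shift_space)
  then show "T.realizes (\<Sum>j | A $ i $ j = 1. U j * star (U j)) (F.transport (\<lambda>\<xi> x n. if cat [i] x \<in> shift_space A then \<xi> x n else 0))"
    using T.realizes_sum[where J = "{j. A $ i $ j = 1}" and f = "\<lambda>j. U j * star (U j)", OF realizes_U_star_U] by simp
qed

lemma U_orthogonal:
  assumes "i \<noteq> j"
  shows "U i * star (U i) * (U j * star (U j)) = 0"
proof (rule T.realizes_unique[OF T.realizes_mult[OF realizes_U_star_U realizes_U_star_U]])
  have "(\<lambda>\<xi>. F.transport (\<lambda>\<xi> x n. if x \<in> shift_space A \<and> x 0 = i then \<xi> x n else 0)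
      (F.transport (\<lambda>\<xi> x n. if x \<in> shift_space A \<and> x 0 = j then \<xi> x n else 0) \<xi>)) = (\<lambda>\<xi> y n. 0)"
    using assms by (intro ext) (auto simp: F.transport_def F.pull_def F.h_in F.gh)
  then show "T.realizes 0 (\<lambda>\<xi>. F.transport (\<lambda>\<xi> x n. if x \<in> shift_space A \<and> x 0 = i then \<xi> x n else 0)
      (F.transport (\<lambda>\<xi> x n. if x \<in> shift_space A \<and> x 0 = j then \<xi> x n else 0) \<xi>))"
    using T.realizes_sum[of "{}"] by simp
qed

text \<open>If \<open>U i\<close> vanished, the relation for \<open>i\<close> would annihilate the
  \<open>U j\<close> of all successors, and irreducibility would spread this to every symbol,
  contrary to the sum being 1.\<close>

lemma U_nonzero: "U i \<noteq> 0"
proof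
  assume i: "U i = 0"
  have succ: "U j = 0" if "U i = 0" "A $ i $ j = 1" for i j
  proof -
    have "0 = U j * star (U j) * (\<Sum>k | A $ i $ k = 1. U k * star (U k))"
      using U_relation[of i] that(1) by simp
    also have "\<dots> = (\<Sum>k | A $ i $ k = 1. if k = j then U j * star (U j) else 0)"
      unfolding sum_distrib_left
    proof (rule sum.cong[OF refl])
      fix k
      have "U j * star (U j) * (U j * star (U j)) = U j * star (U j)"
        by (simp add: U_star_U_U flip: mult.assoc)
      then show "U j * star (U j) * (U k * star (U k)) = (if k = j then U j * star (U j) else 0)"
        using U_orthogonal[of j k] by auto
    qed
    also have "\<dots> = U j * star (U j)" using that(2) by simp
    finally show "U j = 0" using U_star_U_U[of j] by simp
  qed
  have "U j = 0" if "admissible A w j" "U (hd (w @ [j])) = 0" for w j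
    using that
  proof (induction w)
    case (Cons a w)
    then show ?case using succ[of a] by simp
  qed simp
  then have "U j = 0" for j using markov_path[OF F.markov_A, of i j] i by fastforce
  then show False using sum_U by simp
qed

lemma ck_family_U: "ck_family A U"
proof
  show "markov_matrix A" by (rule F.markov_A)
  show "U i \<noteq> 0" "U i * star (U i) * U i = U i" "(\<Sum>j\<in>UNIV. U j * star (U j)) = 1" for i
    by (rule U_nonzero U_star_U_U sum_U)+
  fix i
  have "(\<Sum>j | A $ i $ j = 1. U j * star (U j)) = (\<Sum>j\<in>UNIV. of_nat (A $ i $ j) * (U j * star (U j)))"
  proof (rule sum.mono_neutral_cong_left)
    show "\<forall>j\<in>UNIV - {j. A $ i $ j = 1}. of_nat (A $ i $ j) * (U j * star (U j)) = 0"
    proof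
      fix j assume "j \<in> UNIV - {j. A $ i $ j = 1}"
      then have "A $ i $ j = 0" using markov_matrix_01[OF F.markov_A, of i j] by simp
      then show "of_nat (A $ i $ j) * (U j * star (U j)) = 0" by simp
    qed
  qed auto
  then show "star (U i) * U i = (\<Sum>j\<in>UNIV. of_nat (A $ i $ j) * (U j * star (U j)))"
    by (simp add: U_relation)
qed

text \<open>The prefix table of the inverse direction writes the generator \<open>j\<close> of
  \<open>B\<close> through words over \<open>A\<close>. The same expression in \<open>U\<close> has
  the operator of \<open>T j\<close>, because the coboundaries cancel, and hence equals
  \<open>T j\<close>.\<close>

lemma generator_in_hull: "T j \<in> cstar_subalgebra hull (range U)"
proof -
  let ?M = "cstar_subalgebra hull (range U)"
  have M: "cstar_subalgebra ?M" by (rule hull_in) (auto simp: cstar_subalgebra_def)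
  have sum_in: "sum f J \<in> ?M" if "\<And>x. x \<in> J \<Longrightarrow> f x \<in> ?M" for f and J :: "'z set"
    using that M by (induction J rule: infinite_finite_induct) (auto simp: cstar_subalgebra_def)
  have U: "U i \<in> ?M" for i by (rule hull_inc) auto
  have "1 \<in> ?M"
    unfolding sum_U[symmetric] using U M by (intro sum_in) (auto simp: cstar_subalgebra_def)
  then have W: "WU w \<in> ?M" for w
    using U M by (induction w) (auto simp: WU_def cstar_subalgebra_def)
  obtain I v where I: "\<And>\<xi> x n. (\<Sum>w\<in>I. op_word A w (op_word_star A (v w) \<xi>) x n) = R.transport (op_gen B j) \<xi> x n"
    using R.generator_implementation[of j] by blast
  have "T j = (\<Sum>w\<in>I. WU w * star (WU (v w)))"
  proof (rule T.realizes_unique[OF T.realizes_gen])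
    have "(\<lambda>\<xi> y n. \<Sum>w\<in>I. F.transport (op_word A w) (F.transport (op_word_star A (v w)) \<xi>) y n) = op_gen B j"
    proof (intro ext)
      fix \<xi> :: "(nat \<Rightarrow> 'm) \<Rightarrow> int \<Rightarrow> complex" and y n
      have "(\<Sum>w\<in>I. F.transport (op_word A w) (F.transport (op_word_star A (v w)) \<xi>) y n)
          = (\<Sum>w\<in>I. F.transport (\<lambda>\<xi>. op_word A w (op_word_star A (v w) \<xi>)) \<xi> y n)"
        by (simp add: op_word_op_id flip: F.transport_comp)
      also have "\<dots> = (if y \<in> shift_space B then \<Sum>w\<in>I. op_word A w (op_word_star A (v w) (F.pull \<xi>)) (g y) (n - b (g y)) else 0)"
        by (simp add: F.transport_def)
      also have "\<dots> = op_gen B j \<xi> y n"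
        using transport_transport_gen[of y j \<xi> n] by (simp add: I) (simp add: op_gen_def)
      finally show "(\<Sum>w\<in>I. F.transport (op_word A w) (F.transport (op_word_star A (v w)) \<xi>) y n) = op_gen B j \<xi> y n" .
    qed
    then show "T.realizes (\<Sum>w\<in>I. WU w * star (WU (v w))) (op_gen B j)"
      using T.realizes_sum[where J = I and f = "\<lambda>w. WU w * star (WU (v w))", OF T.realizes_mult[OF realizes_WU realizes_star_WU]]
      by simp
  qed
  also have "\<dots> \<in> ?M" using W M by (intro sum_in) (auto simp: cstar_subalgebra_def)
  finally show ?thesis .
qed

end

lemma (in orbit_equivalence) exists_transported_family:
  assumes "ck_family B T"
  shows "\<exists>U. transported_family A B h g k l b k' l' b' T U"
proof -
  interpret T: ck_family B T by (rule assms)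
  have "\<exists>U. T.realizes U (F.transport (op_gen A i)) \<and> T.realizes (star U) (F.transport (op_star A i))" for i
  proof -
    obtain I v where "\<And>\<xi> y n. (\<Sum>w\<in>I. op_word B w (op_word_star B (v w) \<xi>) y n) = F.transport (op_gen A i) \<xi> y n"
      "\<And>\<xi> y n. (\<Sum>w\<in>I. op_word B (v w) (op_word_star B w \<xi>) y n) = F.transport (op_star A i) \<xi> y n"
      using F.generator_implementation[of i] by blast
    then have op: "F.transport (op_gen A i) = (\<lambda>\<xi> y n. \<Sum>w\<in>I. op_word B w (op_word_star B (v w) \<xi>) y n)"
      "F.transport (op_star A i) = (\<lambda>\<xi> y n. \<Sum>w\<in>I. op_word B (v w) (op_word_star B w \<xi>) y n)"
      by (simp_all add: fun_eq_iff)
    have st: "star (\<Sum>w\<in>I. T.W w * star (T.W (v w))) = (\<Sum>w\<in>I. T.W (v w) * star (T.W w))"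
      by (simp add: star_sum star_mult star_star)
    show ?thesis
      by (rule exI[of _ "\<Sum>w\<in>I. T.W w * star (T.W (v w))"], unfold op st)
         (intro conjI T.realizes_sum T.realizes_mult T.realizes_W T.realizes_star_W)
  qed
  then obtain U where "\<And>i. T.realizes (U i) (F.transport (op_gen A i))" "\<And>i. T.realizes (star (U i)) (F.transport (op_star A i))"
    by metis
  then have "transported_family A B h g k l b k' l' b' T U" by unfold_locales
  then show ?thesis by blast
qed

section \<open>The gauge action on operators and its comparison under the equivalence\<close>

lemma star_iso_1: "star_iso (\<phi> :: 'a::unital_cstar_algebra \<Rightarrow> 'b::unital_cstar_algebra) \<Longrightarrow> \<phi> 1 = 1"
proof -
  assume \<phi>: "star_iso \<phi>"
  then obtain x where "\<phi> x = 1" by (metis star_iso_def bij_pointE)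
  then show ?thesis using star_homD(3)[of \<phi> x 1] \<phi> by (simp add: star_iso_def)
qed

text \<open>Conjugation by the multiplication with exp(2 \<pi> i t n) implements the gauge action:
  an operator that raises the degree by 1 picks up the factor exp(2 \<pi> i t).\<close>

lemma ck_rel_gauge_action:
  assumes "markov_matrix A" "cuntz_krieger_algebra A S"
  shows "ck_rel A S S K X Y L \<Longrightarrow> ck_rel A S S K (gauge_action S t X) (gauge_action S t Y)
    (\<lambda>\<xi> y n. cis (2 * pi * t * of_int n) * L (\<lambda>y n. cis (- (2 * pi * t * of_int n)) * \<xi> y n) y n)"
proof (induction rule: ck_rel.induct)
  case (gen i)
  have c: "cis (2 * pi * t * of_int n) * (cis (- (2 * pi * t * of_int (n - 1))) * z) = cis (2 * pi * t) * z" for n z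
    unfolding mult.assoc[symmetric] cis_mult by (simp add: algebra_simps)
  have "(\<lambda>\<xi> y n. cis (2 * pi * t * of_int n) * op_gen A i (\<lambda>y n. cis (- (2 * pi * t * of_int n)) * \<xi> y n) y n)
      = (\<lambda>\<xi> y n. cis (2 * pi * t) * op_gen A i \<xi> y n)"
    using c by (intro ext) (auto simp: op_gen_def simp del: of_int_diff)
  then show ?case using ck_rel.scale[OF ck_rel.gen[of A S S i], of "cis (2 * pi * t)"]
    by (simp only: gauge_action(2)[OF assms])
next
  case (star_gen i)
  have c: "cis (2 * pi * t * of_int n) * (cis (- (2 * pi * t * of_int (n + 1))) * z) = cnj (cis (2 * pi * t)) * z" for n z
    unfolding mult.assoc[symmetric] cis_mult cis_cnj by (simp add: algebra_simps)
  have "(\<lambda>\<xi> y n. cis (2 * pi * t * of_int n) * op_star A i (\<lambda>y n. cis (- (2 * pi * t * of_int n)) * \<xi> y n) y n)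
      = (\<lambda>\<xi> y n. cnj (cis (2 * pi * t)) * op_star A i \<xi> y n)"
    using c by (intro ext) (auto simp: op_star_def simp del: of_int_add)
  moreover have "gauge_action S t (star (S i)) = cnj (cis (2 * pi * t)) *\<^sub>C star (S i)"
    using gauge_action[OF assms] by (simp add: star_iso_def star_homD star_scaleC)
  ultimately show ?case using ck_rel.scale[OF ck_rel.star_gen[of A S S i], of "cnj (cis (2 * pi * t))"]
    by (simp only:)
next
  case one
  have "(\<lambda>\<xi> y n. cis (2 * pi * t * of_int n) * op_id A (\<lambda>y n. cis (- (2 * pi * t * of_int n)) * \<xi> y n) y n) = op_id A"
    by (intro ext) (simp add: op_id_def cis_mult flip: mult.assoc)
  then show ?case using ck_rel.one by (simp add: star_iso_1[OF gauge_action(1)[OF assms]])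
next
  case (add K X Y L X' Y' L')
  from ck_rel.add[OF add.IH] show ?case
    using gauge_action(1)[OF assms, of t] by (simp add: star_iso_def star_homD distrib_left)
next
  case (scale K X Y L c)
  from ck_rel.scale[OF scale.IH, of c] show ?case
    using gauge_action(1)[OF assms, of t] by (simp add: star_iso_def star_homD mult.left_commute)
next
  case (mult K X Y L K' X' Y' L')
  have 1: "(\<lambda>y n. cis (- (2 * pi * t * of_int n)) * (cis (2 * pi * t * of_int n) * \<zeta> y n)) = \<zeta>" for \<zeta> :: "_ \<Rightarrow> int \<Rightarrow> complex"
    by (intro ext) (simp add: cis_mult flip: mult.assoc)
  have "(\<lambda>\<xi> y n. cis (2 * pi * t * of_int n) * L (\<lambda>y n. cis (- (2 * pi * t * of_int n)) *
        (cis (2 * pi * t * of_int n) * L' (\<lambda>y n. cis (- (2 * pi * t * of_int n)) * \<xi> y n) y n)) y n)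
      = (\<lambda>\<xi> y n. cis (2 * pi * t * of_int n) * L (L' (\<lambda>y n. cis (- (2 * pi * t * of_int n)) * \<xi> y n)) y n)"
  proof (rule ext)
    fix \<xi> :: "(nat \<Rightarrow> 'a) \<Rightarrow> int \<Rightarrow> complex"
    show "(\<lambda>y n. cis (2 * pi * t * of_int n) * L (\<lambda>y n. cis (- (2 * pi * t * of_int n)) *
        (cis (2 * pi * t * of_int n) * L' (\<lambda>y n. cis (- (2 * pi * t * of_int n)) * \<xi> y n) y n)) y n)
      = (\<lambda>y n. cis (2 * pi * t * of_int n) * L (L' (\<lambda>y n. cis (- (2 * pi * t * of_int n)) * \<xi> y n)) y n)"
      by (simp only: 1[of "L' (\<lambda>y n. cis (- (2 * pi * t * of_int n)) * \<xi> y n)"])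
  qed
  with ck_rel.mult[OF mult.IH] show ?case
    using gauge_action(1)[OF assms, of t] by (simp add: star_iso_def star_homD)
next
  case (weaken K X Y L K')
  then show ?case by (blast intro: ck_rel.weaken)
qed

lemma cis_int_periodic: "cis (2 * pi * (t + 1) * of_int m) = cis (2 * pi * t * of_int m)"
proof -
  have "cis (2 * pi * of_int m) = 1" using cis_multiple_2pi[of "of_int m"] by simp
  moreover have "2 * pi * (t + 1) * of_int m = 2 * pi * t * of_int m + 2 * pi * of_int m" by (simp add: algebra_simps)
  ultimately show ?thesis by (simp only: flip: cis_mult) simp
qed

context transported_family
begin

text \<open>The unitaries \<open>exp (-2 \<pi> i t (b \<circ> g))\<close> of the diagonal; the action \<open>a \<mapsto> u t (gauge_action T t a) (u t)\<^sup>*\<close>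
  multiplies each \<open>U i\<close> by \<open>exp (2 \<pi> i t)\<close>.\<close>

lemma exists_unitary_cocycle:
  assumes T: "cuntz_krieger_algebra B T"
  shows "\<exists>u. continuous_on UNIV u \<and> (\<forall>t. u (t + 1) = u t) \<and> (\<forall>s t. u (s + t) = u s * u t) \<and> u 0 = 1 \<and>
     (\<forall>t. star (u t) = u (- t)) \<and> (\<forall>s t. gauge_action T s (u t) = u t) \<and>
     (\<forall>t i. u t * gauge_action T t (U i) * u (- t) = cis (2 * pi * t) *\<^sub>C U i)"
proof -
  obtain N where N: "determined B N (\<lambda>y. b (g y))" using det_b by blast
  define I where "I = {w::'m list. length w = N}"
  have fin: "finite I" using finite_lists_length_eq[of "UNIV :: 'm set" N] by (simp add: I_def)
  \<comment> \<open>Reads \<open>b \<circ> g\<close> off a prefix of length \<open>N\<close>. For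
    words that are not prefixes the value is arbitrary, but their terms have zero operator.\<close>
  define c where "c = (\<lambda>w. b (g (SOME y. y \<in> shift_space B \<and> map y [0..<N] = w)))"
  have c: "c (map y [0..<N]) = b (g y)" if y: "y \<in> shift_space B" for y
  proof -
    have "(SOME z. z \<in> shift_space B \<and> map z [0..<N] = map y [0..<N]) \<in> shift_space B \<and>
        map (SOME z. z \<in> shift_space B \<and> map z [0..<N] = map y [0..<N]) [0..<N] = map y [0..<N]"
      by (rule someI[of _ y]) (use y in auto)
    then show ?thesis unfolding c_def using determinedD[OF N _ y] by blast
  qed
  define u where "u = (\<lambda>t. \<Sum>w\<in>I. cis (- (2 * pi * t * of_int (c w))) *\<^sub>C (T.W w * star (T.W w)))"
  define M where "M = (\<lambda>t \<xi> y (n::int). if y \<in> shift_space B then cis (- (2 * pi * t * of_int (b (g y)))) * \<xi> y n else (0::complex))"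
  have u: "T.realizes (u t) (M t)" for t
  proof -
    have "M t = (\<lambda>\<xi> y n. \<Sum>w\<in>I. cis (- (2 * pi * t * of_int (c w))) * op_word B w (op_word_star B w \<xi>) y n)"
    proof (intro ext)
      fix \<xi> :: "(nat \<Rightarrow> 'm) \<Rightarrow> int \<Rightarrow> complex" and y n
      have "(\<Sum>w\<in>I. cis (- (2 * pi * t * of_int (c w))) * op_word B w (op_word_star B w \<xi>) y n)
          = (\<Sum>w\<in>I. if w = map y [0..<N] then M t \<xi> y n else 0)"
      proof (rule sum.cong[OF refl])
        fix w assume "w \<in> I"
        then have w: "length w = N" by (simp add: I_def)
        show "cis (- (2 * pi * t * of_int (c w))) * op_word B w (op_word_star B w \<xi>) y n
            = (if w = map y [0..<N] then M t \<xi> y n else 0)"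
          unfolding op_word_word_star M_def w using c[of y] by (auto simp: cat_map_shift_power)
      qed
      also have "\<dots> = M t \<xi> y n" using fin by (simp add: I_def)
      finally show "M t \<xi> y n = (\<Sum>w\<in>I. cis (- (2 * pi * t * of_int (c w))) * op_word B w (op_word_star B w \<xi>) y n)" by simp
    qed
    then show ?thesis unfolding u_def
      by (simp only:) (intro T.realizes_sum T.realizes_scale T.realizes_mult T.realizes_W T.realizes_star_W)
  qed
  have gauge: "T.realizes (gauge_action T t X)
      (\<lambda>\<xi> y n. cis (2 * pi * t * of_int n) * L (\<lambda>y n. cis (- (2 * pi * t * of_int n)) * \<xi> y n) y n)"
    if "T.realizes X L" for t X L
    using that ck_rel_gauge_action[OF F.markov_B T] unfolding T.realizes_def by blast
  have "continuous_on UNIV u"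
    unfolding u_def by (intro continuous_intros continuous_on_scaleC)
  moreover have "u (t + 1) = u t" for t
    unfolding u_def by (intro sum.cong refl) (simp only: cis_int_periodic flip: cis_cnj)
  moreover have add: "u (s + t) = u s * u t" for s t
  proof (rule T.realizes_unique[OF u])
    have "M (s + t) = (\<lambda>\<xi>. M s (M t \<xi>))"
    proof (intro ext)
      fix \<xi> :: "(nat \<Rightarrow> 'm) \<Rightarrow> int \<Rightarrow> complex" and y n
      have "cis (- (2 * pi * (s + t) * r)) = cis (- (2 * pi * s * r)) * cis (- (2 * pi * t * r))" for r
        by (simp add: cis_mult algebra_simps)
      then show "M (s + t) \<xi> y n = M s (M t \<xi>) y n" by (simp add: M_def)
    qed
    then show "T.realizes (u s * u t) (M (s + t))" using T.realizes_mult[OF u u] by simp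
  qed
  moreover have "u 0 = 1"
  proof (rule T.realizes_unique[OF u])
    have "M 0 = op_id B" by (intro ext) (simp add: M_def op_id_def)
    then show "T.realizes 1 (M 0)" using T.realizes_one by simp
  qed
  moreover have "star (u t) = u (- t)" for t
    by (simp add: u_def star_sum star_scaleC star_mult star_star cis_cnj)
  moreover have "gauge_action T s (u t) = u t" for s t
  proof (rule T.realizes_unique[OF gauge[OF u]])
    have "(\<lambda>\<xi> y n. cis (2 * pi * s * of_int n) * M t (\<lambda>y n. cis (- (2 * pi * s * of_int n)) * \<xi> y n) y n) = M t"
    proof (intro ext)
      fix \<xi> :: "(nat \<Rightarrow> 'm) \<Rightarrow> int \<Rightarrow> complex" and y n
      have "cis a * cis (- a) = 1" for a by (simp add: cis_mult)
      then show "cis (2 * pi * s * of_int n) * M t (\<lambda>y n. cis (- (2 * pi * s * of_int n)) * \<xi> y n) y n = M t \<xi> y n"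
        by (simp add: M_def)
    qed
    then show "T.realizes (u t) (\<lambda>\<xi> y n. cis (2 * pi * s * of_int n) * M t (\<lambda>y n. cis (- (2 * pi * s * of_int n)) * \<xi> y n) y n)"
      using u by simp
  qed
  moreover have "u t * gauge_action T t (U i) * u (- t) = cis (2 * pi * t) *\<^sub>C U i" for t i
  proof (rule T.realizes_unique[OF T.realizes_mult[OF T.realizes_mult[OF u gauge[OF realizes_U]] u]])
    have eq: "(\<lambda>\<xi>. M t (\<lambda>y n. cis (2 * pi * t * of_int n) * F.transport (op_gen A i)
        (\<lambda>y n. cis (- (2 * pi * t * of_int n)) * M (- t) \<xi> y n) y n))
        = (\<lambda>\<xi> y n. cis (2 * pi * t) * F.transport (op_gen A i) \<xi> y n)"
    proof (intro ext)
      fix \<xi> :: "(nat \<Rightarrow> 'm) \<Rightarrow> int \<Rightarrow> complex" and y n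
      show "M t (\<lambda>y n. cis (2 * pi * t * of_int n) * F.transport (op_gen A i)
          (\<lambda>y n. cis (- (2 * pi * t * of_int n)) * M (- t) \<xi> y n) y n) y n
        = cis (2 * pi * t) * F.transport (op_gen A i) \<xi> y n"
      proof (cases "y \<in> shift_space B \<and> g y 0 = i")
        case True
        then have y: "y \<in> shift_space B" "g y 0 = i" by auto
        have s: "h (shift (g y)) \<in> shift_space B" "g (h (shift (g y))) = shift (g y)"
          using y by (simp_all add: F.g_in F.h_in F.gh shift_in_shift_space1)
        \<comment> \<open>The degree at which \<open>\<xi>\<close> is finally evaluated. With it the
          four phases have total exponent \<open>2 * pi * t\<close>, since the contributions of
          \<open>b\<close> at \<open>g y\<close> and at its shift cancel.\<close>
        define m where "m = n - b (g y) - 1 + b (shift (g y))"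
        define z where "z = \<xi> (h (shift (g y))) m"
        have "- (2 * pi * t * of_int (b (g y))) + (2 * pi * t * of_int n + (- (2 * pi * t * of_int m)
            + (- (2 * pi * (- t) * of_int (b (shift (g y))))))) = 2 * pi * t"
          by (simp add: m_def algebra_simps)
        then have "cis (- (2 * pi * t * of_int (b (g y)))) * (cis (2 * pi * t * of_int n) * (cis (- (2 * pi * t * of_int m))
            * cis (- (2 * pi * (- t) * of_int (b (shift (g y))))))) = cis (2 * pi * t)"
          unfolding cis_mult by (rule arg_cong)
        then have "cis (- (2 * pi * t * of_int (b (g y)))) * (cis (2 * pi * t * of_int n) * (cis (- (2 * pi * t * of_int m))
            * (cis (- (2 * pi * (- t) * of_int (b (shift (g y))))) * z))) = cis (2 * pi * t) * z"
          by (simp only: flip: mult.assoc)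
        then show ?thesis
          unfolding M_def F.transport_def op_gen_def F.pull_def
          by (simp only: y F.g_in s m_def[symmetric] z_def[symmetric] if_True simp_thms)
      next
        case False
        then show ?thesis by (auto simp: M_def F.transport_def op_gen_def)
      qed
    qed
    show "T.realizes (cis (2 * pi * t) *\<^sub>C U i) (\<lambda>\<xi>. M t (\<lambda>y n. cis (2 * pi * t * of_int n) * F.transport (op_gen A i)
        (\<lambda>y n. cis (- (2 * pi * t * of_int n)) * M (- t) \<xi> y n) y n))"
      unfolding eq by (rule T.realizes_scale[OF realizes_U])
  qed
  ultimately show ?thesis by blast
qed

lemma cuntz_krieger_algebra_U:
  assumes "cuntz_krieger_algebra B T"
  shows "cuntz_krieger_algebra A U"
proof -
  interpret U: ck_family A U by (rule ck_family_U)
  have M: "cstar_subalgebra (cstar_subalgebra hull range U)" by (rule hull_in) (auto simp: cstar_subalgebra_def)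
  have "cstar_subalgebra hull range U = UNIV"
    using assms by (intro generated_subset[of T, OF _ M generator_in_hull]) (simp add: cuntz_krieger_algebra_def)
  then show ?thesis
    using U.S_nonzero U.S_partial_isometry U.S_sum U.S_relation by (simp add: cuntz_krieger_algebra_def partial_isometry_def)
qed

end

lemma star_iso_conjugation:
  fixes v :: "'a::unital_cstar_algebra"
  assumes "star v * v = 1" "v * star v = 1"
  shows "star_iso (\<lambda>x. v * x * star v)"
proof -
  have r: "star v * (v * x) = x" "v * (star v * x) = x" for x using assms by (simp_all flip: mult.assoc)
  have "bij (\<lambda>x. v * x * star v)"
    by (rule o_bij[of "\<lambda>x. star v * x * v"]) (auto simp: fun_eq_iff mult.assoc r assms)
  moreover have "star_hom (\<lambda>x. v * x * star v)"
    by (auto simp: star_hom_def distrib_left distrib_right mult_scaleC_left mult_scaleC_right star_mult star_star mult.assoc r)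
  ultimately show ?thesis by (simp add: star_iso_def)
qed

text \<open>For each \<open>t\<close> both sides are isomorphisms in \<open>a\<close>, the right one
  involving conjugation by the unitary \<open>u t\<close>, and they agree on the generators
  \<open>S i\<close>.\<close>

theorem (in orbit_equivalence) gauge_actions_cocycle_conjugate:
  assumes S: "cuntz_krieger_algebra A S" and T: "cuntz_krieger_algebra B T"
  shows "\<exists>\<Phi> u. star_iso \<Phi> \<and> continuous_on UNIV u \<and> (\<forall>t. u (t + 1) = u t) \<and> (\<forall>s t. u (s + t) = u s * u t) \<and> u 0 = 1 \<and>
     (\<forall>t. star (u t) = u (- t)) \<and> (\<forall>s t. gauge_action T s (u t) = u t) \<and>
     (\<forall>t a. \<Phi> (gauge_action S t a) = u t * gauge_action T t (\<Phi> a) * u (- t))"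
proof -
  obtain U where "transported_family A B h g k l b k' l' b' T U"
    using exists_transported_family[OF cuntz_krieger_algebra_ck_family[OF F.markov_B T]] by blast
  then interpret U: transported_family A B h g k l b k' l' b' T U .
  obtain \<Phi> where \<Phi>: "star_iso \<Phi>" "\<And>i. \<Phi> (S i) = U i"
    using cuntz_krieger_uniqueness[OF F.markov_A S U.cuntz_krieger_algebra_U[OF T]] by blast
  obtain u where u: "continuous_on UNIV u" "\<And>t. u (t + 1) = u t" "\<And>s t. u (s + t) = u s * u t" "u 0 = 1"
     "\<And>t. star (u t) = u (- t)" "\<And>s t. gauge_action T s (u t) = u t"
     "\<And>t i. u t * gauge_action T t (U i) * u (- t) = cis (2 * pi * t) *\<^sub>C U i"
    using U.exists_unitary_cocycle[OF T] by blast
  have "(\<lambda>a. \<Phi> (gauge_action S t a)) = (\<lambda>a. u t * gauge_action T t (\<Phi> a) * u (- t))" for t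
  proof (rule star_iso_eq_on_generators[of S])
    show "cstar_subalgebra hull range S = UNIV" using S by (simp add: cuntz_krieger_algebra_def)
    show "star_iso (\<lambda>a. \<Phi> (gauge_action S t a))"
      by (rule star_iso_comp[OF \<Phi>(1) gauge_action(1)[OF F.markov_A S]])
    have "star_iso (\<lambda>x. u t * x * star (u t))"
      using u(3)[of t "-t"] u(3)[of "-t" t] by (intro star_iso_conjugation) (simp_all add: u(4,5))
    then show "star_iso (\<lambda>a. u t * gauge_action T t (\<Phi> a) * u (- t))"
      unfolding u(5) by (rule star_iso_comp[OF _ star_iso_comp[OF gauge_action(1)[OF F.markov_B T] \<Phi>(1)]])
    show "\<Phi> (gauge_action S t (S i)) = u t * gauge_action T t (\<Phi> (S i)) * u (- t)" for i
      using \<Phi>(1) by (simp add: gauge_action(2)[OF F.markov_A S] \<Phi>(2) u(7) star_iso_def star_homD)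
  qed
  then have "\<forall>t a. \<Phi> (gauge_action S t a) = u t * gauge_action T t (\<Phi> a) * u (- t)" by (simp add: fun_eq_iff)
  then show ?thesis using \<Phi>(1) u by blast
qed

section \<open>From homeomorphisms to finitely determined data\<close>

lemma continuous_map_coordinate: "continuous_map (shift_top A) (discrete_topology UNIV) (\<lambda>x. x n)"
  unfolding shift_top_def
  by (rule continuous_map_from_subtopology, rule continuous_map_product_projection) auto

lemma continuous_map_shift: "continuous_map (shift_top A) (shift_top A) shift"
proof -
  have "continuous_map (shift_top A) (discrete_topology UNIV) (\<lambda>x. shift x n)" for n
    using continuous_map_coordinate[of A "Suc n"] by (simp add: shift_def)
  then have "continuous_map (shift_top A) (product_topology (\<lambda>_. discrete_topology UNIV) UNIV) shift"
    by (simp add: continuous_map_componentwise_UNIV)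
  then show ?thesis
    unfolding shift_top_def[of A] by (subst continuous_map_in_subtopology) (auto simp: shift_top_def shift_in_shift_space1)
qed

lemma orbit_map_of_strongly_continuous:
  assumes "markov_matrix A" "markov_matrix B" and hg: "homeomorphic_maps (shift_top A) (shift_top B) h g"
    and kl: "orbit_cocycles A h k l" and b: "\<And>x. x \<in> shift_space A \<Longrightarrow> int (l x) - int (k x) = 1 + b x - b (shift x)"
  shows "orbit_map A B h g k l b"
proof -
  have h: "continuous_map (shift_top A) (shift_top B) h" and g: "continuous_map (shift_top B) (shift_top A) g"
    using hg by (auto simp: homeomorphic_maps_def)
  have det: "\<exists>N. determined B N (\<lambda>y. f (g y))" if "continuous_map (shift_top A) (discrete_topology UNIV) f" for f
    using continuous_map_determined[OF continuous_map_compose[OF g that]] by (simp add: o_def)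
  have "continuous_map (shift_top A) (discrete_topology UNIV) (\<lambda>x. h (shift x) n)" for n
    using continuous_map_compose[OF continuous_map_compose[OF continuous_map_shift h] continuous_map_coordinate] by (simp add: o_def)
  note det_h = det[OF this]
  show ?thesis
  proof
    show "h x \<in> shift_space B" if "x \<in> shift_space A" for x
      using h that by (auto simp: continuous_map_def)
    show "g y \<in> shift_space A" if "y \<in> shift_space B" for y
      using g that by (auto simp: continuous_map_def)
    show "\<exists>N. determined B N (\<lambda>y. h (shift (g y)) n)" for n by (rule det_h)
    show "\<exists>N. determined B N (\<lambda>y. g y 0)" by (rule det[OF continuous_map_coordinate])
  qed (use assms det in \<open>auto simp: homeomorphic_maps_def orbit_cocycles_def\<close>)
qed

lemma exists_orbit_equivalence:
  assumes AB: "markov_matrix A" "markov_matrix B" and "strongly_continuous_orbit_equivalent A B"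
  shows "\<exists>h g k l b k' l' b'. orbit_equivalence A B h g k l b k' l' b'"
proof -
  obtain h g where hg: "homeomorphic_maps (shift_top A) (shift_top B) h g"
    and h: "strongly_continuous_orbit_map A B h" and g: "strongly_continuous_orbit_map B A g"
    using assms(3) by (auto simp: strongly_continuous_orbit_equivalent_def)
  obtain k l and b :: "_ \<Rightarrow> int" where kl: "orbit_cocycles A h k l" "continuous_map (shift_top A) (discrete_topology UNIV) b"
    "\<And>x. x \<in> shift_space A \<Longrightarrow> int (l x) - int (k x) = 1 + b x - b (shift x)"
    using h unfolding strongly_continuous_orbit_map_def by blast
  obtain k' l' and b' :: "_ \<Rightarrow> int" where kl': "orbit_cocycles B g k' l'" "continuous_map (shift_top B) (discrete_topology UNIV) b'"
    "\<And>y. y \<in> shift_space B \<Longrightarrow> int (l' y) - int (k' y) = 1 + b' y - b' (shift y)"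
    using g unfolding strongly_continuous_orbit_map_def by blast
  have gh: "homeomorphic_maps (shift_top B) (shift_top A) g h" using hg homeomorphic_maps_sym by blast
  have "continuous_map (shift_top B) (shift_top A) g" using hg by (simp add: homeomorphic_maps_def)
  from continuous_map_determined[OF continuous_map_compose[OF this kl(2)]]
  have "\<exists>N. determined B N (\<lambda>y. b (g y))" by (simp add: o_def)
  moreover have "\<exists>N. determined B N b'" by (rule continuous_map_determined[OF kl'(2)])
  ultimately have "orbit_equivalence A B h g k l b k' l' b'"
    using orbit_map_of_strongly_continuous[OF AB hg kl(1,3)] orbit_map_of_strongly_continuous[OF AB(2,1) gh kl'(1,3)]
    by (simp add: orbit_equivalence_def orbit_equivalence_axioms_def)
  then show ?thesis by blast
qed

section \<open>Crossed products\<close>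

text \<open>The inverse \<open>L'\<close> transfers non-integrability, and then both sides are the
  default value 0. The convolution identities below can thus be stated for arbitrary
  functions.\<close>

lemma integral_bijective_isometry:
  fixes L :: "'a::banach \<Rightarrow> 'b::banach"
  assumes L: "bounded_linear L" and L': "bounded_linear L'" and inv: "\<And>x. L' (L x) = x"
  shows "integral S (\<lambda>s. L (f s)) = L (integral S f)"
proof (cases "f integrable_on S")
  case True
  then show ?thesis using integral_linear[OF True L] by (simp add: o_def)
next
  case False
  have "\<not> (\<lambda>s. L (f s)) integrable_on S"
  proof
    assume "(\<lambda>s. L (f s)) integrable_on S"
    from integrable_linear[OF this L'] show False using False by (simp add: o_def inv)
  qed
  then show ?thesis using False linear_0[OF bounded_linear.linear[OF L]] by (simp add: not_integrable_integral)
qed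

lemma L1_cstar_seminorm_comp:
  assumes p: "L1_cstar_seminorm \<beta> p"
    and circle: "\<And>f. f \<in> circle_functions \<Longrightarrow> \<Psi> f \<in> circle_functions"
    and add: "\<And>f g. \<Psi> (\<lambda>t. f t + g t) = (\<lambda>t. \<Psi> f t + \<Psi> g t)"
    and scale: "\<And>c f. \<Psi> (\<lambda>t. c *\<^sub>C f t) = (\<lambda>t. c *\<^sub>C \<Psi> f t)"
    and conv: "\<And>f g. \<Psi> (convolution \<alpha> f g) = convolution \<beta> (\<Psi> f) (\<Psi> g)"
    and invol: "\<And>f. \<Psi> (involution \<alpha> f) = involution \<beta> (\<Psi> f)"
    and L1: "\<And>f. L1_norm (\<Psi> f) = L1_norm f"
  shows "L1_cstar_seminorm \<alpha> (\<lambda>f. p (\<Psi> f))"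
  using p circle unfolding L1_cstar_seminorm_def add scale conv invol L1[symmetric] by simp

text \<open>Common framework for the twist by the unitaries \<open>u t\<close> and for the
  multiplication by characters. The last two conditions say that the fibrewise map respects
  convolution and involution.\<close>

locale fibre_isometries =
  fixes \<alpha> :: "real \<Rightarrow> 'a::cstar_algebra \<Rightarrow> 'a" and \<beta> :: "real \<Rightarrow> 'b::cstar_algebra \<Rightarrow> 'b"
    and \<Lambda> :: "real \<Rightarrow> 'a \<Rightarrow> 'b" and \<Lambda>' :: "real \<Rightarrow> 'b \<Rightarrow> 'a"
  assumes \<Lambda>_add: "\<And>t x y. \<Lambda> t (x + y) = \<Lambda> t x + \<Lambda> t y"
    and \<Lambda>_scale: "\<And>t c x. \<Lambda> t (c *\<^sub>C x) = c *\<^sub>C \<Lambda> t x"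
    and \<Lambda>_norm: "\<And>t x. norm (\<Lambda> t x) = norm x"
    and \<Lambda>'_\<Lambda>: "\<And>t x. \<Lambda>' t (\<Lambda> t x) = x" and \<Lambda>_\<Lambda>': "\<And>t y. \<Lambda> t (\<Lambda>' t y) = y"
    and circle: "\<And>f. f \<in> circle_functions \<Longrightarrow> (\<lambda>t. \<Lambda> t (f t)) \<in> circle_functions"
    and circle': "\<And>f. f \<in> circle_functions \<Longrightarrow> (\<lambda>t. \<Lambda>' t (f t)) \<in> circle_functions"
    and \<Lambda>_mult: "\<And>s t x y. \<Lambda> t (x * \<alpha> s y) = \<Lambda> s x * \<beta> s (\<Lambda> (t - s) y)"
    and \<Lambda>_star: "\<And>t x. \<Lambda> t (\<alpha> t (star x)) = \<beta> t (star (\<Lambda> (- t) x))"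
begin

definition \<Psi> :: "(real \<Rightarrow> 'a) \<Rightarrow> real \<Rightarrow> 'b" where
  "\<Psi> f = (\<lambda>t. \<Lambda> t (f t))"

definition \<Psi>' :: "(real \<Rightarrow> 'b) \<Rightarrow> real \<Rightarrow> 'a" where
  "\<Psi>' f = (\<lambda>t. \<Lambda>' t (f t))"

lemma \<Psi>'_\<Psi>: "\<Psi>' (\<Psi> f) = f" and \<Psi>_\<Psi>': "\<Psi> (\<Psi>' g) = g"
  by (simp_all add: \<Psi>_def \<Psi>'_def \<Lambda>'_\<Lambda> \<Lambda>_\<Lambda>')

lemma bounded_linear_\<Lambda>: "bounded_linear (\<Lambda> t)" and bounded_linear_\<Lambda>': "bounded_linear (\<Lambda>' t)"
proof -
  show "bounded_linear (\<Lambda> t)"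
    by (rule bounded_linear_intro[where K = 1]) (simp_all add: \<Lambda>_add \<Lambda>_scale \<Lambda>_norm scaleR_scaleC)
  have "\<Lambda>' t (x + y) = \<Lambda>' t x + \<Lambda>' t y" for x y
    using \<Lambda>_add[of t "\<Lambda>' t x" "\<Lambda>' t y"] by (metis \<Lambda>'_\<Lambda> \<Lambda>_\<Lambda>')
  moreover have "\<Lambda>' t (c *\<^sub>C x) = c *\<^sub>C \<Lambda>' t x" for c x
    using \<Lambda>_scale[of t c "\<Lambda>' t x"] by (metis \<Lambda>'_\<Lambda> \<Lambda>_\<Lambda>')
  moreover have "norm (\<Lambda>' t x) = norm x" for x
    using \<Lambda>_norm[of t "\<Lambda>' t x"] by (simp add: \<Lambda>_\<Lambda>')
  ultimately show "bounded_linear (\<Lambda>' t)"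
    by (intro bounded_linear_intro[where K = 1]) (simp_all add: scaleR_scaleC)
qed

lemma \<Psi>_convolution: "\<Psi> (convolution \<alpha> f g) = convolution \<beta> (\<Psi> f) (\<Psi> g)"
proof
  fix t
  have "\<Psi> (convolution \<alpha> f g) t = integral {0..1} (\<lambda>s. \<Lambda> t (f s * \<alpha> s (g (t - s))))"
    unfolding \<Psi>_def convolution_def
    by (rule integral_bijective_isometry[OF bounded_linear_\<Lambda> bounded_linear_\<Lambda>' \<Lambda>'_\<Lambda>, symmetric])
  then show "\<Psi> (convolution \<alpha> f g) t = convolution \<beta> (\<Psi> f) (\<Psi> g) t"
    by (simp add: \<Lambda>_mult convolution_def \<Psi>_def)
qed

lemma \<Psi>'_convolution: "\<Psi>' (convolution \<beta> f g) = convolution \<alpha> (\<Psi>' f) (\<Psi>' g)"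
  using \<Psi>_convolution[of "\<Psi>' f" "\<Psi>' g"] by (metis \<Psi>'_\<Psi> \<Psi>_\<Psi>')

lemma \<Psi>_involution: "\<Psi> (involution \<alpha> f) = involution \<beta> (\<Psi> f)"
  by (simp add: \<Psi>_def involution_def \<Lambda>_star)

lemma \<Psi>'_involution: "\<Psi>' (involution \<beta> f) = involution \<alpha> (\<Psi>' f)"
  using \<Psi>_involution[of "\<Psi>' f"] by (metis \<Psi>'_\<Psi> \<Psi>_\<Psi>')

lemma \<Psi>_add: "\<Psi> (\<lambda>t. f t + g t) = (\<lambda>t. \<Psi> f t + \<Psi> g t)" and \<Psi>_scale: "\<Psi> (\<lambda>t. c *\<^sub>C f t) = (\<lambda>t. c *\<^sub>C \<Psi> f t)"
  by (simp_all add: \<Psi>_def \<Lambda>_add \<Lambda>_scale)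

lemma \<Psi>'_add: "\<Psi>' (\<lambda>t. f t + g t) = (\<lambda>t. \<Psi>' f t + \<Psi>' g t)"
  using \<Psi>_add[of "\<Psi>' f" "\<Psi>' g"] by (metis \<Psi>'_\<Psi> \<Psi>_\<Psi>')

lemma \<Psi>'_scale: "\<Psi>' (\<lambda>t. c *\<^sub>C f t) = (\<lambda>t. c *\<^sub>C \<Psi>' f t)"
  using \<Psi>_scale[of c "\<Psi>' f"] by (metis \<Psi>'_\<Psi> \<Psi>_\<Psi>')

lemma L1_norm_\<Psi>: "L1_norm (\<Psi> f) = L1_norm f"
  by (simp add: L1_norm_def \<Psi>_def \<Lambda>_norm)

lemma L1_norm_\<Psi>': "L1_norm (\<Psi>' f) = L1_norm f"
  using L1_norm_\<Psi>[of "\<Psi>' f"] by (simp add: \<Psi>_\<Psi>')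

text \<open>Composition with \<open>\<Psi>\<close> and \<open>\<Psi>'\<close> exchanges the
  seminorms of both sides, so the two suprema run over the same set of values.\<close>

lemma universal_norm_\<Psi>: "universal_norm \<beta> (\<Psi> f) = universal_norm \<alpha> f"
proof -
  have 1: "L1_cstar_seminorm \<alpha> (\<lambda>f. p (\<Psi> f))" if "L1_cstar_seminorm \<beta> p" for p
    by (rule L1_cstar_seminorm_comp[OF that])
       (auto simp: circle \<Psi>_add \<Psi>_scale \<Psi>_convolution \<Psi>_involution L1_norm_\<Psi>, simp add: \<Psi>_def circle)
  have 2: "L1_cstar_seminorm \<beta> (\<lambda>f. q (\<Psi>' f))" if "L1_cstar_seminorm \<alpha> q" for q
    by (rule L1_cstar_seminorm_comp[OF that])
       (auto simp: \<Psi>'_add \<Psi>'_scale \<Psi>'_convolution \<Psi>'_involution L1_norm_\<Psi>', simp add: \<Psi>'_def circle')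
  have "(\<lambda>p. p (\<Psi> f)) ` {p. L1_cstar_seminorm \<beta> p} = (\<lambda>q. q f) ` {q. L1_cstar_seminorm \<alpha> q}"
  proof (intro equalityI subsetI)
    fix r assume "r \<in> (\<lambda>p. p (\<Psi> f)) ` {p. L1_cstar_seminorm \<beta> p}"
    then obtain p where "L1_cstar_seminorm \<beta> p" "r = p (\<Psi> f)" by blast
    then show "r \<in> (\<lambda>q. q f) ` {q. L1_cstar_seminorm \<alpha> q}" using 1 by (intro image_eqI[of _ _ "\<lambda>f. p (\<Psi> f)"]) auto
  next
    fix r assume "r \<in> (\<lambda>q. q f) ` {q. L1_cstar_seminorm \<alpha> q}"
    then obtain q where "L1_cstar_seminorm \<alpha> q" "r = q f" by blast
    then show "r \<in> (\<lambda>p. p (\<Psi> f)) ` {p. L1_cstar_seminorm \<beta> p}"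
      using 2 by (intro image_eqI[of _ _ "\<lambda>f. q (\<Psi>' f)"]) (auto simp: \<Psi>'_\<Psi>)
  qed
  then show ?thesis by (simp add: universal_norm_def)
qed

text \<open>The universal norms correspond and both canonical images are dense, so pairing
  \<open>\<iota> f\<close> with \<open>\<kappa> (\<Psi> f)\<close> gives a correspondence that
  extends to an isomorphism. Stability of circle functions under convolution and involution depends
  on the continuity of \<open>\<alpha>\<close> and is therefore a hypothesis.\<close>

lemma crossed_product_iso:
  assumes \<iota>: "crossed_product \<alpha> \<iota>" and \<kappa>: "crossed_product \<beta> \<kappa>"
    and conv: "\<And>f g. f \<in> circle_functions \<Longrightarrow> g \<in> circle_functions \<Longrightarrow> convolution \<alpha> f g \<in> circle_functions"
    and invol: "\<And>f. f \<in> circle_functions \<Longrightarrow> involution \<alpha> f \<in> circle_functions"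
  shows "\<exists>\<Theta>. star_iso \<Theta> \<and> (\<forall>f\<in>circle_functions. \<Theta> (\<iota> f) = \<kappa> (\<lambda>t. \<Lambda> t (f t)))"
proof -
  define G where "G = (\<lambda>f. (\<iota> f, \<kappa> (\<Psi> f))) ` circle_functions"
  have \<Psi>c: "\<Psi> f \<in> circle_functions" if "f \<in> circle_functions" for f using circle that by (simp add: \<Psi>_def)
  have GI: "(\<iota> f, \<kappa> (\<Psi> f)) \<in> G" if "f \<in> circle_functions" for f using that by (simp add: G_def)
  note \<iota>D = \<iota>[unfolded crossed_product_def] and \<kappa>D = \<kappa>[unfolded crossed_product_def]
  have add_circle: "(\<lambda>t. f t + g t) \<in> circle_functions" if "f \<in> circle_functions" "g \<in> circle_functions" for f g :: "real \<Rightarrow> 'a"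
    using that by (auto simp: circle_functions_def intro: continuous_intros)
  have scale_circle: "(\<lambda>t. c *\<^sub>C f t) \<in> circle_functions" if "f \<in> circle_functions" for c and f :: "real \<Rightarrow> 'a"
    using that by (auto simp: circle_functions_def intro: bounded_linear.continuous_on[OF bounded_linear_scaleC_right])
  have "\<exists>\<Theta>. star_iso \<Theta> \<and> (\<forall>x y. (x, y) \<in> G \<longrightarrow> \<Theta> x = y)"
  proof (rule star_iso_extension)
    fix x y x' y' assume "(x, y) \<in> G" "(x', y') \<in> G"
    then obtain f g where f: "f \<in> circle_functions" "x = \<iota> f" "y = \<kappa> (\<Psi> f)"
      and g: "g \<in> circle_functions" "x' = \<iota> g" "y' = \<kappa> (\<Psi> g)" by (auto simp: G_def)
    show "(x + x', y + y') \<in> G"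
      using GI[OF add_circle[OF f(1) g(1)]] \<iota>D \<kappa>D f g \<Psi>c by (simp add: \<Psi>_add)
    show "(x * x', y * y') \<in> G"
      using GI[OF conv[OF f(1) g(1)]] \<iota>D \<kappa>D f g \<Psi>c by (simp add: \<Psi>_convolution)
  next
    fix c x y assume "(x, y) \<in> G"
    then obtain f where f: "f \<in> circle_functions" "x = \<iota> f" "y = \<kappa> (\<Psi> f)" by (auto simp: G_def)
    show "(c *\<^sub>C x, c *\<^sub>C y) \<in> G"
      using GI[OF scale_circle[OF f(1), of c]] \<iota>D \<kappa>D f \<Psi>c by (simp add: \<Psi>_scale)
  next
    fix x y assume "(x, y) \<in> G"
    then obtain f where f: "f \<in> circle_functions" "x = \<iota> f" "y = \<kappa> (\<Psi> f)" by (auto simp: G_def)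
    show "(star x, star y) \<in> G"
      using GI[OF invol[OF f(1)]] \<iota>D \<kappa>D f \<Psi>c by (simp add: \<Psi>_involution)
    show "norm x = norm y" using \<iota>D \<kappa>D f \<Psi>c by (simp add: universal_norm_\<Psi>)
  next
    have "fst ` G = \<iota> ` circle_functions" by (simp add: G_def image_image)
    then show "closure (fst ` G) = UNIV" using \<iota>D by simp
    have "g \<in> \<Psi> ` circle_functions" if "g \<in> circle_functions" for g
      using that circle'[OF that] by (intro image_eqI[of _ _ "\<Psi>' g"]) (simp add: \<Psi>_\<Psi>', simp add: \<Psi>'_def)
    then have "\<Psi> ` circle_functions = circle_functions" using \<Psi>c by blast
    moreover have "snd ` G = \<kappa> ` (\<Psi> ` circle_functions)" by (simp add: G_def image_image)
    ultimately have "snd ` G = \<kappa> ` circle_functions" by (simp only:)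
    then show "closure (snd ` G) = UNIV" using \<kappa>D by simp
  qed
  then obtain \<Theta> where "star_iso \<Theta>" "\<And>x y. (x, y) \<in> G \<Longrightarrow> \<Theta> x = y" by blast
  then show ?thesis using GI by (auto simp: \<Psi>_def)
qed

end

text \<open>Isometry of each automorphism upgrades pointwise continuity in \<open>t\<close> to joint
  continuity, which convolution integrals need.\<close>

lemma gauge_action_continuous:
  assumes "markov_matrix A" "cuntz_krieger_algebra A S" "continuous_on X p" "continuous_on X f"
  shows "continuous_on X (\<lambda>z. gauge_action S (p z) (f z))"
  unfolding continuous_on_def
proof
  let ?\<alpha> = "gauge_action S"
  have h: "star_hom (?\<alpha> t)" for t using gauge_action(1)[OF assms(1,2)] by (simp add: star_iso_def)
  fix w assume w: "w \<in> X"
  have "continuous_on X (\<lambda>z. ?\<alpha> (p z) (f w))"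
    using continuous_on_compose2[OF gauge_action_continuous_pointwise[OF assms(1,2)] assms(3)] by simp
  then have "((\<lambda>z. ?\<alpha> (p z) (f w)) \<longlongrightarrow> ?\<alpha> (p w) (f w)) (at w within X)" using w by (auto simp: continuous_on_def)
  moreover have "(f \<longlongrightarrow> f w) (at w within X)" using assms(4) w by (auto simp: continuous_on_def)
  ultimately have "((\<lambda>z. norm (f z - f w) + norm (?\<alpha> (p z) (f w) - ?\<alpha> (p w) (f w))) \<longlongrightarrow>
      norm (f w - f w) + norm (?\<alpha> (p w) (f w) - ?\<alpha> (p w) (f w))) (at w within X)"
    by (intro tendsto_intros)
  then have 0: "((\<lambda>z. norm (f z - f w) + norm (?\<alpha> (p z) (f w) - ?\<alpha> (p w) (f w))) \<longlongrightarrow> 0) (at w within X)" by simp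
  have "norm (?\<alpha> (p z) (f z) - ?\<alpha> (p w) (f w)) \<le> norm (f z - f w) + norm (?\<alpha> (p z) (f w) - ?\<alpha> (p w) (f w))" for z
  proof -
    have "?\<alpha> (p z) (f z) - ?\<alpha> (p w) (f w) = ?\<alpha> (p z) (f z - f w) + (?\<alpha> (p z) (f w) - ?\<alpha> (p w) (f w))"
      by (simp add: star_homD[OF h])
    then have "norm (?\<alpha> (p z) (f z) - ?\<alpha> (p w) (f w)) \<le> norm (?\<alpha> (p z) (f z - f w)) + norm (?\<alpha> (p z) (f w) - ?\<alpha> (p w) (f w))"
      by (metis norm_triangle_ineq)
    then show ?thesis by (simp add: star_iso_norm[OF gauge_action(1)[OF assms(1,2)]])
  qed
  then have "((\<lambda>z. ?\<alpha> (p z) (f z) - ?\<alpha> (p w) (f w)) \<longlongrightarrow> 0) (at w within X)"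
    by (intro Lim_null_comparison[OF always_eventually 0]) blast
  then show "((\<lambda>z. ?\<alpha> (p z) (f z)) \<longlongrightarrow> ?\<alpha> (p w) (f w)) (at w within X)" by (simp add: LIM_zero_iff)
qed

lemma convolution_circle:
  assumes "markov_matrix A" "cuntz_krieger_algebra A S" "f \<in> circle_functions" "g \<in> circle_functions"
  shows "convolution (gauge_action S) f g \<in> circle_functions"
proof -
  have fg: "continuous_on UNIV f" "continuous_on UNIV g" "\<And>t. g (t + 1) = g t"
    using assms(3,4) by (auto simp: circle_functions_def)
  have "continuous_on (UNIV \<times> cbox 0 1) (\<lambda>(t, s). f s * gauge_action S s (g (t - s)))"
    unfolding split_def
    by (intro continuous_on_mult gauge_action_continuous[OF assms(1,2)] continuous_on_compose2[OF fg(1)]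
        continuous_on_compose2[OF fg(2)] continuous_intros) auto
  from integral_continuous_on_param[OF this] have "continuous_on UNIV (convolution (gauge_action S) f g)"
    by (simp add: convolution_def[abs_def])
  moreover have "convolution (gauge_action S) f g (t + 1) = convolution (gauge_action S) f g t" for t
    using fg(3)[of "t - _"] by (simp add: convolution_def algebra_simps)
  ultimately show ?thesis by (simp add: circle_functions_def)
qed

lemma involution_circle:
  assumes "markov_matrix A" "cuntz_krieger_algebra A S" "f \<in> circle_functions"
  shows "involution (gauge_action S) f \<in> circle_functions"
proof -
  have f: "continuous_on UNIV f" "\<And>t. f (t + 1) = f t"
    using assms(3) by (auto simp: circle_functions_def)
  have "continuous_on UNIV (involution (gauge_action S) f)"
    unfolding involution_def
    by (intro gauge_action_continuous[OF assms(1,2)] bounded_linear.continuous_on[OF bounded_linear_star]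
        continuous_on_compose2[OF f(1)] continuous_intros) auto
  moreover have "involution (gauge_action S) f (t + 1) = involution (gauge_action S) f t" for t
    using f(2)[of "- t - 1"] by (simp add: involution_def gauge_action_periodic[OF assms(1,2)])
  ultimately show ?thesis by (simp add: circle_functions_def)
qed

lemma scale_circle_functions:
  assumes "f \<in> circle_functions"
  shows "(\<lambda>t. cis (2 * pi * of_int n * t) *\<^sub>C f t) \<in> circle_functions"
proof -
  have f: "continuous_on UNIV f" "\<And>t. f (t + 1) = f t"
    using assms by (auto simp: circle_functions_def)
  have "cis (2 * pi * of_int n * (t + 1)) = cis (2 * pi * of_int n * t)" for t
    using cis_int_periodic[of t n] by (simp only: ac_simps)
  then show ?thesis
    unfolding circle_functions_def by (auto simp: f intro!: continuous_on_scaleC continuous_intros f)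
qed

text \<open>Multiplication by a character is a fibrewise isometry from the system to itself, by
  multiplicativity of the character; density of the image of \<open>\<iota>\<close> makes the
  extension unique.\<close>

lemma dual_action:
  assumes "markov_matrix A" "cuntz_krieger_algebra A S" and \<iota>: "crossed_product (gauge_action S) \<iota>"
  shows "star_iso (dual_action \<iota> n)"
    and "f \<in> circle_functions \<Longrightarrow> dual_action \<iota> n (\<iota> f) = \<iota> (\<lambda>t. cis (- 2 * pi * of_int n * t) *\<^sub>C f t)"
proof -
  let ?c = "\<lambda>t. cis (- 2 * pi * of_int n * t)"
  have h: "star_hom (gauge_action S t)" for t using gauge_action(1)[OF assms(1,2)] by (simp add: star_iso_def)
  have c1: "?c (t - s) * ?c s = ?c t" and c2: "cnj (?c (- t)) = ?c t" and c3: "?c t * cis (2 * pi * of_int n * t) = 1"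
    and c4: "cis (2 * pi * of_int n * t) * ?c t = 1" for s t
    by (simp_all add: cis_mult cis_cnj algebra_simps)
  interpret fibre_isometries "gauge_action S" "gauge_action S" "\<lambda>t x. ?c t *\<^sub>C x" "\<lambda>t x. cis (2 * pi * of_int n * t) *\<^sub>C x"
  proof
    show "(\<lambda>t. ?c t *\<^sub>C f t) \<in> circle_functions" if "f \<in> circle_functions" for f :: "real \<Rightarrow> 'b"
      using scale_circle_functions[OF that, of "- n"] by simp
    show "?c t *\<^sub>C (x * gauge_action S s y) = ?c s *\<^sub>C x * gauge_action S s (?c (t - s) *\<^sub>C y)" for s t x y
      unfolding star_homD(2)[OF h] mult_scaleC_left mult_scaleC_right scaleC_scaleC c1 ..
    show "?c t *\<^sub>C gauge_action S t (star x) = gauge_action S t (star (?c (- t) *\<^sub>C x))" for t x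
      unfolding star_scaleC star_homD(2)[OF h] c2 ..
    show "cis (2 * pi * of_int n * t) *\<^sub>C ?c t *\<^sub>C x = x" "?c t *\<^sub>C cis (2 * pi * of_int n * t) *\<^sub>C x = x" for t x
      unfolding scaleC_scaleC c3 c4 by simp_all
    show "(\<lambda>t. cis (2 * pi * of_int n * t) *\<^sub>C f t) \<in> circle_functions" if "f \<in> circle_functions" for f :: "real \<Rightarrow> 'b"
      by (rule scale_circle_functions[OF that])
  qed (simp_all only: scaleC_add_right scaleC_scaleC norm_scaleC norm_cis mult_1 mult.commute)
  obtain \<Theta> where \<Theta>: "star_iso \<Theta>" "\<And>f. f \<in> circle_functions \<Longrightarrow> \<Theta> (\<iota> f) = \<iota> (\<lambda>t. ?c t *\<^sub>C f t)"
    using crossed_product_iso[OF \<iota> \<iota> convolution_circle[OF assms(1,2)] involution_circle[OF assms(1,2)]] by blast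
  have uniq: "\<theta> = \<Theta>" if "star_iso \<theta>" "\<And>f. f \<in> circle_functions \<Longrightarrow> \<theta> (\<iota> f) = \<iota> (\<lambda>t. ?c t *\<^sub>C f t)" for \<theta>
    using \<iota> \<Theta> that by (intro star_iso_eq_on_dense[of \<theta> \<Theta> "\<iota> ` circle_functions"]) (auto simp: crossed_product_def)
  have "dual_action \<iota> n = \<Theta>"
    unfolding dual_action_def
  proof (rule the_equality)
    show "star_iso \<Theta> \<and> (\<forall>f\<in>circle_functions. \<Theta> (\<iota> f) = \<iota> (\<lambda>t. ?c t *\<^sub>C f t))" using \<Theta> by blast
  qed (use uniq in blast)
  note eq = this
  show "star_iso (dual_action \<iota> n)" unfolding eq by (rule \<Theta>(1))
  show "dual_action \<iota> n (\<iota> f) = \<iota> (\<lambda>t. ?c t *\<^sub>C f t)" if "f \<in> circle_functions"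
    unfolding eq by (rule \<Theta>(2)[OF that])
qed

theorem corollary6p8:
  fixes A :: "nat^'n^'n" and B :: "nat^'m^'m"
    and S :: "'n \<Rightarrow> 'a::unital_cstar_algebra" and T :: "'m \<Rightarrow> 'b::unital_cstar_algebra"
    and \<iota>\<^sub>A :: "(real \<Rightarrow> 'a) \<Rightarrow> 'c::cstar_algebra" and \<iota>\<^sub>B :: "(real \<Rightarrow> 'b) \<Rightarrow> 'd::cstar_algebra"
  assumes "markov_matrix A" and "markov_matrix B"
    and "strongly_continuous_orbit_equivalent A B"
    and "cuntz_krieger_algebra A S" and "cuntz_krieger_algebra B T"
    and "crossed_product (gauge_action S) \<iota>\<^sub>A" and "crossed_product (gauge_action T) \<iota>\<^sub>B"
  shows "\<exists>\<Phi> :: 'c \<Rightarrow> 'd. star_iso \<Phi> \<and>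
           (\<forall>n x. \<Phi> (dual_action \<iota>\<^sub>A n x) = dual_action \<iota>\<^sub>B n (\<Phi> x))"
proof -
  obtain h g k l b k' l' b' where "orbit_equivalence A B h g k l b k' l' b'"
    using exists_orbit_equivalence[OF assms(1-3)] by blast
  from orbit_equivalence.gauge_actions_cocycle_conjugate[OF this assms(4,5)]
  obtain \<phi> u where \<phi>: "star_iso \<phi>" and u: "continuous_on UNIV u" "\<And>t. u (t + 1) = u t" "\<And>s t. u (s + t) = u s * u t" "u 0 = 1"
     "\<And>t. star (u t) = u (- t)" "\<And>s t. gauge_action T s (u t) = u t"
     "\<And>t a. \<phi> (gauge_action S t a) = u t * gauge_action T t (\<phi> a) * u (- t)"
    by blast
  have \<phi>h: "star_hom \<phi>" and inv: "inv \<phi> (\<phi> x) = x" "\<phi> (inv \<phi> y) = y" for x y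
    using \<phi> by (auto simp: star_iso_def bij_is_inj bij_is_surj inv_f_f surj_f_inv_f)
  have Th: "star_hom (gauge_action T t)" for t
    using gauge_action(1)[OF assms(2,5)] by (simp add: star_iso_def)
  have uu: "u t * u (- t) = 1" "u (- t) * u t = 1" for t
    using u(3)[of t "-t"] u(3)[of "-t" t] by (simp_all add: u(4))
  have norm_u: "norm (x * u t) = norm x" for x t
  proof -
    \<comment> \<open>The C*-identity is applied to the adjoint so that \<open>u t\<close> and its
      inverse meet in the middle.\<close>
    have "norm (star (x * u t)) ^ 2 = norm (x * u t * star (x * u t))"
      using cstar_identity[of "star (x * u t)"] by (simp add: star_star)
    also have "x * u t * star (x * u t) = x * (u t * u (- t)) * star x" by (simp add: star_mult u(5) mult.assoc)
    also have "norm \<dots> = norm (star x) ^ 2" using cstar_identity[of "star x"] by (simp add: uu star_star)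
    finally show ?thesis by simp
  qed
  interpret fibre_isometries "gauge_action S" "gauge_action T" "\<lambda>t x. \<phi> x * u t" "\<lambda>t y. inv \<phi> (y * u (- t))"
  proof
    show "(\<lambda>t. \<phi> (f t) * u t) \<in> circle_functions" if "f \<in> circle_functions" for f
      using that unfolding circle_functions_def
      by (auto simp: u(2) intro!: continuous_on_mult u(1) continuous_on_compose2[OF star_iso_continuous[OF \<phi>]])
    show "(\<lambda>t. inv \<phi> (f t * u (- t))) \<in> circle_functions" if "f \<in> circle_functions" for f
    proof -
      have "u (- (t + 1)) = u (- t)" for t using u(2)[of "- t - 1"] by simp
      then show ?thesis
        using that unfolding circle_functions_def
        by (auto intro!: continuous_on_mult continuous_on_compose2[OF star_iso_continuous[OF star_iso_inv[OF \<phi>]]]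
            continuous_on_compose2[OF u(1)] continuous_intros)
    qed
    show "\<phi> (x * gauge_action S s y) * u t = \<phi> x * u s * gauge_action T s (\<phi> y * u (t - s))" for s t x y
    proof -
      \<comment> \<open>The cocycle identity for \<open>\<phi> (gauge_action S s y)\<close> leaves
        \<open>u (- s) * u t\<close> on the right; this element is fixed by the gauge action and may
        be moved inside it.\<close>
      have "u (- s) * u t = u (t - s)" using u(3)[of "-s" t] by simp
      then show ?thesis by (simp add: star_homD[OF \<phi>h] star_homD[OF Th] u(6,7) mult.assoc)
    qed
    show "\<phi> (gauge_action S t (star x)) * u t = gauge_action T t (star (\<phi> x * u (- t)))" for t x
      by (simp add: star_homD[OF \<phi>h] star_homD[OF Th] star_mult u(5,6,7) mult.assoc uu)
  qed (simp_all add: star_homD[OF \<phi>h] distrib_right mult_scaleC_left norm_u star_iso_norm[OF \<phi>] inv mult.assoc uu)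
  obtain \<Theta> where \<Theta>: "star_iso \<Theta>" "\<And>f. f \<in> circle_functions \<Longrightarrow> \<Theta> (\<iota>\<^sub>A f) = \<iota>\<^sub>B (\<lambda>t. \<phi> (f t) * u t)"
    using crossed_product_iso[OF assms(6,7) convolution_circle[OF assms(1,4)] involution_circle[OF assms(1,4)]] by blast
  \<comment> \<open>The fibre maps are complex linear, so they commute with multiplication by a
    character; on the dense image both compositions coincide.\<close>
  have "(\<lambda>x. \<Theta> (dual_action \<iota>\<^sub>A n x)) = (\<lambda>x. dual_action \<iota>\<^sub>B n (\<Theta> x))" for n
  proof (rule star_iso_eq_on_dense)
    note dA = dual_action[OF assms(1,4,6)] and dB = dual_action[OF assms(2,5,7)]
    show "star_iso (\<lambda>x. \<Theta> (dual_action \<iota>\<^sub>A n x))" by (rule star_iso_comp[OF \<Theta>(1) dA(1)])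
    show "star_iso (\<lambda>x. dual_action \<iota>\<^sub>B n (\<Theta> x))" by (rule star_iso_comp[OF dB(1) \<Theta>(1)])
    show "closure (\<iota>\<^sub>A ` circle_functions) = UNIV" using assms(6) by (simp add: crossed_product_def)
    fix x assume "x \<in> \<iota>\<^sub>A ` circle_functions"
    then obtain f where f: "f \<in> circle_functions" "x = \<iota>\<^sub>A f" by blast
    have cf: "(\<lambda>t. cis (- 2 * pi * of_int n * t) *\<^sub>C f t) \<in> circle_functions"
      using scale_circle_functions[OF f(1), of "- n"] by simp
    have "\<Theta> (dual_action \<iota>\<^sub>A n x) = \<iota>\<^sub>B (\<lambda>t. cis (- 2 * pi * of_int n * t) *\<^sub>C (\<phi> (f t) * u t))"
      unfolding f(2) dA(2)[OF f(1)] \<Theta>(2)[OF cf] by (simp add: star_homD[OF \<phi>h] mult_scaleC_left)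
    also have "\<dots> = dual_action \<iota>\<^sub>B n (\<Theta> x)"
      unfolding f(2) \<Theta>(2)[OF f(1)] using dB(2)[OF circle[OF f(1)]] by simp
    finally show "\<Theta> (dual_action \<iota>\<^sub>A n x) = dual_action \<iota>\<^sub>B n (\<Theta> x)" .
  qed
  then show ?thesis using \<Theta>(1) by (auto simp: fun_eq_iff)
qed

end
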